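(* Let $\mathcal{L}=(i_1,\ldots,i_k)$ be a signature with $i_k\ge1$ and let $\mathbf{X}=(X_t,t\ge0)$ be an exchangeable combinatorial Lévy process on $\mathcal{L}_{\mathbb{N}}$ with characteristic (rate) measure $\mu=\nu_0^*+\sum_{q=1}^{i_k}\sum_{\lambda\vdash q}\mu_\lambda^*$, decomposed as described in the context. Then the sample paths of $\|\mathbf{X}\|=(\|X_t\|,t\ge0)$ are continuous except possibly at the times of jumps from the $\nu_0^*$ measure.
   Context: Structures. A signature is a finite list $\mathcal{L}=(i_1,\ldots,i_k)$ of integers $0\le i_1\le\cdots\le i_k$. For $S\subseteq\mathbb{N}=\{1,2,\ldots\}$, an $\mathcal{L}$-structure over $S$ is $M=(S;M_1,\ldots,M_k)$ with $M_j\subseteq S^{i_j}$ (with $S^0:=\{\odot\}$ a one-point set); $\mathcal{L}_S$ is the set of these, $M_j(a)=\mathbf{1}\{a\in M_j\}$, $\mathbf{0}_S^{\mathcal{L}}=(S;\emptyset,\ldots,\emptyset)$. $M\triangle M'$ is the componentwise symmetric difference. $M|_{S'}=(S';M_1\cap S'^{i_1},\ldots,M_k\cap S'^{i_k})$; $[n]=\{1,\ldots,n\}$. For an injection $\varphi:S'\to S$ (in particular a permutation), $M^\varphi\in\mathcal{L}_{S'}$ has $(a_1,\ldots,a_{i_j})\in M_j^\varphi$ iff $(\varphi(a_1),\ldots,\varphi(a_{i_j}))\in M_j$. $\mathcal{L}_{\mathbb{N}}$ has the topology of $d(M,M')=1/(1+\sup\{n:M|_{[n]}=M'|_{[n]}\})$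 ($1/\infty=0$) and its Borel $\sigma$-field. Lévy processes. A combinatorial Lévy process on $\mathcal{L}_{\mathbb{N}}$ is a process $(X_t)_{t\ge0}$ with $X_0=\mathbf{0}^{\mathcal{L}}_{\mathbb{N}}$, $X_{t+s}\triangle X_s=_{\mathcal D}X_t$ for all $s,t\ge0$, independent increments $X_{t_1}\triangle X_{t_0},\ldots,X_{t_r}\triangle X_{t_{r-1}}$ ($0\le t_0\le\cdots\le t_r$), and càdlàg paths; it is exchangeable if $(X_t^\sigma)_{t\ge0}=_{\mathcal D}(X_t)_{t\ge0}$ (equality of finite-dimensional distributions) for all permutations $\sigma$ of $\mathbb{N}$. Its rate (characteristic) measure is the unique measure $\mu$ on $\mathcal{L}_{\mathbb{N}}$ with $\mu(\{\mathbf{0}^{\mathcal{L}}_{\mathbb{N}}\})=0$, $\mu(\{M:M|_{[n]}\ne\mathbf{0}^{\mathcal{L}}_{[n]}\})<\infty$ for all $n$, and $\frac1t\mathbb{P}\{X_t\in d\Delta\}\to\mu(d\Delta)$ vaguely on $\mathcal{L}_{\mathbb{N}}\setminus\{\mathbf{0}^{\mathcal{L}}_{\mathbb{N}}\}$ as $t\downarrow0$. Terminology of jumps. A combinatorial Lévy process with rate measure $\mu$ has the same finite-dimensional distributions as the $\mu$-canonical process built from a Poisson point process $\mathbf{\Delta}$ on $[0,\infty)\times\mathcal{L}_{\mathbb{N}}$ with intensity $dt\otimes\mu$: for each $n$, the restriction to $[n]$ starts at $\mathbf{0}^{\mathcal{L}}_{[n]}$, is changed at each atom $(t,\Delta_t)$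 with $\Delta_t|_{[n]}\ne\mathbf{0}^{\mathcal{L}}_{[n]}$ by taking $\triangle$ of its current value with $\Delta_t|_{[n]}$, and is constant otherwise. With $\mu$ decomposed as below, $\mathbf{\Delta}$ is the superposition of independent Poisson point processes $\mathbf{\Delta}_0$ of intensity $dt\otimes\nu_0^*$ and $\mathbf{\Delta}_\lambda$ of intensity $dt\otimes\mu_\lambda^*$; the jumps from the $\nu_0^*$ measure are those corresponding to the atoms of $\mathbf{\Delta}_0$. Limits. For $A\in\mathcal{L}_{[m]}$, $M\in\mathcal{L}_{\mathbb{N}}$: $\delta(A;M)=\lim_{n\to\infty}\frac{1}{n(n-1)\cdots(n-m+1)}\sum_{\varphi:[m]\to[n]\text{ injective}}\mathbf{1}\{(M|_{[n]})^\varphi=A\}$, if it exists. If all $\delta(A;M)$ exist, the combinatorial limit $\|M\|$ is the unique probability measure on $\mathcal{L}_{\mathbb{N}}$ with $\|M\|(\{A^*:A^*|_{[m]}=A\})=\delta(A;M)$ for $A\in\mathcal{L}_{[m]}$, $m\in\mathbb{N}$. For exchangeable combinatorial Lévy processes, $\|\mathbf{X}\|=(\|X_t\|,t\ge0)$ exists almost surely. $\mathcal{E}_{\mathcal{L}}$ is the space of probability measures on $\mathcal{L}_{\mathbb{N}}$ that are exchangeable (invariant under $M\mapsto M^\sigma$ for all permutations $\sigma$ of $\mathbb{N}$) and dissociated (under which $M|_T$ and $M|_{T'}$ are independent for disjoint $T,T'$), with metric $\sum_n2^{-n}\sum_{A\in\mathcal{L}_{[n]}}|W(A)-W'(A)|$,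 $W(A)=W(\{A\}):=W(\{A^*:A^*|_{[n]}=A\})$ for $A\in\mathcal{L}_{[n]}$. $\mathbf{0}_{\mathcal{L}}\in\mathcal{E}_{\mathcal{L}}$ is the point mass at $\mathbf{0}^{\mathcal{L}}_{\mathbb{N}}$. For a measure $\nu$ on $\mathcal{E}_{\mathcal{L}}$, $\nu^*(\mathcal{B})=\int_{\mathcal{E}_{\mathcal{L}}} W(\mathcal{B})\,\nu(dW)$. Decomposition. It is known that the rate measure $\mu$ of an exchangeable combinatorial Lévy process on $\mathcal{L}_{\mathbb{N}}$ can be written $\mu=\nu_0^*+\sum_{q=1}^{i_k}\sum_{\lambda\vdash q}\mu_\lambda^*$ (inner sum over partitions $\lambda$ of the integer $q$), where $\nu_0$ is a unique measure on $\mathcal{E}_{\mathcal{L}}$ with $\nu_0(\{\mathbf{0}_{\mathcal{L}}\})=0$ and $\int(1-W(\{\mathbf{0}^{\mathcal{L}}_{[i_k]}\}))\nu_0(dW)<\infty$, and each $\mu_\lambda$ is a measure on $\mathcal{L}_{\mathbb{N}}$ with (i) $\mu_\lambda(\{\mathbf{0}^{\mathcal{L}}_{\mathbb{N}}\})=0$ and $\mu_\lambda(\{M:M|_{[n]}\ne\mathbf{0}^{\mathcal{L}}_{[n]}\})<\infty$ for all $n$; (ii) $M^*_{s_\lambda}=M$ for $\mu_\lambda$-a.e. $M$; (iii) $s_M=s_\lambda$ for $\mu_\lambda$-a.e. $M$. The notation is as follows. Multisets. A finite multiset $s=\{s_1^{m_1},\ldots,s_r^{m_r}\}$ of $\mathbb{N}$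 has distinct elements $\{s\}=\{s_1<\cdots<s_r\}$ with multiplicities $m_i\ge1$; $|s|=\sum m_i$; $s\preceq s'$ means every element has multiplicity in $s$ at most that in $s'$; $s\cap s'$ takes minimum multiplicities. A tuple $a\in\mathbb{N}^{i}$ is identified, when needed, with the multiset of its entries ($|a|=i$). $\lambda(s)$ is the partition of $|s|$ obtained by listing the multiplicities in nonincreasing order. For $\lambda=(\lambda_1\ge\cdots\ge\lambda_r\ge1)\vdash q$, $s_\lambda=\{1^{\lambda_1},\ldots,r^{\lambda_r}\}$. Substructures. $M^*_s=(\mathbb{N};M^*_{s,1},\ldots,M^*_{s,k})$ where for $a\in\mathbb{N}^{i_j}$, $M^*_{s,j}(a)=M_j(a)$ if ($|a|\le|s|$, $a\preceq s$ and $\{a\}=\{s\}$) or if ($|a|>|s|$ and $s\preceq a$), and $M^*_{s,j}(a)=0$ otherwise. Limits of substructures. Let $q=|s|$ and $\lambda(s)=(\lambda_1,\ldots,\lambda_r)$. For $j$ with $i_j\ge q$, let $w_1,\ldots,w_{k_j}$ (any fixed order), $k_j=\binom{i_j}{q}q!/\prod_l\lambda_l!$, be the words of length $i_j$ with exactly $i_j-q$ entries $*$ and whose remaining entries form the multiset $s$. Encode $M^*_{s,j}$ as the structure $(\mathbb{N};M^*_{s,j,1},\ldots,M^*_{s,j,k_j})$ of signature $(i_j-q,\ldots,i_j-q)$, where $b\in M^*_{s,j,l}$ iff the tuple obtained by replacing the $*$'s of $w_l$ from left to right by the entries of $b$ belongs to $M_j$; $\|M^*_{s,j}\|$ denotes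 its combinatorial limit. If $i_j<q$, $M^*_{s,j}$ is the null structure (empty signature), whose limit is by definition the zero limit for that signature. $\|M\|_s=(\|M^*_{s,1}\|,\ldots,\|M^*_{s,k}\|)$, and $\|M\|_s=\mathbf{0}$ iff for every $j$ the limit $\|M^*_{s,j}\|$ is the point mass at the empty structure of its signature (automatic when $i_j<q$). When $\|M\|_{s'}$ exists for all finite multisets $s'$ of $\mathbb{N}$, $s_M:=\bigcap\{s':\|M\|_{s'}\ne\mathbf{0}\}$. Symmetrized measures. For $s$ with $\lambda(s)=\lambda=(\lambda_1,\ldots,\lambda_r)$, write $s=\{\tilde s_1^{\lambda_1},\ldots,\tilde s_r^{\lambda_r}\}$ with $\tilde s_i<\tilde s_{i+1}$ whenever $\lambda_i=\lambda_{i+1}$, and define the canonical mapping $\sigma_{s,\lambda}:[r]\to\{s\}$ by $\sigma_{s,\lambda}(i)=\tilde s_i$, $i=1,\ldots,r$. Then $\mu_\lambda^*(\cdot)=\sum_{s\subset\mathbb{N}:\lambda(s)=\lambda}\mu_\lambda(\{M\in\mathcal{L}_{\mathbb{N}}:M^{\sigma_{s,\lambda}^{-1}}\in\cdot\})$ (sum over finite multisets $s$ of $\mathbb{N}$), where $M^{\sigma_{s,\lambda}^{-1}}$ is the relabeling of $M$ by $\sigma_{s,\lambda}^{-1}$, sending label $i$ to $\tilde s_i$ for $i\le r$; the source specifies $\sigma_{s,\lambda}$ only by these values on $[r]$. *)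

theory Defs
  imports "HOL-Probability.Probability"
begin

section \<open>Structures\<close>

text \<open>A signature is a list of arities.  Tuples are lists, so that \<open>S\<^sup>0 = {[]}\<close> is a one-point set, and
  a structure is the list of its relations.  The base set \<open>S\<close> is not stored; it is the second
  argument of \<open>structs\<close>.  The label set is \<open>{0<..}\<close>, and \<open>{1..n}\<close> plays the role of \<open>[n]\<close>.\<close>

type_synonym signature = "nat list"
type_synonym rel_struct = "nat list set list"

definition structs :: "signature \<Rightarrow> nat set \<Rightarrow> rel_struct set" where
  "structs sig S = {M. list_all2 (\<lambda>R i. R \<subseteq> {a. length a = i \<and> set a \<subseteq> S}) M sig}"

definition zero_struct :: "signature \<Rightarrow> rel_struct" where
  "zero_struct sig = map (\<lambda>_. {}) sig"

definition symdiff :: "rel_struct \<Rightarrow> rel_struct \<Rightarrow> rel_struct" where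
  "symdiff M M' = map2 (\<lambda>R R'. sym_diff R R') M M'"

definition restr :: "nat set \<Rightarrow> rel_struct \<Rightarrow> rel_struct" where
  "restr S M = map (\<lambda>R. {a \<in> R. set a \<subseteq> S}) M"

text \<open>\<open>relabel S' \<phi> M\<close> is \<open>M\<^sup>\<phi>\<close>, a structure over \<open>S'\<close>, for an injection \<open>\<phi>\<close> defined on \<open>S'\<close>.\<close>

definition relabel :: "nat set \<Rightarrow> (nat \<Rightarrow> nat) \<Rightarrow> rel_struct \<Rightarrow> rel_struct" where
  "relabel S' \<phi> M = map (\<lambda>R. {a. set a \<subseteq> S' \<and> map \<phi> a \<in> R}) M"

text \<open>For \<open>M \<noteq> M'\<close> the supremum is that of a finite set of naturals, equal to 0 if the set is empty.\<close>

definition struct_dist :: "rel_struct \<Rightarrow> rel_struct \<Rightarrow> real" where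
  "struct_dist M M' =
     (if M = M' then 0 else 1 / (1 + real (Sup {n. restr {1..n} M = restr {1..n} M'})))"

definition LN_top :: "signature \<Rightarrow> rel_struct topology" where
  "LN_top sig = Metric_space.mtopology (structs sig {0<..}) struct_dist"

definition LN_borel :: "signature \<Rightarrow> rel_struct measure" where
  "LN_borel sig = sigma (structs sig {0<..}) {U. openin (LN_top sig) U}"

definition LN_perms :: "(nat \<Rightarrow> nat) set" where
  "LN_perms = {\<sigma>. bij_betw \<sigma> {0<..} {0<..}}"

section \<open>Combinatorial limits\<close>

definition inj_density :: "nat \<Rightarrow> rel_struct \<Rightarrow> rel_struct \<Rightarrow> nat \<Rightarrow> real" where
  "inj_density m A M n =
     real (card {\<phi> \<in> {1..m} \<rightarrow>\<^sub>E {1..n}. inj_on \<phi> {1..m} \<and> relabel {1..m} \<phi> (restr {1..n} M) = A})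
       / (\<Prod>i<m. real n - real i)"

definition cyl :: "signature \<Rightarrow> nat \<Rightarrow> rel_struct \<Rightarrow> rel_struct set" where
  "cyl sig m A = {M \<in> structs sig {0<..}. restr {1..m} M = A}"

definition climit_exists :: "signature \<Rightarrow> rel_struct \<Rightarrow> bool" where
  "climit_exists sig M \<longleftrightarrow> (\<forall>m\<ge>1. \<forall>A \<in> structs sig {1..m}. convergent (inj_density m A M))"

text \<open>The combinatorial limit \<open>\<parallel>M\<parallel>\<close>; meaningful only if \<open>climit_exists sig M\<close>.\<close>

definition climit :: "signature \<Rightarrow> rel_struct \<Rightarrow> rel_struct measure" where
  "climit sig M = (THE W. W \<in> space (prob_algebra (LN_borel sig)) \<and>
     (\<forall>m\<ge>1. \<forall>A \<in> structs sig {1..m}. measure W (cyl sig m A) = lim (inj_density m A M)))"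

text \<open>The space of exchangeable dissociated laws.  A restriction \<open>M|\<^sub>T\<close> is regarded as the element of
  \<open>structs sig {0<..}\<close> with the same relations.\<close>

definition E_space :: "signature \<Rightarrow> rel_struct measure set" where
  "E_space sig = {W \<in> space (prob_algebra (LN_borel sig)).
     (\<forall>\<sigma>\<in>LN_perms. distr W (LN_borel sig) (relabel {0<..} \<sigma>) = W) \<and>
     (\<forall>T T'. T \<subseteq> {0<..} \<and> T' \<subseteq> {0<..} \<and> T \<inter> T' = {} \<longrightarrow>
        prob_space.indep_var W (LN_borel sig) (restr T) (LN_borel sig) (restr T'))}"

definition limit_dist :: "signature \<Rightarrow> rel_struct measure \<Rightarrow> rel_struct measure \<Rightarrow> real" where
  "limit_dist sig W W' = (\<Sum>\<^sub>\<infinity>n\<in>{0<..}. (1/2)^n *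
     (\<Sum>A\<in>structs sig {1..n}. \<bar>measure W (cyl sig n A) - measure W' (cyl sig n A)\<bar>))"

definition E_top :: "signature \<Rightarrow> rel_struct measure topology" where
  "E_top sig = Metric_space.mtopology (E_space sig) (limit_dist sig)"

definition E_borel :: "signature \<Rightarrow> rel_struct measure measure" where
  "E_borel sig = sigma (E_space sig) {U. openin (E_top sig) U}"

definition zero_limit :: "signature \<Rightarrow> rel_struct measure" where
  "zero_limit sig = return (LN_borel sig) (zero_struct sig)"

text \<open>The mixture \<open>\<nu>\<^sup>*\<close>.\<close>

definition mixture :: "signature \<Rightarrow> rel_struct measure measure \<Rightarrow> rel_struct measure" where
  "mixture sig \<nu> = measure_of (space (LN_borel sig)) (sets (LN_borel sig)) (\<lambda>B. \<integral>\<^sup>+W. emeasure W B \<partial>\<nu>)"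

section \<open>Exchangeable combinatorial Levy processes and rate measures\<close>

definition cadlag_path :: "signature \<Rightarrow> (real \<Rightarrow> rel_struct) \<Rightarrow> bool" where
  "cadlag_path sig x \<longleftrightarrow> (\<forall>t\<ge>0. limitin (LN_top sig) x (x t) (at_right t)) \<and>
     (\<forall>t>0. \<exists>l. limitin (LN_top sig) x l (at_left t))"

definition comb_Levy_process :: "'w measure \<Rightarrow> signature \<Rightarrow> (real \<Rightarrow> 'w \<Rightarrow> rel_struct) \<Rightarrow> bool" where
  "comb_Levy_process P sig X \<longleftrightarrow> prob_space P \<and>
     (\<forall>t\<ge>0. X t \<in> measurable P (LN_borel sig)) \<and>
     (AE \<omega> in P. X 0 \<omega> = zero_struct sig) \<and>
     (\<forall>s\<ge>0. \<forall>t\<ge>0. distr P (LN_borel sig) (\<lambda>\<omega>. symdiff (X (t + s) \<omega>) (X s \<omega>)) = distr P (LN_borel sig) (X t)) \<and>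
     (\<forall>r. \<forall>t::nat \<Rightarrow> real. 0 \<le> t 0 \<and> (\<forall>i<r. t i \<le> t (Suc i)) \<longrightarrow>
        prob_space.indep_vars P (\<lambda>_. LN_borel sig) (\<lambda>i \<omega>. symdiff (X (t (Suc i)) \<omega>) (X (t i) \<omega>)) {..<r}) \<and>
     (AE \<omega> in P. cadlag_path sig (\<lambda>t. X t \<omega>))"

definition exchangeable_process :: "'w measure \<Rightarrow> signature \<Rightarrow> (real \<Rightarrow> 'w \<Rightarrow> rel_struct) \<Rightarrow> bool" where
  "exchangeable_process P sig X \<longleftrightarrow> (\<forall>\<sigma>\<in>LN_perms. \<forall>J. finite J \<and> J \<subseteq> {0..} \<longrightarrow>
     distr P (\<Pi>\<^sub>M t\<in>J. LN_borel sig) (\<lambda>\<omega>. \<lambda>t\<in>J. relabel {0<..} \<sigma> (X t \<omega>)) =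
     distr P (\<Pi>\<^sub>M t\<in>J. LN_borel sig) (\<lambda>\<omega>. \<lambda>t\<in>J. X t \<omega>))"

text \<open>\<open>\<mu>\<close> is a measure without mass at the empty structure that is finite on structures which are
  nonempty on \<open>[n]\<close>.\<close>

definition finite_off_zero :: "signature \<Rightarrow> rel_struct measure \<Rightarrow> bool" where
  "finite_off_zero sig \<mu> \<longleftrightarrow> sets \<mu> = sets (LN_borel sig) \<and> emeasure \<mu> {zero_struct sig} = 0 \<and>
     (\<forall>n. emeasure \<mu> {M \<in> structs sig {0<..}. restr {1..n} M \<noteq> zero_struct sig} < \<infinity>)"

text \<open>Vague convergence is tested against the continuous functions with compact support in the
  complement of the empty structure, extended by 0 to that point.\<close>

definition rate_measure ::
    "'w measure \<Rightarrow> signature \<Rightarrow> (real \<Rightarrow> 'w \<Rightarrow> rel_struct) \<Rightarrow> rel_struct measure \<Rightarrow> bool" where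
  "rate_measure P sig X \<mu> \<longleftrightarrow> finite_off_zero sig \<mu> \<and>
     (\<forall>f :: rel_struct \<Rightarrow> real. \<forall>K.
        let Y = subtopology (LN_top sig) (structs sig {0<..} - {zero_struct sig})
        in continuous_map Y euclidean f \<and> compactin Y K \<and> (\<forall>M. M \<notin> K \<longrightarrow> f M = 0) \<longrightarrow>
          ((\<lambda>t. (1 / t) * (\<integral>\<omega>. f (X t \<omega>) \<partial>P)) \<longlongrightarrow> (\<integral>M. f M \<partial>\<mu>)) (at_right 0))"

section \<open>Multisets, substructures and their limits\<close>

definition label_multisets :: "nat multiset set" where
  "label_multisets = {s. set_mset s \<subseteq> {0<..}}"

definition int_partitions :: "nat \<Rightarrow> nat list set" where
  "int_partitions q = {l. sorted_wrt (\<ge>) l \<and> 0 \<notin> set l \<and> sum_list l = q}"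

text \<open>\<open>\<lambda>(s)\<close> and \<open>s\<^sub>\<lambda>\<close>.\<close>

definition mult_partition :: "nat multiset \<Rightarrow> nat list" where
  "mult_partition s = rev (sorted_list_of_multiset (image_mset (count s) (mset_set (set_mset s))))"

definition canon_mset :: "nat list \<Rightarrow> nat multiset" where
  "canon_mset l = (\<Sum>i<length l. replicate_mset (l ! i) (Suc i))"

text \<open>\<open>M\<^sup>*\<^sub>s\<close>.\<close>

definition substruct :: "nat multiset \<Rightarrow> rel_struct \<Rightarrow> rel_struct" where
  "substruct s M = map (\<lambda>R. {a \<in> R.
     (length a \<le> size s \<and> mset a \<subseteq># s \<and> set a = set_mset s) \<or>
     (length a > size s \<and> s \<subseteq># mset a)}) M"

text \<open>In a word, \<open>None\<close> stands for the symbol \<open>*\<close>; \<open>fill_word w b\<close> replaces these symbols from left to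
  right by the entries of \<open>b\<close>.\<close>

fun fill_word :: "nat option list \<Rightarrow> nat list \<Rightarrow> nat list" where
  "fill_word [] b = []"
| "fill_word (Some x # w) b = x # fill_word w b"
| "fill_word (None # w) (y # b) = y # fill_word w b"
| "fill_word (None # w) [] = []"

definition words :: "nat \<Rightarrow> nat multiset \<Rightarrow> nat option list list" where
  "words i s = (SOME ws. distinct ws \<and>
     set ws = {w. mset w = replicate_mset (i - size s) None + image_mset Some s})"

text \<open>Signature and encoding of \<open>M\<^sup>*\<^sub>s\<^sub>,\<^sub>j\<close>, where \<open>i\<close> is the arity of the \<open>j\<close>-th relation \<open>R\<close> and
  \<open>i \<ge> size s\<close>.\<close>

definition code_sig :: "nat \<Rightarrow> nat multiset \<Rightarrow> signature" where
  "code_sig i s = map (\<lambda>_. i - size s) (words i s)"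

definition code_struct :: "nat \<Rightarrow> nat multiset \<Rightarrow> nat list set \<Rightarrow> rel_struct" where
  "code_struct i s R =
     map (\<lambda>w. {b. length b = i - size s \<and> set b \<subseteq> {0<..} \<and> fill_word w b \<in> R}) (words i s)"

text \<open>Existence of \<open>\<parallel>M\<parallel>\<^sub>s\<close>, and \<open>\<parallel>M\<parallel>\<^sub>s = 0\<close>.  Relations of arity below \<open>size s\<close> contribute the null
  structure, whose limit is the zero limit.\<close>

definition sub_climit_exists :: "signature \<Rightarrow> nat multiset \<Rightarrow> rel_struct \<Rightarrow> bool" where
  "sub_climit_exists sig s M \<longleftrightarrow> (\<forall>j<length sig. size s \<le> sig ! j \<longrightarrow>
     climit_exists (code_sig (sig ! j) s) (code_struct (sig ! j) s (M ! j)))"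

definition sub_climit_zero :: "signature \<Rightarrow> nat multiset \<Rightarrow> rel_struct \<Rightarrow> bool" where
  "sub_climit_zero sig s M \<longleftrightarrow> (\<forall>j<length sig. size s \<le> sig ! j \<longrightarrow>
     climit (code_sig (sig ! j) s) (code_struct (sig ! j) s (M ! j)) = zero_limit (code_sig (sig ! j) s))"

text \<open>\<open>s\<^sub>M\<close>; the library sets the intersection of an empty family of multisets to the empty multiset.\<close>

definition support_mset :: "signature \<Rightarrow> rel_struct \<Rightarrow> nat multiset" where
  "support_mset sig M = Inf {s \<in> label_multisets. \<not> sub_climit_zero sig s M}"

section \<open>Decomposition of the rate measure\<close>

text \<open>The permutation \<open>\<tau>\<close> of the labels extends the canonical mapping \<open>\<sigma>\<^sub>s\<^sub>,\<^sub>\<lambda>\<close> with \<open>\<lambda> = \<lambda>(s)\<close>, which is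
  determined on \<open>{1..r}\<close> only.\<close>

definition extends_canonical :: "nat multiset \<Rightarrow> (nat \<Rightarrow> nat) \<Rightarrow> bool" where
  "extends_canonical s \<tau> \<longleftrightarrow> \<tau> \<in> LN_perms \<and>
     (let l = mult_partition s; r = length l
      in \<tau> ` {1..r} = set_mset s \<and>
         (\<forall>i\<in>{1..r}. count s (\<tau> i) = l ! (i - 1)) \<and>
         (\<forall>i\<in>{1..<r}. l ! (i - 1) = l ! i \<longrightarrow> \<tau> i < \<tau> (Suc i)))"

text \<open>\<open>\<mu>\<^sub>\<lambda>\<^sup>*\<close>, for a choice \<open>\<tau>\<close> of extensions of the canonical mappings.\<close>

definition symmetrized ::
    "signature \<Rightarrow> (nat multiset \<Rightarrow> nat \<Rightarrow> nat) \<Rightarrow> nat list \<Rightarrow> rel_struct measure \<Rightarrow> rel_struct measure" where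
  "symmetrized sig \<tau> l m = measure_of (space (LN_borel sig)) (sets (LN_borel sig))
     (\<lambda>B. \<integral>\<^sup>+s. emeasure m {M \<in> structs sig {0<..}. relabel {0<..} (inv_into {0<..} (\<tau> s)) M \<in> B}
        \<partial>count_space {s \<in> label_multisets. mult_partition s = l})"

definition rate_decomposition ::
    "signature \<Rightarrow> (nat multiset \<Rightarrow> nat \<Rightarrow> nat) \<Rightarrow> rel_struct measure \<Rightarrow>
     rel_struct measure measure \<Rightarrow> (nat list \<Rightarrow> rel_struct measure) \<Rightarrow> bool" where
  "rate_decomposition sig \<tau> \<mu> \<nu>\<^sub>0 m \<longleftrightarrow>
     sets \<nu>\<^sub>0 = sets (E_borel sig) \<and> emeasure \<nu>\<^sub>0 {zero_limit sig} = 0 \<and>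
     (\<integral>\<^sup>+W. ennreal (1 - measure W (cyl sig (last sig) (zero_struct sig))) \<partial>\<nu>\<^sub>0) < \<infinity> \<and>
     (\<forall>q\<in>{1..last sig}. \<forall>l\<in>int_partitions q.
        finite_off_zero sig (m l) \<and>
        (AE M in m l. substruct (canon_mset l) M = M) \<and>
        (AE M in m l. (\<forall>s\<in>label_multisets. sub_climit_exists sig s M) \<and> support_mset sig M = canon_mset l)) \<and>
     (\<forall>s\<in>label_multisets. extends_canonical s (\<tau> s)) \<and>
     sets \<mu> = sets (LN_borel sig) \<and>
     (\<forall>B\<in>sets (LN_borel sig). emeasure \<mu> B = emeasure (mixture sig \<nu>\<^sub>0) B +
        (\<Sum>q\<in>{1..last sig}. \<Sum>l\<in>int_partitions q. emeasure (symmetrized sig \<tau> l (m l)) B))"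

section \<open>Poisson point processes and the canonical process\<close>

text \<open>A point process is represented by its random set of atoms, which suffices for intensities
  without point masses, such as \<open>dt \<otimes> \<mu>\<close>.\<close>

definition num_atoms :: "'a set \<Rightarrow> ennreal" where
  "num_atoms A = emeasure (count_space UNIV) A"

definition poisson_point_process :: "'w measure \<Rightarrow> 'a measure \<Rightarrow> ('w \<Rightarrow> 'a set) \<Rightarrow> bool" where
  "poisson_point_process P m D \<longleftrightarrow>
     (\<forall>\<omega>\<in>space P. D \<omega> \<subseteq> space m) \<and>
     (\<forall>B\<in>sets m. (\<lambda>\<omega>. num_atoms (D \<omega> \<inter> B)) \<in> borel_measurable P) \<and>
     (\<forall>B\<in>sets m. if emeasure m B < \<infinity>
        then \<forall>k::nat. measure P {\<omega> \<in> space P. num_atoms (D \<omega> \<inter> B) = of_nat k} =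
               exp (- measure m B) * measure m B ^ k / fact k
        else AE \<omega> in P. num_atoms (D \<omega> \<inter> B) = \<infinity>) \<and>
     (\<forall>r. \<forall>B :: nat \<Rightarrow> 'a set. (\<forall>i<r. B i \<in> sets m) \<and> disjoint_family_on B {..<r} \<longrightarrow>
        prob_space.indep_vars P (\<lambda>_. borel) (\<lambda>i \<omega>. num_atoms (D \<omega> \<inter> B i)) {..<r})"

definition atoms_algebra :: "'w measure \<Rightarrow> 'a measure \<Rightarrow> ('w \<Rightarrow> 'a set) \<Rightarrow> 'w set set" where
  "atoms_algebra P m D = sigma_sets (space P)
     {{\<omega> \<in> space P. num_atoms (D \<omega> \<inter> B) \<in> C} | B C. B \<in> sets m \<and> C \<in> sets borel}"

definition time_intensity :: "rel_struct measure \<Rightarrow> (real \<times> rel_struct) measure" where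
  "time_intensity \<mu> = restrict_space lborel {0..} \<Otimes>\<^sub>M \<mu>"

definition jump_partitions :: "signature \<Rightarrow> nat list set" where
  "jump_partitions sig = (\<Union>q\<in>{1..last sig}. int_partitions q)"

text \<open>\<open>D\<^sub>0\<close> and \<open>D l\<close>, for \<open>l\<close> in \<open>jump_partitions sig\<close>, are independent Poisson point processes with
  intensities \<open>dt \<otimes> \<nu>\<^sub>0\<^sup>*\<close> and \<open>dt \<otimes> \<mu>\<^sub>\<lambda>\<^sup>*\<close>; in the index type, \<open>None\<close> belongs to \<open>D\<^sub>0\<close>.\<close>

definition driving_processes ::
    "'w measure \<Rightarrow> signature \<Rightarrow> (nat multiset \<Rightarrow> nat \<Rightarrow> nat) \<Rightarrow>
     rel_struct measure measure \<Rightarrow> (nat list \<Rightarrow> rel_struct measure) \<Rightarrow>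
     ('w \<Rightarrow> (real \<times> rel_struct) set) \<Rightarrow> (nat list \<Rightarrow> 'w \<Rightarrow> (real \<times> rel_struct) set) \<Rightarrow> bool" where
  "driving_processes P sig \<tau> \<nu>\<^sub>0 m D\<^sub>0 D \<longleftrightarrow>
     (let I = insert None (Some ` jump_partitions sig);
          N = (\<lambda>i. time_intensity (case i of None \<Rightarrow> mixture sig \<nu>\<^sub>0 | Some l \<Rightarrow> symmetrized sig \<tau> l (m l)));
          F = (\<lambda>i. case i of None \<Rightarrow> D\<^sub>0 | Some l \<Rightarrow> D l)
      in (\<forall>i\<in>I. poisson_point_process P (N i) (F i)) \<and>
         prob_space.indep_sets P (\<lambda>i. atoms_algebra P (N i) (F i)) I)"

text \<open>\<open>x\<close> is the path of the canonical process built from the atoms \<open>(t, \<Delta>\<^sub>t)\<close> in \<open>A\<close>.  Almost surely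
  there is no atom at time 0, and no two atoms have the same time.\<close>

definition canonical_path ::
    "signature \<Rightarrow> (real \<times> rel_struct) set \<Rightarrow> (real \<Rightarrow> rel_struct) \<Rightarrow> bool" where
  "canonical_path sig A x \<longleftrightarrow> (\<forall>n.
     restr {1..n} (x 0) = zero_struct sig \<and>
     (\<forall>t>0. \<forall>M. (t, M) \<in> A \<and> restr {1..n} M \<noteq> zero_struct sig \<longrightarrow>
        (\<forall>\<^sub>F s in at_left t. restr {1..n} (x t) = symdiff (restr {1..n} (x s)) (restr {1..n} M))) \<and>
     (\<forall>s\<ge>0. \<forall>t\<ge>s. (\<forall>u M. s < u \<and> u \<le> t \<and> (u, M) \<in> A \<longrightarrow> restr {1..n} M = zero_struct sig) \<longrightarrow>
        restr {1..n} (x t) = restr {1..n} (x s)))"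

section \<open>The distances are metrics\<close>

lemma restr_eq_mono:
  assumes "restr {1..n} M = restr {1..n} M'" "k \<le> n"
  shows "restr {1..k} M = restr {1..k} M'"
proof -
  have "restr {1..k} N = restr {1..k} (restr {1..n} N)" for N
    unfolding restr_def using assms(2) by (auto simp: subset_iff)
  then show ?thesis using assms(1) by metis
qed

lemma structs_eqI:
  assumes "M \<in> structs sig {0<..}" "M' \<in> structs sig {0<..}"
    and eq: "\<And>n. restr {1..n} M = restr {1..n} M'"
  shows "M = M'"
proof (rule nth_equalityI)
  show len: "length M = length M'"
    using assms(1,2) by (auto simp: structs_def dest!: list_all2_lengthD)
  fix j assume j: "j < length M"
  have sub: "N ! j \<subseteq> {a. set a \<subseteq> {0<..}}" if "N \<in> structs sig {0<..}" "j < length N" for N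
    using that by (auto simp: structs_def list_all2_conv_all_nth subset_iff)
  have "a \<in> M ! j \<longleftrightarrow> a \<in> M' ! j" if "set a \<subseteq> {0<..}" for a
  proof -
    have "set a \<subseteq> {1..Max (insert 0 (set a))}"
      using that by (auto simp: subset_iff)
    moreover have "restr {1..Max (insert 0 (set a))} M ! j = restr {1..Max (insert 0 (set a))} M' ! j"
      using eq by simp
    ultimately show ?thesis using j len by (auto simp: restr_def)
  qed
  then show "M ! j = M' ! j"
    using sub[OF assms(1)] sub[OF assms(2)] j len by (metis (no_types, lifting) mem_Collect_eq set_eqI subsetD)
qed

lemma struct_dist_less_iff:
  assumes "M \<in> structs sig {0<..}" "M' \<in> structs sig {0<..}"
    and "M \<noteq> M'"
  shows "struct_dist M M' \<le> 1 / (1 + real n) \<longleftrightarrow> n = 0 \<or> restr {1..n} M = restr {1..n} M'"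
proof -
  define A where "A = {n. restr {1..n} M = restr {1..n} M'}"
  obtain N where N: "N \<notin> A" using structs_eqI[OF assms(1,2)] assms(3) A_def by auto
  have down: "k \<in> A" if "n \<in> A" "k \<le> n" for n k
    using restr_eq_mono that unfolding A_def by blast
  have fin: "finite A"
    by (rule finite_subset[of _ "{..N}"]) (use down N in \<open>auto intro: nat_le_linear simp: not_le[symmetric]\<close>, metis down linear)
  have "n \<le> Sup A \<longleftrightarrow> n = 0 \<or> n \<in> A"
  proof (cases "A = {}")
    case True then show ?thesis by (simp add: Sup_nat_def)
  next
    case False
    then have "Sup A \<in> A" "\<And>k. k \<in> A \<Longrightarrow> k \<le> Sup A"
      using fin by (auto simp: Sup_nat_def)
    then show ?thesis using down False by blast
  qed
  then show ?thesis using assms(3) unfolding struct_dist_def A_def[symmetric]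
    by (auto simp: A_def divide_simps)
qed

lemma Metric_space_structs: "Metric_space (structs sig {0<..}) struct_dist"
proof
  show "0 \<le> struct_dist x y" for x y by (auto simp: struct_dist_def)
  show "struct_dist x y = struct_dist y x" for x y
    by (auto simp: struct_dist_def eq_commute[of "restr _ x" "restr _ y"])
  show "struct_dist x y = 0 \<longleftrightarrow> x = y" for x y
    by (auto simp: struct_dist_def add_nonneg_eq_0_iff)
  fix x y z assume S: "x \<in> structs sig {0<..}" "y \<in> structs sig {0<..}" "z \<in> structs sig {0<..}"
  show "struct_dist x z \<le> struct_dist x y + struct_dist y z"
  proof (cases "x = y \<or> y = z \<or> x = z")
    case True then show ?thesis by (auto simp: struct_dist_def)
  next
    case False
    define n where "n = Sup {n. restr {1..n} x = restr {1..n} y}"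
    define k where "k = Sup {n. restr {1..n} y = restr {1..n} z}"
    have xy: "struct_dist x y = 1 / (1 + real n)" and yz: "struct_dist y z = 1 / (1 + real k)"
      using False by (auto simp: struct_dist_def n_def k_def)
    have "struct_dist x z \<le> 1 / (1 + real (min n k))"
      using struct_dist_less_iff[OF S(1,2), of n] struct_dist_less_iff[OF S(2,3), of k]
        struct_dist_less_iff[OF S(1,3), of "min n k"] False xy yz
        restr_eq_mono[of n x y "min n k"] restr_eq_mono[of k y z "min n k"] by force
    also have "\<dots> \<le> 1 / (1 + real n) + 1 / (1 + real k)"
      by (auto simp: min_def)
    finally show ?thesis using xy yz by simp
  qed
qed

lemma finite_structs: "finite S \<Longrightarrow> finite (structs sig S)"
proof (induction sig)
  case Nil then show ?case by (simp add: structs_def)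
next
  case (Cons i sig)
  have "structs (i # sig) S = (\<lambda>(R, M). R # M) ` (Pow {a. length a = i \<and> set a \<subseteq> S} \<times> structs sig S)"
    by (auto simp: structs_def list_all2_Cons2 image_iff)
  moreover have "finite {a. set a \<subseteq> S \<and> length a = i}" 
    using Cons.prems by (rule finite_lists_length_eq)
  ultimately show ?case using Cons by (auto simp: conj_commute)
qed

lemma restr_in_structs: "M \<in> structs sig {0<..} \<Longrightarrow> restr {1..n} M \<in> structs sig {1..n}"
  by (auto simp: structs_def restr_def list_all2_conv_all_nth)

lemma LN_open_iff:
  "openin (LN_top sig) U \<longleftrightarrow> U \<subseteq> structs sig {0<..} \<and>
     (\<forall>M\<in>U. \<exists>n. cyl sig n (restr {1..n} M) \<subseteq> U)"
proof -
  interpret Metric_space "structs sig {0<..}" struct_dist by (rule Metric_space_structs)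
  have "(\<exists>r>0. mball M r \<subseteq> U) \<longleftrightarrow> (\<exists>n. cyl sig n (restr {1..n} M) \<subseteq> U)"
    if U: "U \<subseteq> structs sig {0<..}" "M \<in> U" for M
  proof
    have M: "M \<in> structs sig {0<..}" using U by auto
    {
      assume "\<exists>r>0. mball M r \<subseteq> U"
      then obtain r where r: "r > 0" "mball M r \<subseteq> U" by auto
      obtain n where "inverse (real (Suc n)) < r" using reals_Archimedean[OF r(1)] by auto
      then have n: "1 / (1 + real n) < r" by (simp add: field_simps)
      have "N \<in> mball M r" if "N \<in> cyl sig n (restr {1..n} M)" for N
      proof (cases "M = N")
        case True then show ?thesis using M r by simp
      next
        case False
        then have "struct_dist M N \<le> 1 / (1 + real n)"
          using that struct_dist_less_iff[OF M, of N n] by (auto simp: cyl_def)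
        then show ?thesis using M n that by (auto simp: cyl_def)
      qed
      then show "\<exists>n. cyl sig n (restr {1..n} M) \<subseteq> U" using r by blast
    }
    {
      assume "\<exists>n. cyl sig n (restr {1..n} M) \<subseteq> U"
      then obtain n where n: "cyl sig n (restr {1..n} M) \<subseteq> U" by auto
      have "N \<in> cyl sig n (restr {1..n} M)" if "N \<in> mball M (1 / (1 + real (Suc n)))" for N
      proof (cases "M = N")
        case True then show ?thesis using M by (simp add: cyl_def)
      next
        case False
        then have "restr {1..Suc n} M = restr {1..Suc n} N"
          using that struct_dist_less_iff[of M sig N "Suc n"] by auto
        then have "restr {1..n} M = restr {1..n} N" by (rule restr_eq_mono) simp
        then show ?thesis using that by (simp add: cyl_def)
      qed
      then show "\<exists>r>0. mball M r \<subseteq> U" using n by (intro exI[of _ "1 / (1 + real (Suc n))"]) auto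
    }
  qed
  then show ?thesis unfolding LN_top_def openin_mtopology by blast
qed

lemma space_LN_borel [simp]: "space (LN_borel sig) = structs sig {0<..}"
  unfolding LN_borel_def by (rule space_measure_of) (auto simp: LN_open_iff)

lemma sets_LN_borel: "sets (LN_borel sig) = sigma_sets (structs sig {0<..}) {U. openin (LN_top sig) U}"
  unfolding LN_borel_def by (rule sets_measure_of) (auto simp: LN_open_iff)

lemma cyl_open: "openin (LN_top sig) (cyl sig n A)"
  unfolding LN_open_iff by (auto simp: cyl_def)

lemma cyl_sets [measurable]: "cyl sig n A \<in> sets (LN_borel sig)"
  unfolding sets_LN_borel using cyl_open by blast

lemma sets_LN_borel_cyl:
  "sets (LN_borel sig) =
     sigma_sets (structs sig {0<..}) ({cyl sig n A | n A. n \<ge> 1 \<and> A \<in> structs sig {1..n}} \<union> {{}})"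
    (is "_ = sigma_sets ?S ?G")
proof
  show "sigma_sets ?S ?G \<subseteq> sets (LN_borel sig)"
    using sets.sigma_sets_subset[of ?G "LN_borel sig"] cyl_sets unfolding space_LN_borel by blast
  have "U \<in> sigma_sets ?S ?G" if U: "openin (LN_top sig) U" for U
  proof -
    define C where "C = (\<lambda>n. {A \<in> structs sig {1..n}. cyl sig n A \<subseteq> U})"
    have "U = (\<Union>n\<in>{0<..}. \<Union>A\<in>C n. cyl sig n A)"
    proof
      show "U \<subseteq> (\<Union>n\<in>{0<..}. \<Union>A\<in>C n. cyl sig n A)"
      proof
        fix M assume M: "M \<in> U"
        then have S: "M \<in> structs sig {0<..}" using U unfolding LN_open_iff by (metis subsetD)
        obtain n where n: "cyl sig n (restr {1..n} M) \<subseteq> U"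
          using U M unfolding LN_open_iff by metis
        have "cyl sig (Suc n) (restr {1..Suc n} M) \<subseteq> cyl sig n (restr {1..n} M)"
        proof
          fix N assume "N \<in> cyl sig (Suc n) (restr {1..Suc n} M)"
          then show "N \<in> cyl sig n (restr {1..n} M)"
            unfolding cyl_def mem_Collect_eq using restr_eq_mono[of "Suc n" N M n] by (metis le_add2 plus_1_eq_Suc)
        qed
        then have "restr {1..Suc n} M \<in> C (Suc n)"
          using n restr_in_structs[OF S] by (auto simp: C_def)
        moreover have "M \<in> cyl sig (Suc n) (restr {1..Suc n} M)" using S by (simp add: cyl_def)
        ultimately show "M \<in> (\<Union>n\<in>{0<..}. \<Union>A\<in>C n. cyl sig n A)" by (intro UN_I) auto
      qed
    qed (auto simp: C_def)
    moreover have "countable (C n)" for n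
      by (rule countable_finite, rule finite_subset[OF _ finite_structs[of "{1..n}" sig]]) (auto simp: C_def)
    then have "(\<Union>A\<in>C n. cyl sig n A) \<in> sigma_sets ?S ?G" if "n \<ge> 1" for n
      by (rule sigma_sets_UNION[OF countable_image]) (use that in \<open>auto simp: C_def intro!: sigma_sets.Basic\<close>)
    then have "(\<Union>n\<in>{0<..}. \<Union>A\<in>C n. cyl sig n A) \<in> sigma_sets ?S ?G"
      by (intro sigma_sets_UNION[OF countable_image]) auto
    ultimately show ?thesis by simp
  qed
  then show "sets (LN_borel sig) \<subseteq> sigma_sets ?S ?G"
    unfolding sets_LN_borel by (intro sigma_sets_mono) blast
qed

lemma limit_eqI:
  assumes "W \<in> space (prob_algebra (LN_borel sig))" "W' \<in> space (prob_algebra (LN_borel sig))"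
    and eq: "\<And>n A. n \<ge> 1 \<Longrightarrow> A \<in> structs sig {1..n} \<Longrightarrow> measure W (cyl sig n A) = measure W' (cyl sig n A)"
  shows "W = W'"
proof -
  let ?G = "{cyl sig n A | n A. n \<ge> 1 \<and> A \<in> structs sig {1..n}} \<union> {{}}"
  have W: "prob_space W" "sets W = sets (LN_borel sig)" and W': "prob_space W'" "sets W' = sets (LN_borel sig)"
    using assms by (auto simp: space_prob_algebra)
  interpret W: prob_space W by fact
  interpret W': prob_space W' by fact
  have sp: "space W = structs sig {0<..}" "space W' = structs sig {0<..}"
    using W(2) W'(2) by (auto dest: sets_eq_imp_space_eq)
  have nest: "cyl sig n A \<inter> cyl sig k B = {} \<or> cyl sig n A \<inter> cyl sig k B = cyl sig k B"
    if "n \<le> k" for n k A B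
  proof (rule disj_imp[THEN iffD2], rule impI)
    assume "cyl sig n A \<inter> cyl sig k B \<noteq> {}"
    then obtain M where M: "restr {1..n} M = A" "restr {1..k} M = B" by (auto simp: cyl_def)
    have "restr {1..n} N = A" if "restr {1..k} N = B" for N
      using restr_eq_mono[of k N M n] that M \<open>n \<le> k\<close> by simp
    then show "cyl sig n A \<inter> cyl sig k B = cyl sig k B" unfolding cyl_def by blast
  qed
  have "Int_stable ?G"
  proof (rule Int_stableI)
    fix a b assume "a \<in> ?G" "b \<in> ?G"
    then consider "a \<inter> b = {}" | n A k B where "a = cyl sig n A" "b = cyl sig k B" "n \<ge> 1" "k \<ge> 1"
        "A \<in> structs sig {1..n}" "B \<in> structs sig {1..k}" by blast
    then show "a \<inter> b \<in> ?G"
    proof cases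
      case 2
      have "a \<inter> b = {} \<or> a \<inter> b = a \<or> a \<inter> b = b"
      proof (cases "n \<le> k")
        case True then show ?thesis using nest[OF True, of A B] 2 by blast
      next
        case False then show ?thesis using nest[of k n B A] 2 by (auto simp: Int_commute)
      qed
      then show ?thesis using \<open>a \<in> ?G\<close> \<open>b \<in> ?G\<close> by (elim disjE) simp_all
    qed auto
  qed
  then show ?thesis
  proof (rule measure_eqI_generator_eq_countable[where \<Omega> = "structs sig {0<..}" and A = "cyl sig 1 ` structs sig {1..1}"])
    show "?G \<subseteq> Pow (structs sig {0<..})" by (auto simp: cyl_def)
    show "emeasure W X = emeasure W' X" if "X \<in> ?G" for X
      using eq that by (auto simp: W.emeasure_eq_measure W'.emeasure_eq_measure)
    show "sets W = sigma_sets (structs sig {0<..}) ?G" "sets W' = sigma_sets (structs sig {0<..}) ?G"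
      using W(2) W'(2) sets_LN_borel_cyl by auto
    show "cyl sig 1 ` structs sig {1..1} \<subseteq> ?G" by blast
    show "\<Union>(cyl sig 1 ` structs sig {1..1}) = structs sig {0<..}"
      using restr_in_structs[of _ sig 1] by (auto simp: cyl_def)
    show "countable (cyl sig 1 ` structs sig {1..1})"
      by (intro countable_image countable_finite finite_structs) simp
    show "emeasure W a \<noteq> \<infinity>" for a by simp
  qed
qed

lemma limit_dist_summable:
  assumes "W \<in> E_space sig" "W' \<in> E_space sig"
  shows "(\<lambda>n. (1/2)^n * (\<Sum>A\<in>structs sig {1..n}. \<bar>measure W (cyl sig n A) - measure W' (cyl sig n A)\<bar>))
     summable_on {0<..}"
proof (rule summable_on_comparison_test)
  have "(\<lambda>n. 2 * (1/2)^n :: real) summable_on UNIV"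
    by (rule norm_summable_imp_summable_on) (simp add: summable_mult summable_geometric)
  then show "(\<lambda>n. 2 * (1/2)^n :: real) summable_on {0<..}"
    by (rule summable_on_subset_banach) simp
  fix n :: nat assume n: "n \<in> {0<..}"
  have *: "(\<Sum>A\<in>structs sig {1..n}. measure V (cyl sig n A)) \<le> 1" if "V \<in> E_space sig" for V
  proof -
    have V: "prob_space V" "sets V = sets (LN_borel sig)"
      using that by (auto simp: E_space_def space_prob_algebra)
    interpret V: prob_space V by fact
    have "(\<Sum>A\<in>structs sig {1..n}. measure V (cyl sig n A)) = measure V (\<Union>A\<in>structs sig {1..n}. cyl sig n A)"
      by (rule V.finite_measure_finite_Union[symmetric])
        (use cyl_sets in \<open>auto simp: finite_structs V(2) disjoint_family_on_def, auto simp: cyl_def\<close>)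
    then show ?thesis by simp
  qed
  have "(\<Sum>A\<in>structs sig {1..n}. \<bar>measure W (cyl sig n A) - measure W' (cyl sig n A)\<bar>) \<le>
      (\<Sum>A\<in>structs sig {1..n}. measure W (cyl sig n A) + measure W' (cyl sig n A))"
    by (intro sum_mono) (smt (verit) measure_nonneg)
  also have "\<dots> \<le> 2" using *[OF assms(1)] *[OF assms(2)] by (simp add: sum.distrib)
  finally show "(1/2)^n * (\<Sum>A\<in>structs sig {1..n}. \<bar>measure W (cyl sig n A) - measure W' (cyl sig n A)\<bar>)
      \<le> 2 * (1/2)^n" by (simp add: mult_left_mono mult.commute)
qed (auto intro!: sum_nonneg)

lemma Metric_space_limits: "Metric_space (E_space sig) (limit_dist sig)"
proof
  show "0 \<le> limit_dist sig W W'" for W W'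
    unfolding limit_dist_def by (intro infsum_nonneg mult_nonneg_nonneg sum_nonneg) auto
  show "limit_dist sig W W' = limit_dist sig W' W" for W W'
    unfolding limit_dist_def by (simp add: abs_minus_commute)
next
  fix V W assume VW: "V \<in> E_space sig" "W \<in> E_space sig"
  show "limit_dist sig V W = 0 \<longleftrightarrow> V = W"
  proof
    assume "limit_dist sig V W = 0"
    have "measure V (cyl sig n A) = measure W (cyl sig n A)"
      if "n \<ge> 1" "A \<in> structs sig {1..n}" for n A
    proof -
      have "(1/2)^n * (\<Sum>A\<in>structs sig {1..n}. \<bar>measure V (cyl sig n A) - measure W (cyl sig n A)\<bar>) = 0"
        using \<open>limit_dist sig V W = 0\<close> unfolding limit_dist_def
        by (rule nonneg_infsum_le_0D[OF eq_refl])
          (use limit_dist_summable[OF VW] that in \<open>auto intro!: sum_nonneg\<close>)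
      then show ?thesis using that by (simp add: sum_nonneg_eq_0_iff finite_structs)
    qed
    then show "V = W" using VW by (intro limit_eqI[of V sig W]) (auto simp: E_space_def)
  qed (simp add: limit_dist_def)
next
  fix U V W assume S: "U \<in> E_space sig" "V \<in> E_space sig" "W \<in> E_space sig"
  show "limit_dist sig U W \<le> limit_dist sig U V + limit_dist sig V W"
    unfolding limit_dist_def
      infsum_add[OF limit_dist_summable[OF S(1,2)] limit_dist_summable[OF S(2,3)], symmetric]
  proof (rule infsum_mono)
    fix n :: nat
    show "(1/2)^n * (\<Sum>A\<in>structs sig {1..n}. \<bar>measure U (cyl sig n A) - measure W (cyl sig n A)\<bar>)
      \<le> (1/2)^n * (\<Sum>A\<in>structs sig {1..n}. \<bar>measure U (cyl sig n A) - measure V (cyl sig n A)\<bar>) +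
        (1/2)^n * (\<Sum>A\<in>structs sig {1..n}. \<bar>measure V (cyl sig n A) - measure W (cyl sig n A)\<bar>)"
      unfolding distrib_left[symmetric] sum.distrib[symmetric]
      by (intro mult_left_mono sum_mono) auto
  qed (use limit_dist_summable S in \<open>auto intro!: summable_on_add\<close>)
qed

end

theory Submission
  imports Defs
begin

text \<open>The idea is that a jump moves the combinatorial limit only if it changes a positive fraction of all
finite samples.  Write \<open>X\<^sup>\<phi>\<close> for the structure that a map \<open>\<phi>\<close> from \<open>{1..m}\<close> to the labels reads off \<open>X\<close>.
The limit at time \<open>t\<close> is described by the densities: the proportion of the maps \<open>\<phi>\<close> into \<open>{1..N}\<close> with
\<open>X\<^sub>t\<^sup>\<phi> = A\<close>, as \<open>N\<close> tends to infinity.  If \<open>X\<^sub>s\<^sup>\<phi> \<noteq> X\<^sub>t\<^sup>\<phi>\<close>, then some atom of the driving processes at a time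
in \<open>(s, t]\<close> \<^emph>\<open>hits\<close> \<open>\<phi>\<close>, that is, its structure is not empty when read through \<open>\<phi>\<close>
(\<open>path_changes_only_at_hits\<close>).  So the densities at \<open>s\<close> and \<open>t\<close> differ by at most the proportion of maps
that are hit, and it suffices to bound this proportion.

\<^item> Atoms of type \<open>\<lambda>\<close>.  All tuples of such a structure share a label, so two maps with disjoint ranges are
never hit by the same atom.  For a Poisson process the hits of such maps are therefore independent,
and a law of large numbers bounds the proportion of maps hit in an interval by the length of the
interval times the rate at which a single map is hit (\<open>independent_hits_mean\<close>).  That rate does not
depend on the map, because the rate measure of an exchangeable process is exchangeable on such events.

\<^item> Atoms of \<open>\<nu>\<^sub>0\<^sup>*\<close>.  Those that can be seen on \<open>{1..p}\<close> are finite in number up to any time \<open>T\<close>.  The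
others hit a proportion of the maps that becomes small as \<open>p\<close> grows, uniformly over \<open>[0, T]\<close>
(\<open>invisible_hits_vanish\<close>): a dissociated exchangeable law other than the point mass at the empty structure almost surely
produces a structure that is nonempty outside every finite set (\<open>dissociated_never_locally_empty\<close>).

Both statements rest on one law of large numbers, \<open>sample_means_converge\<close>: averages over maps converge
almost surely as soon as the correlation of two summands is the same for all pairs of maps with
disjoint ranges.  For Poisson processes that correlation is read off from the probabilities that a set
contains no atom.

Existence at all times: the densities converge at all rational times almost surely, and any \<open>t\<close> is followed by
rational times \<open>r\<close> such that no atom of \<open>\<nu>\<^sub>0\<^sup>*\<close> visible on \<open>{1..p}\<close> occurs in \<open>(t, r]\<close>.
Continuity: if \<open>t\<close> is not the time of an atom of \<open>\<nu>\<^sub>0\<^sup>*\<close>, then neither is any time close to \<open>t\<close>, as far as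
atoms visible on \<open>{1..p}\<close> are concerned.  It remains to see that a limit of densities is an
exchangeable dissociated law (\<open>climit_in_E_space\<close>); this is a statement about a single structure.\<close>


section \<open>Averages over all maps into an initial segment\<close>

text \<open>Collisions are admitted, so that the values of a uniformly chosen map at different points of \<open>I\<close> are
independent; asymptotically the mean over injections is the same.\<close>

definition sample_mean :: "nat set \<Rightarrow> nat \<Rightarrow> ((nat \<Rightarrow> nat) \<Rightarrow> real) \<Rightarrow> real" where
  "sample_mean I N f = (\<Sum>\<phi>\<in>I \<rightarrow>\<^sub>E {1..N}. f \<phi>) / real N ^ card I"

lemma finite_maps: "finite I \<Longrightarrow> finite (I \<rightarrow>\<^sub>E {1..N::nat})"
  by (simp add: finite_PiE)

lemma sample_mean_const: "finite I \<Longrightarrow> N \<ge> 1 \<Longrightarrow> sample_mean I N (\<lambda>_. c) = c"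
  by (simp add: sample_mean_def card_funcsetE)

lemma sample_mean_mono:
  assumes "\<And>\<phi>. \<phi> \<in> I \<rightarrow>\<^sub>E {1..N} \<Longrightarrow> f \<phi> \<le> g \<phi>"
  shows "sample_mean I N f \<le> sample_mean I N g"
  unfolding sample_mean_def by (intro divide_right_mono sum_mono assms) auto

lemma sample_mean_cong:
  assumes "\<And>\<phi>. \<phi> \<in> I \<rightarrow>\<^sub>E {1..N} \<Longrightarrow> f \<phi> = g \<phi>"
  shows "sample_mean I N f = sample_mean I N g"
  unfolding sample_mean_def using assms by simp

lemma sample_mean_add: "sample_mean I N (\<lambda>\<phi>. f \<phi> + g \<phi>) = sample_mean I N f + sample_mean I N g"
  by (simp add: sample_mean_def sum.distrib add_divide_distrib)

lemma sample_mean_diff: "sample_mean I N (\<lambda>\<phi>. f \<phi> - g \<phi>) = sample_mean I N f - sample_mean I N g"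
  by (simp add: sample_mean_def sum_subtractf diff_divide_distrib)

lemma sample_mean_cmult: "sample_mean I N (\<lambda>\<phi>. c * f \<phi>) = c * sample_mean I N f"
  by (simp add: sample_mean_def sum_distrib_left)

lemma sample_mean_sum: "sample_mean I N (\<lambda>\<phi>. \<Sum>l\<in>L. f l \<phi>) = (\<Sum>l\<in>L. sample_mean I N (f l))"
  unfolding sample_mean_def by (subst sum.swap) (simp add: sum_divide_distrib)

lemma sample_mean_nonneg: "(\<And>\<phi>. \<phi> \<in> I \<rightarrow>\<^sub>E {1..N} \<Longrightarrow> 0 \<le> f \<phi>) \<Longrightarrow> 0 \<le> sample_mean I N f"
  unfolding sample_mean_def by (intro divide_nonneg_nonneg sum_nonneg) auto

lemma abs_sample_mean_le: "\<bar>sample_mean I N f\<bar> \<le> sample_mean I N (\<lambda>\<phi>. \<bar>f \<phi>\<bar>)"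
  unfolding sample_mean_def by (simp add: divide_right_mono)

lemma abs_sample_mean_le_1:
  assumes "finite I" "\<And>\<phi>. \<phi> \<in> I \<rightarrow>\<^sub>E {1..N} \<Longrightarrow> \<bar>f \<phi>\<bar> \<le> 1"
  shows "\<bar>sample_mean I N f\<bar> \<le> 1"
proof (cases "N \<ge> 1")
  case True
  have "\<bar>sample_mean I N f\<bar> \<le> sample_mean I N (\<lambda>\<phi>. \<bar>f \<phi>\<bar>)" by (rule abs_sample_mean_le)
  also have "\<dots> \<le> sample_mean I N (\<lambda>_. 1)" using assms by (intro sample_mean_mono) auto
  finally show ?thesis using True assms by (simp add: sample_mean_const)
next
  case False
  show ?thesis
  proof (cases "I = {}")
    case True then show ?thesis using assms by (simp add: sample_mean_def)
  next
    case F: False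
    then have "I \<rightarrow>\<^sub>E {1..N} = {}" using False by (auto simp: PiE_eq_empty_iff)
    then show ?thesis by (simp add: sample_mean_def)
  qed
qed

text \<open>The restrictions of a uniformly chosen map to disjoint sets are independent.\<close>

lemma sample_mean_mult:
  assumes "finite I" "finite J" "I \<inter> J = {}"
  shows "sample_mean (I \<union> J) N (\<lambda>\<phi>. f (restrict \<phi> I) * g (restrict \<phi> J)) = sample_mean I N f * sample_mean J N g"
proof -
  have "(\<Sum>\<phi>\<in>I \<union> J \<rightarrow>\<^sub>E {1..N}. f (restrict \<phi> I) * g (restrict \<phi> J)) =
        (\<Sum>(\<alpha>,\<beta>)\<in>(I \<rightarrow>\<^sub>E {1..N}) \<times> (J \<rightarrow>\<^sub>E {1..N}). f \<alpha> * g \<beta>)"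
  proof (rule sum.reindex_bij_witness[where j = "\<lambda>\<phi>. (restrict \<phi> I, restrict \<phi> J)"
        and i = "\<lambda>(\<alpha>,\<beta>) x. if x \<in> I then \<alpha> x else if x \<in> J then \<beta> x else undefined"], goal_cases)
    case (1 \<phi>) then show ?case by (auto simp: fun_eq_iff PiE_iff extensional_def)
  next
    case (2 \<phi>) then show ?case by (auto simp: PiE_iff)
  next
    case (3 ab) then show ?case using assms(3) by (auto simp: fun_eq_iff PiE_iff extensional_def restrict_def)
  next
    case (4 ab) then show ?case by (auto simp: PiE_iff extensional_def)
  next
    case (5 \<phi>) then show ?case by simp
  qed
  also have "\<dots> = (\<Sum>\<alpha>\<in>I \<rightarrow>\<^sub>E {1..N}. f \<alpha>) * (\<Sum>\<beta>\<in>J \<rightarrow>\<^sub>E {1..N}. g \<beta>)"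
    by (simp add: sum_product sum.cartesian_product)
  finally show ?thesis
    using assms by (simp add: sample_mean_def card_Un_disjoint power_add)
qed

text \<open>The values of a uniformly chosen map are independent and uniform, so reading it through an injection
gives a uniformly chosen map again.\<close>

lemma sample_mean_marginal:
  assumes "finite K" "inj_on \<psi> I" "\<psi> ` I \<subseteq> K" "N \<ge> 1"
  shows "sample_mean K N (\<lambda>\<phi>. g (restrict (\<phi> \<circ> \<psi>) I)) = sample_mean I N g"
proof -
  let ?J = "\<psi> ` I"
  have fin: "finite ?J" using assms finite_subset by blast
  have r: "restrict (restrict \<phi> ?J \<circ> \<psi>) I = restrict (\<phi> \<circ> \<psi>) I" for \<phi> :: "nat \<Rightarrow> nat"
    by (auto simp: fun_eq_iff restrict_def)
  have "sample_mean K N (\<lambda>\<phi>. g (restrict (\<phi> \<circ> \<psi>) I)) =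
        sample_mean (?J \<union> (K - ?J)) N (\<lambda>\<phi>. (\<lambda>\<phi>. g (restrict (\<phi> \<circ> \<psi>) I)) (restrict \<phi> ?J) * (\<lambda>_. 1) (restrict \<phi> (K - ?J)))"
    using assms(3) by (simp add: r Un_absorb1)
  also have "\<dots> = sample_mean ?J N (\<lambda>\<phi>. g (restrict (\<phi> \<circ> \<psi>) I)) * sample_mean (K - ?J) N (\<lambda>_. 1)"
    by (rule sample_mean_mult) (use assms fin in auto)
  also have "\<dots> = sample_mean ?J N (\<lambda>\<phi>. g (restrict (\<phi> \<circ> \<psi>) I))"
    using assms by (simp add: sample_mean_const)
  also have "\<dots> = sample_mean I N g"
  proof -
    have "(\<Sum>\<phi>\<in>?J \<rightarrow>\<^sub>E {1..N}. g (restrict (\<phi> \<circ> \<psi>) I)) = (\<Sum>\<phi>\<in>I \<rightarrow>\<^sub>E {1..N}. g \<phi>)"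
    proof (rule sum.reindex_bij_witness[where j = "\<lambda>\<phi>. restrict (\<phi> \<circ> \<psi>) I"
          and i = "\<lambda>\<phi>. restrict (\<phi> \<circ> inv_into I \<psi>) ?J"], goal_cases)
      case (1 \<phi>) then show ?case using assms(2) by (auto simp: fun_eq_iff PiE_iff extensional_def)
    next
      case (2 \<phi>) then show ?case by (auto simp: PiE_iff)
    next
      case (3 \<phi>) then show ?case using assms(2) by (auto simp: fun_eq_iff PiE_iff extensional_def restrict_def)
    next
      case (4 \<phi>) then show ?case using assms(2) by (auto simp: PiE_iff)
    next
      case (5 \<phi>) then show ?case by simp
    qed
    then show ?thesis using assms(2) by (simp add: sample_mean_def card_image)
  qed
  finally show ?thesis .
qed

text \<open>Maps of this kind are those whose joint behaviour with \<open>F\<close> is determined by exchangeability.\<close>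

definition spread :: "nat set \<Rightarrow> nat set \<Rightarrow> (nat \<Rightarrow> nat) \<Rightarrow> bool" where
  "spread F I \<phi> \<longleftrightarrow> inj_on \<phi> I \<and> \<phi> ` I \<inter> F = {}"

lemma one_minus_sum_le_prod:
  fixes a :: "nat \<Rightarrow> real"
  assumes "\<And>i. i < m \<Longrightarrow> 0 \<le> a i" "\<And>i. i < m \<Longrightarrow> a i \<le> 1"
  shows "1 - (\<Sum>i<m. a i) \<le> (\<Prod>i<m. 1 - a i)"
  using assms
proof (induction m)
  case (Suc m)
  have p: "(\<Prod>i<m. 1 - a i) \<le> 1" by (rule prod_le_1) (use Suc.prems in auto)
  have "1 - (\<Sum>i<Suc m. a i) \<le> (\<Prod>i<m. 1 - a i) - a m" using Suc by simp
  also have "\<dots> \<le> (\<Prod>i<m. 1 - a i) - (\<Prod>i<m. 1 - a i) * a m"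
    using p mult_right_mono[OF p, of "a m"] Suc.prems by auto
  finally show ?case by (simp add: algebra_simps)
qed simp

text \<open>The number of injections from \<open>I\<close> into \<open>{1..N} - F\<close> is at least a product of \<open>card I\<close> factors, each at least
\<open>N - card I - card F\<close>.\<close>

lemma sample_mean_not_spread:
  assumes I: "finite I" and F: "finite F" and N: "N \<ge> 1"
  shows "sample_mean I N (\<lambda>\<phi>. of_bool (\<not> spread F I \<phi>)) \<le> card I * (card I + card F) / N"
proof (cases "card I + card F \<le> N")
  case False
  have "sample_mean I N (\<lambda>\<phi>. of_bool (\<not> spread F I \<phi>)) \<le> sample_mean I N (\<lambda>_. 1)"
    by (rule sample_mean_mono) auto
  then have le1: "sample_mean I N (\<lambda>\<phi>. of_bool (\<not> spread F I \<phi>)) \<le> 1"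
    using I N by (simp add: sample_mean_const)
  show ?thesis
  proof (cases "card I = 0")
    case True
    then show ?thesis using I by (simp add: sample_mean_def spread_def)
  next
    case ne: False
    then have "1 * N \<le> card I * (card I + card F)"
      using False mult_le_mono[of 1 "card I" N "card I + card F"] by auto
    then have "real N \<le> real (card I * (card I + card F))" using of_nat_le_iff by fastforce
    then have "1 \<le> card I * (card I + card F) / N" using N by (simp add: field_simps)
    then show ?thesis using le1 by simp
  qed
next
  case True
  define m where "m = card I"
  define C where "C = {1..N} - F"
  have finC: "finite C" by (simp add: C_def)
  have "card F \<ge> card (F \<inter> {1..N})" using F by (intro card_mono) auto
  moreover have "card C = N - card (F \<inter> {1..N})" 
    unfolding C_def using F by (simp add: card_Diff_subset_Int Int_commute)
  ultimately have cC: "N - card F \<le> card C" by simp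
  have good: "{\<phi> \<in> I \<rightarrow>\<^sub>E {1..N}. spread F I \<phi>} = {\<phi> \<in> I \<rightarrow>\<^sub>E C. inj_on \<phi> I}"
    by (auto simp: spread_def C_def PiE_iff image_iff)
  have "card {\<phi> \<in> I \<rightarrow>\<^sub>E {1..N}. spread F I \<phi>} = prod ((-) (card C)) {0..<m}"
    unfolding good using card_inj_on_subset_funcset[OF I finC order_refl] by (simp add: m_def)
  then have "real (card {\<phi> \<in> I \<rightarrow>\<^sub>E {1..N}. spread F I \<phi>}) = (\<Prod>i<m. real (card C - i))"
    by (simp add: atLeast0LessThan)
  also have "\<dots> \<ge> (\<Prod>i<m. real N * (1 - (real (card F) + i) / N))"
  proof (rule prod_mono)
    fix i assume "i \<in> {..<m}"
    then have i: "i < card I" by (simp add: m_def)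
    have "real N * (1 - (real (card F) + i) / N) = real N - (real (card F) + i)"
      using N by (simp add: right_diff_distrib)
    moreover have "0 \<le> real N - (real (card F) + i)" using True i by simp
    moreover have "real N - (real (card F) + i) \<le> real (card C - i)" using cC True i by simp
    ultimately show "0 \<le> real N * (1 - (real (card F) + i) / N) \<and>
        real N * (1 - (real (card F) + i) / N) \<le> real (card C - i)" by simp
  qed
  also have "(\<Prod>i<m. real N * (1 - (real (card F) + i) / N)) = real N ^ m * (\<Prod>i<m. 1 - (real (card F) + i) / N)"
    by (simp add: prod.distrib)
  finally have 1: "real N ^ m * (\<Prod>i<m. 1 - (real (card F) + i) / N) \<le> card {\<phi> \<in> I \<rightarrow>\<^sub>E {1..N}. spread F I \<phi>}" .
  have "1 - (\<Sum>i<m. (real (card F) + i) / N) \<le> (\<Prod>i<m. 1 - (real (card F) + i) / N)"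
    using True N unfolding m_def by (intro one_minus_sum_le_prod) (auto simp: field_simps)
  moreover have "(\<Sum>i<m. (real (card F) + i) / N) \<le> (\<Sum>i<m. real (card F + m) / N)"
    by (intro sum_mono divide_right_mono) auto
  ultimately have "1 - real m * (card F + m) / N \<le> (\<Prod>i<m. 1 - (real (card F) + i) / N)"
    by (simp add: add.commute)
  then have 2: "real N ^ m * (1 - real m * (card F + m) / N) \<le> card {\<phi> \<in> I \<rightarrow>\<^sub>E {1..N}. spread F I \<phi>}"
    using 1 mult_left_mono[of _ _ "real N ^ m"] by (smt (verit) zero_le_power of_nat_0_le_iff)
  have "sample_mean I N (\<lambda>\<phi>. of_bool (\<not> spread F I \<phi>)) = sample_mean I N (\<lambda>\<phi>. 1 - of_bool (spread F I \<phi>))"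
    by (intro sample_mean_cong) auto
  also have "\<dots> = 1 - sample_mean I N (\<lambda>\<phi>. of_bool (spread F I \<phi>))"
    using I N by (simp add: sample_mean_diff sample_mean_const)
  also have "sample_mean I N (\<lambda>\<phi>. of_bool (spread F I \<phi>)) = card {\<phi> \<in> I \<rightarrow>\<^sub>E {1..N}. spread F I \<phi>} / real N ^ m"
    unfolding sample_mean_def m_def of_bool_def
    by (subst sum.If_cases) (use I in \<open>auto simp: finite_PiE Int_def\<close>)
  also have "1 - \<dots> \<le> real m * (card F + m) / N"
    using 2 N by (simp add: field_simps)
  finally show ?thesis by (simp add: m_def add.commute)
qed

text \<open>A proportion \<open>(n / N) ^ card I\<close> of the maps into \<open>{1..N}\<close> take their values in \<open>{1..n}\<close>.  The bound fills the gaps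
between the members of a sparse subsequence of sizes.\<close>

lemma sample_mean_change_size:
  assumes I: "finite I" and f: "\<And>\<phi>. \<phi> \<in> I \<rightarrow>\<^sub>E {1..N} \<Longrightarrow> \<bar>f \<phi>\<bar> \<le> 1" and n: "1 \<le> n" "n \<le> N"
  shows "\<bar>sample_mean I N f - sample_mean I n f\<bar> \<le> 2 * (1 - (n / N) ^ card I)"
proof -
  define m where "m = card I"
  let ?A = "I \<rightarrow>\<^sub>E {1..n}" and ?B = "I \<rightarrow>\<^sub>E {1..N}"
  have sub: "?A \<subseteq> ?B" using n by (intro PiE_mono) auto
  have fin: "finite ?B" using I by (rule finite_maps)
  have cA: "card ?A = n ^ m" and cB: "card ?B = N ^ m" using I by (auto simp: card_funcsetE m_def)
  have pos: "real N ^ m > 0" "real n ^ m > 0" using n by auto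
  have split: "sum f ?B = sum f (?B - ?A) + sum f ?A" using sum.subset_diff[OF sub fin] .
  have "\<bar>sum f (?B - ?A)\<bar> \<le> (\<Sum>\<phi>\<in>?B - ?A. 1)"
    by (rule order.trans[OF sum_abs sum_mono]) (use f in auto)
  also have "\<dots> = real N ^ m - real n ^ m"
    using card_Diff_subset[OF finite_subset[OF sub fin] sub] cA cB card_mono[OF fin sub] by (simp add: of_nat_diff)
  finally have 1: "\<bar>sum f (?B - ?A) / real N ^ m\<bar> \<le> 1 - (n / N) ^ m"
    using pos by (simp add: power_divide field_simps)
  have s: "\<bar>sum f ?A\<bar> \<le> real n ^ m"
    using order.trans[OF sum_abs sum_mono[of ?A "\<lambda>\<phi>. \<bar>f \<phi>\<bar>" "\<lambda>_. 1"]] f sub cA by auto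
  have "sum f ?A / real N ^ m - sum f ?A / real n ^ m = - (sum f ?A / real n ^ m) * (1 - (n / N) ^ m)"
    using n by (simp add: power_divide field_simps)
  also have "\<bar>\<dots>\<bar> \<le> 1 * (1 - (n / N) ^ m)"
    unfolding abs_mult using s pos n
    by (intro mult_mono) (auto simp: field_simps power_divide power_mono)
  finally have 2: "\<bar>sum f ?A / real N ^ m - sum f ?A / real n ^ m\<bar> \<le> 1 - (n / N) ^ m" by simp
  have "\<bar>sample_mean I N f - sample_mean I n f\<bar> =
      \<bar>sum f (?B - ?A) / real N ^ m + (sum f ?A / real N ^ m - sum f ?A / real n ^ m)\<bar>"
    unfolding sample_mean_def split add_divide_distrib m_def[symmetric] by simp
  also have "\<dots> \<le> (1 - (n / N) ^ m) + (1 - (n / N) ^ m)"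
    by (rule order.trans[OF abs_triangle_ineq add_mono[OF 1 2]])
  finally show ?thesis by (simp add: m_def)
qed

section \<open>A law of large numbers for averages over maps\<close>

lemma maps_pos: "\<phi> \<in> I \<rightarrow>\<^sub>E {1..n::nat} \<Longrightarrow> \<phi> \<in> I \<rightarrow>\<^sub>E {0<..}"
  by (rule subsetD[OF PiE_mono]) auto

context prob_space
begin

lemma sample_mean_measurable:
  assumes "\<And>\<phi>. \<phi> \<in> I \<rightarrow>\<^sub>E {1..N} \<Longrightarrow> Z \<phi> \<in> borel_measurable M"
  shows "(\<lambda>\<omega>. sample_mean I N (\<lambda>\<phi>. Z \<phi> \<omega>)) \<in> borel_measurable M"
  unfolding sample_mean_def using assms by (intro borel_measurable_divide borel_measurable_sum) auto

text \<open>Almost all pairs of maps are injective with disjoint ranges outside \<open>F\<close>, and these contribute \<open>c\<close>; the others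
change the value by at most their proportion, which is of order \<open>1 / N\<close>.\<close>

lemma sample_mean_product_expectation:
  fixes Z :: "(nat \<Rightarrow> nat) \<Rightarrow> 'a \<Rightarrow> real"
  assumes I: "finite I" and F: "finite F"
    and meas: "\<And>\<phi>. \<phi> \<in> I \<rightarrow>\<^sub>E {0<..} \<Longrightarrow> Z \<phi> \<in> borel_measurable M"
    and bound: "\<And>\<phi> \<omega>. \<phi> \<in> I \<rightarrow>\<^sub>E {0<..} \<Longrightarrow> \<omega> \<in> space M \<Longrightarrow> \<bar>Z \<phi> \<omega>\<bar> \<le> 1"
    and c: "\<And>\<phi> \<phi>'. \<phi> \<in> I \<rightarrow>\<^sub>E {0<..} \<Longrightarrow> \<phi>' \<in> I \<rightarrow>\<^sub>E {0<..} \<Longrightarrow> spread F I \<phi> \<Longrightarrow>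
            spread (F \<union> \<phi> ` I) I \<phi>' \<Longrightarrow> expectation (\<lambda>\<omega>. Z \<phi> \<omega> * Z \<phi>' \<omega>) = c"
    and c1: "\<bar>c\<bar> \<le> 1" and N: "1 \<le> N" "N \<le> K"
  shows "\<bar>expectation (\<lambda>\<omega>. sample_mean I N (\<lambda>\<phi>. Z \<phi> \<omega>) * sample_mean I K (\<lambda>\<phi>. Z \<phi> \<omega>)) - c\<bar>
       \<le> 4 * (card I * (2 * card I + card F)) / N"
proof -
  let ?m = "card I"
  define D where "D = real ?m * (2 * ?m + card F) / N"
  have pos: "\<phi> \<in> I \<rightarrow>\<^sub>E {1..n} \<Longrightarrow> \<phi> \<in> I \<rightarrow>\<^sub>E {0<..}" for \<phi> and n :: nat by (rule maps_pos)
  define e where "e = (\<lambda>\<phi> \<phi>'. expectation (\<lambda>\<omega>. Z \<phi> \<omega> * Z \<phi>' \<omega>))"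
  have prod1: "\<bar>Z \<phi> \<omega> * Z \<phi>' \<omega>\<bar> \<le> 1" if "\<phi> \<in> I \<rightarrow>\<^sub>E {0<..}" "\<phi>' \<in> I \<rightarrow>\<^sub>E {0<..}" "\<omega> \<in> space M" for \<phi> \<phi>' \<omega>
    unfolding abs_mult using bound[OF that(1,3)] bound[OF that(2,3)] mult_mono[of "\<bar>Z \<phi> \<omega>\<bar>" 1 "\<bar>Z \<phi>' \<omega>\<bar>" 1] by auto
  have int: "integrable M (\<lambda>\<omega>. Z \<phi> \<omega> * Z \<phi>' \<omega>)" if "\<phi> \<in> I \<rightarrow>\<^sub>E {0<..}" "\<phi>' \<in> I \<rightarrow>\<^sub>E {0<..}" for \<phi> \<phi>'
    by (rule integrable_const_bound[where B = 1])
      (use prod1 that meas in \<open>auto intro!: borel_measurable_times AE_I2\<close>)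
  have e1: "\<bar>e \<phi> \<phi>'\<bar> \<le> 1" if "\<phi> \<in> I \<rightarrow>\<^sub>E {0<..}" "\<phi>' \<in> I \<rightarrow>\<^sub>E {0<..}" for \<phi> \<phi>'
  proof -
    have "\<bar>e \<phi> \<phi>'\<bar> \<le> expectation (\<lambda>\<omega>. \<bar>Z \<phi> \<omega> * Z \<phi>' \<omega>\<bar>)"
      unfolding e_def using integral_norm_bound[of M "\<lambda>\<omega>. Z \<phi> \<omega> * Z \<phi>' \<omega>"] by simp
    also have "\<dots> \<le> expectation (\<lambda>_. 1)"
      by (rule integral_mono) (use int[OF that] prod1[OF that] in auto)
    finally show ?thesis by (simp add: prob_space)
  qed
  have "expectation (\<lambda>\<omega>. sample_mean I N (\<lambda>\<phi>. Z \<phi> \<omega>) * sample_mean I K (\<lambda>\<phi>. Z \<phi> \<omega>)) =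
        sample_mean I N (\<lambda>\<phi>. sample_mean I K (\<lambda>\<phi>'. e \<phi> \<phi>'))"
  proof -
    have "expectation (\<lambda>\<omega>. sample_mean I N (\<lambda>\<phi>. Z \<phi> \<omega>) * sample_mean I K (\<lambda>\<phi>. Z \<phi> \<omega>)) =
      expectation (\<lambda>\<omega>. (\<Sum>\<phi>\<in>I \<rightarrow>\<^sub>E {1..N}. \<Sum>\<phi>'\<in>I \<rightarrow>\<^sub>E {1..K}. Z \<phi> \<omega> * Z \<phi>' \<omega>) / (real N ^ ?m * real K ^ ?m))"
      unfolding sample_mean_def by (simp add: sum_product)
    also have "\<dots> = (\<Sum>\<phi>\<in>I \<rightarrow>\<^sub>E {1..N}. \<Sum>\<phi>'\<in>I \<rightarrow>\<^sub>E {1..K}. e \<phi> \<phi>') / (real N ^ ?m * real K ^ ?m)"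
      unfolding e_def using int pos
      by (subst integral_divide_zero, subst Bochner_Integration.integral_sum)
        (auto intro!: Bochner_Integration.integrable_sum sum.cong Bochner_Integration.integral_sum)
    also have "\<dots> = sample_mean I N (\<lambda>\<phi>. sample_mean I K (\<lambda>\<phi>'. e \<phi> \<phi>'))"
      unfolding sample_mean_def by (simp add: sum_divide_distrib[symmetric] mult.commute)
    finally show ?thesis .
  qed
  also have "\<bar>\<dots> - c\<bar> \<le> 4 * D"
  proof -
    have "\<bar>sample_mean I K (\<lambda>\<phi>'. e \<phi> \<phi>') - c\<bar> \<le> 2 * of_bool (\<not> spread F I \<phi>) + 2 * D"
      if \<phi>: "\<phi> \<in> I \<rightarrow>\<^sub>E {0<..}" for \<phi>
    proof -
      have "sample_mean I K (\<lambda>\<phi>'. of_bool (\<not> spread (F \<union> \<phi> ` I) I \<phi>')) \<le> ?m * (?m + card (F \<union> \<phi> ` I)) / K"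
        by (rule sample_mean_not_spread) (use I F N in auto)
      also have "card (F \<union> \<phi> ` I) \<le> card F + ?m"
        using card_Un_le[of F "\<phi> ` I"] card_image_le[OF I, of \<phi>] by linarith
      then have "?m * (?m + card (F \<union> \<phi> ` I)) / K \<le> ?m * (?m + (card F + ?m)) / N"
        using N by (intro frac_le of_nat_mono mult_left_mono) auto
      finally have *: "sample_mean I K (\<lambda>\<phi>'. of_bool (\<not> spread (F \<union> \<phi> ` I) I \<phi>')) \<le> D"
        by (simp add: D_def algebra_simps)
      have "\<bar>sample_mean I K (\<lambda>\<phi>'. e \<phi> \<phi>') - c\<bar> = \<bar>sample_mean I K (\<lambda>\<phi>'. e \<phi> \<phi>' - c)\<bar>"
        using I N by (simp add: sample_mean_diff sample_mean_const)
      also have "\<dots> \<le> sample_mean I K (\<lambda>\<phi>'. \<bar>e \<phi> \<phi>' - c\<bar>)" by (rule abs_sample_mean_le)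
      also have "\<dots> \<le> sample_mean I K (\<lambda>\<phi>'. 2 * of_bool (\<not> spread F I \<phi>) + 2 * of_bool (\<not> spread (F \<union> \<phi> ` I) I \<phi>'))"
      proof (rule sample_mean_mono)
        fix \<phi>' assume "\<phi>' \<in> I \<rightarrow>\<^sub>E {1..K}"
        then have \<phi>': "\<phi>' \<in> I \<rightarrow>\<^sub>E {0<..}" by (rule pos)
        have "\<bar>e \<phi> \<phi>' - c\<bar> \<le> 2" using e1[OF \<phi> \<phi>'] c1 by linarith
        moreover have "e \<phi> \<phi>' = c" if "spread F I \<phi>" "spread (F \<union> \<phi> ` I) I \<phi>'"
          unfolding e_def by (rule c[OF \<phi> \<phi>' that])
        ultimately show "\<bar>e \<phi> \<phi>' - c\<bar> \<le> 2 * of_bool (\<not> spread F I \<phi>) + 2 * of_bool (\<not> spread (F \<union> \<phi> ` I) I \<phi>')"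
          by (auto simp: of_bool_def)
      qed
      also have "\<dots> \<le> 2 * of_bool (\<not> spread F I \<phi>) + 2 * D"
        using * I N by (simp add: sample_mean_add sample_mean_cmult sample_mean_const)
      finally show ?thesis .
    qed
    then have b: "\<bar>sample_mean I K (\<lambda>\<phi>'. e \<phi> \<phi>') - c\<bar> \<le> 2 * of_bool (\<not> spread F I \<phi>) + 2 * D"
      if "\<phi> \<in> I \<rightarrow>\<^sub>E {1..N}" for \<phi> using pos[OF that] by blast
    have "sample_mean I N (\<lambda>\<phi>. of_bool (\<not> spread F I \<phi>)) \<le> ?m * (?m + card F) / N"
      by (rule sample_mean_not_spread) (use I F N in auto)
    also have "\<dots> \<le> D" unfolding D_def using N by (intro divide_right_mono) (auto intro!: mult_left_mono)
    finally have *: "sample_mean I N (\<lambda>\<phi>. of_bool (\<not> spread F I \<phi>)) \<le> D" .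
    have "\<bar>sample_mean I N (\<lambda>\<phi>. sample_mean I K (\<lambda>\<phi>'. e \<phi> \<phi>')) - c\<bar> =
          \<bar>sample_mean I N (\<lambda>\<phi>. sample_mean I K (\<lambda>\<phi>'. e \<phi> \<phi>') - c)\<bar>"
      using I N by (subst sample_mean_diff[of _ _ _ "\<lambda>_. c"]) (simp add: sample_mean_const)
    also have "\<dots> \<le> sample_mean I N (\<lambda>\<phi>. \<bar>sample_mean I K (\<lambda>\<phi>'. e \<phi> \<phi>') - c\<bar>)" by (rule abs_sample_mean_le)
    also have "\<dots> \<le> sample_mean I N (\<lambda>\<phi>. 2 * of_bool (\<not> spread F I \<phi>) + 2 * D)"
      by (rule sample_mean_mono) (rule b)
    also have "\<dots> \<le> 4 * D"
      using * I N by (simp add: sample_mean_add sample_mean_cmult sample_mean_const)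
    finally show ?thesis .
  qed
  finally show ?thesis by (simp add: D_def)
qed

text \<open>By the previous lemma the expectations of \<open>S N * S K\<close> are \<open>c + O(1 / N)\<close> for the averages \<open>S N\<close>,
so that \<open>S N - S K\<close> has second moment \<open>O(1 / N)\<close>.  Hence the averages form a Cauchy sequence in mean square, and
almost surely so along a sufficiently sparse sequence of sizes; between these sizes they
vary little for every outcome.  This is an elementary alternative to the
reverse martingale argument for exchangeable arrays.\<close>

lemma sample_means_converge:
  fixes Z :: "(nat \<Rightarrow> nat) \<Rightarrow> 'a \<Rightarrow> real"
  assumes I: "finite I" and F: "finite F"
    and meas: "\<And>\<phi>. \<phi> \<in> I \<rightarrow>\<^sub>E {0<..} \<Longrightarrow> Z \<phi> \<in> borel_measurable M"
    and bound: "\<And>\<phi> \<omega>. \<phi> \<in> I \<rightarrow>\<^sub>E {0<..} \<Longrightarrow> \<omega> \<in> space M \<Longrightarrow> \<bar>Z \<phi> \<omega>\<bar> \<le> 1"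
    and c: "\<And>\<phi> \<phi>'. \<phi> \<in> I \<rightarrow>\<^sub>E {0<..} \<Longrightarrow> \<phi>' \<in> I \<rightarrow>\<^sub>E {0<..} \<Longrightarrow> spread F I \<phi> \<Longrightarrow>
            spread (F \<union> \<phi> ` I) I \<phi>' \<Longrightarrow> expectation (\<lambda>\<omega>. Z \<phi> \<omega> * Z \<phi>' \<omega>) = c"
    and c1: "\<bar>c\<bar> \<le> 1"
  obtains L where "L \<in> borel_measurable M" "expectation (\<lambda>\<omega>. (L \<omega>)\<^sup>2) = c"
    "\<And>\<omega>. \<omega> \<in> space M \<Longrightarrow> \<bar>L \<omega>\<bar> \<le> 1"
    "AE \<omega> in M. (\<lambda>N. sample_mean I N (\<lambda>\<phi>. Z \<phi> \<omega>)) \<longlonglongrightarrow> L \<omega>"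
proof -
  define m where "m = card I"
  define S where "S = (\<lambda>N \<omega>. sample_mean I N (\<lambda>\<phi>. Z \<phi> \<omega>))"
  define C where "C = 4 * real (m * (2 * m + card F))"
  have pos: "\<phi> \<in> I \<rightarrow>\<^sub>E {1..n} \<Longrightarrow> \<phi> \<in> I \<rightarrow>\<^sub>E {0<..}" for \<phi> and n :: nat by (rule maps_pos)
  have mS[measurable]: "S N \<in> borel_measurable M" for N
    unfolding S_def by (rule sample_mean_measurable) (use meas pos in blast)
  have S1: "\<bar>S N \<omega>\<bar> \<le> 1" if "\<omega> \<in> space M" for N \<omega>
    unfolding S_def by (rule abs_sample_mean_le_1[OF I]) (use bound pos that in blast)
  have SS1: "\<bar>S N \<omega> * S K \<omega>\<bar> \<le> 1" if "\<omega> \<in> space M" for N K \<omega>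
    unfolding abs_mult using S1[OF that, of N] S1[OF that, of K] mult_mono[of "\<bar>S N \<omega>\<bar>" 1 "\<bar>S K \<omega>\<bar>" 1] by auto
  have iSS: "integrable M (\<lambda>\<omega>. S N \<omega> * S K \<omega>)" for N K
    by (rule integrable_const_bound[where B = 1]) (use SS1 in \<open>auto intro!: AE_I2\<close>)
  have ESS: "\<bar>expectation (\<lambda>\<omega>. S N \<omega> * S K \<omega>) - c\<bar> \<le> C / N" if "1 \<le> N" "N \<le> K" for N K
    unfolding S_def C_def m_def
    by (rule order.trans[OF sample_mean_product_expectation[of I F Z c N K]]) (use assms that in auto)
  have C0: "C \<ge> 0" by (simp add: C_def)
  have L2: "expectation (\<lambda>\<omega>. (S N \<omega> - S K \<omega>)\<^sup>2) \<le> 4 * C / N" if "1 \<le> N" "N \<le> K" for N K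
  proof -
    have "expectation (\<lambda>\<omega>. (S N \<omega> - S K \<omega>)\<^sup>2) =
      expectation (\<lambda>\<omega>. S N \<omega> * S N \<omega> + S K \<omega> * S K \<omega> - 2 * (S N \<omega> * S K \<omega>))"
      by (rule Bochner_Integration.integral_cong) (auto simp: power2_eq_square algebra_simps)
    also have "\<dots> = expectation (\<lambda>\<omega>. S N \<omega> * S N \<omega>) + expectation (\<lambda>\<omega>. S K \<omega> * S K \<omega>)
        - 2 * expectation (\<lambda>\<omega>. S N \<omega> * S K \<omega>)"
      using iSS by simp
    also have "\<dots> \<le> C / N + C / K + 2 * (C / N)"
    proof -
      have "expectation (\<lambda>\<omega>. S N \<omega> * S N \<omega>) - c \<le> C / N"
        "expectation (\<lambda>\<omega>. S K \<omega> * S K \<omega>) - c \<le> C / K"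
        "c - expectation (\<lambda>\<omega>. S N \<omega> * S K \<omega>) \<le> C / N"
        using ESS[of N N] ESS[of K K] ESS[OF that] that unfolding abs_le_iff by auto
      then show ?thesis by argo
    qed
    also have "C / K \<le> C / N" using that C0 by (intro divide_left_mono) auto
    finally show ?thesis by simp
  qed
  \<comment> \<open>Along fourth powers the increments have second moment of order \<open>1 / k\<^sup>4\<close>, hence summable means, while
    the ratio of consecutive sizes still tends to 1.\<close>
  define T where "T = (\<lambda>k. S (Suc k ^ 4))"
  have mT[measurable]: "T k \<in> borel_measurable M" for k by (simp add: T_def)
  have T2: "\<bar>T k \<omega> - T (Suc k) \<omega>\<bar> \<le> 2" if "\<omega> \<in> space M" for k \<omega>
    using S1[OF that, of "Suc k ^ 4"] S1[OF that, of "Suc (Suc k) ^ 4"] unfolding T_def by linarith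
  define B where "B = (\<lambda>k. (4 * C + 1) / (real (Suc k))\<^sup>2)"
  have ET: "expectation (\<lambda>\<omega>. \<bar>T k \<omega> - T (Suc k) \<omega>\<bar>) \<le> B k" for k
  proof -
    let ?x = "real (Suc k)"
    have "(T k \<omega> - T (Suc k) \<omega>)\<^sup>2 \<le> 4" if "\<omega> \<in> space M" for \<omega>
      using T2[OF that, of k] abs_le_square_iff[of "T k \<omega> - T (Suc k) \<omega>" 2] by simp
    then have i2: "integrable M (\<lambda>\<omega>. (T k \<omega> - T (Suc k) \<omega>)\<^sup>2)"
      by (intro integrable_const_bound[where B = 4] AE_I2) auto
    have "expectation (\<lambda>\<omega>. \<bar>T k \<omega> - T (Suc k) \<omega>\<bar>) \<le> expectation (\<lambda>\<omega>. ?x\<^sup>2 * (T k \<omega> - T (Suc k) \<omega>)\<^sup>2 + 1 / ?x\<^sup>2)"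
    proof (rule integral_mono')
      fix \<omega>
      define y where "y = \<bar>T k \<omega> - T (Suc k) \<omega>\<bar>"
      \<comment> \<open>The weights \<open>x\<^sup>2\<close> and \<open>1 / x\<^sup>2\<close> balance a second moment of order \<open>1 / x\<^sup>4\<close>.\<close>
      have "0 \<le> (?x * y - 1 / ?x)\<^sup>2" by simp
      also have "\<dots> = ?x\<^sup>2 * y\<^sup>2 + 1 / ?x\<^sup>2 - 2 * y"
        by (simp add: power2_diff power_mult_distrib power_divide)
      finally have "2 * y \<le> ?x\<^sup>2 * y\<^sup>2 + 1 / ?x\<^sup>2" by simp
      moreover have "0 \<le> y" by (simp add: y_def)
      ultimately have "y \<le> ?x\<^sup>2 * y\<^sup>2 + 1 / ?x\<^sup>2" by linarith
      then show "\<bar>T k \<omega> - T (Suc k) \<omega>\<bar> \<le> ?x\<^sup>2 * (T k \<omega> - T (Suc k) \<omega>)\<^sup>2 + 1 / ?x\<^sup>2"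
        by (simp add: y_def)
    qed (use i2 in auto)
    also have "\<dots> = ?x\<^sup>2 * expectation (\<lambda>\<omega>. (T k \<omega> - T (Suc k) \<omega>)\<^sup>2) + 1 / ?x\<^sup>2"
      using i2 by (simp add: prob_space)
    also have "\<dots> \<le> ?x\<^sup>2 * (4 * C / real (Suc k ^ 4)) + 1 / ?x\<^sup>2"
      unfolding T_def by (intro add_right_mono mult_left_mono L2 power_mono) auto
    also have "\<dots> = B k"
    proof -
      have "?x\<^sup>2 * (4 * C / real (Suc k ^ 4)) = 4 * C / ?x\<^sup>2"
        unfolding of_nat_power by (simp add: field_simps power2_eq_square power4_eq_xxxx del: of_nat_Suc)
      then show ?thesis unfolding B_def by (simp add: add_divide_distrib)
    qed
    finally show ?thesis .
  qed
  have sumB: "summable B"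
    unfolding B_def divide_inverse
    using inverse_power_summable[of 2, where 'a = real]
      summable_Suc_iff[of "\<lambda>n. inverse ((real n)\<^sup>2)"] by (intro summable_mult) simp
  have "(\<integral>\<^sup>+\<omega>. (\<Sum>k. ennreal \<bar>T k \<omega> - T (Suc k) \<omega>\<bar>) \<partial>M) = (\<Sum>k. \<integral>\<^sup>+\<omega>. ennreal \<bar>T k \<omega> - T (Suc k) \<omega>\<bar> \<partial>M)"
    by (rule nn_integral_suminf) simp
  also have "\<dots> \<le> (\<Sum>k. ennreal (B k))"
  proof (rule suminf_le)
    fix k
    have "integrable M (\<lambda>\<omega>. \<bar>T k \<omega> - T (Suc k) \<omega>\<bar>)"
      using T2 by (intro integrable_const_bound[where B = 2] AE_I2) auto
    then show "(\<integral>\<^sup>+\<omega>. ennreal \<bar>T k \<omega> - T (Suc k) \<omega>\<bar> \<partial>M) \<le> ennreal (B k)"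
      using ET[of k] by (subst nn_integral_eq_integral) (auto intro: ennreal_leI)
  qed auto
  also have "\<dots> < \<infinity>"
    using sumB C0 by (subst suminf_ennreal2) (auto simp: B_def)
  finally have "AE \<omega> in M. (\<Sum>k. ennreal \<bar>T k \<omega> - T (Suc k) \<omega>\<bar>) \<noteq> \<infinity>"
    by (intro nn_integral_PInf_AE) auto
  then have convT: "AE \<omega> in M. convergent (\<lambda>k. T k \<omega>)"
  proof eventually_elim
    case (elim \<omega>)
    have "summable (\<lambda>k. \<bar>T k \<omega> - T (Suc k) \<omega>\<bar>)"
      by (rule summable_suminf_not_top) (use elim in auto)
    then have "summable (\<lambda>k. T (Suc k) \<omega> - T k \<omega>)"
      by (intro summable_rabs_cancel[of "\<lambda>k. T (Suc k) \<omega> - T k \<omega>"])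
        (subst abs_minus_commute, assumption)
    then have "convergent (\<lambda>n. \<Sum>k<n. T (Suc k) \<omega> - T k \<omega>)"
      by (simp add: summable_iff_convergent)
    then have "convergent (\<lambda>n. T n \<omega> - T 0 \<omega>)" by (simp add: sum_lessThan_telescope[of "\<lambda>k. T k \<omega>"])
    then show ?case using convergent_add[OF _ convergent_const[of "T 0 \<omega>"]] by fastforce
  qed
  \<comment> \<open>Truncation keeps \<open>L\<close> bounded on the null set where \<open>lim\<close> is arbitrary.\<close>
  define L where "L = (\<lambda>\<omega>. max (-1) (min 1 (lim (\<lambda>k. T k \<omega>))))"
  have mL[measurable]: "L \<in> borel_measurable M"
    unfolding L_def by (intro borel_measurable_max borel_measurable_min borel_measurable_lim_metric) auto
  have TL: "AE \<omega> in M. (\<lambda>k. T k \<omega>) \<longlonglongrightarrow> L \<omega>"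
    using convT AE_space
  proof eventually_elim
    case (elim \<omega>)
    then have l: "(\<lambda>k. T k \<omega>) \<longlonglongrightarrow> lim (\<lambda>k. T k \<omega>)" by (simp add: convergent_LIMSEQ_iff)
    have "\<bar>lim (\<lambda>k. T k \<omega>)\<bar> \<le> 1"
      by (rule LIMSEQ_le_const2[OF tendsto_rabs[OF l]]) (use S1 elim in \<open>auto simp: T_def\<close>)
    then have "L \<omega> = lim (\<lambda>k. T k \<omega>)" by (auto simp: L_def)
    with l show ?case by simp
  qed
  have L1: "\<bar>L \<omega>\<bar> \<le> 1" for \<omega> by (auto simp: L_def)
  have "(\<lambda>k. expectation (\<lambda>\<omega>. (T k \<omega>)\<^sup>2)) \<longlonglongrightarrow> expectation (\<lambda>\<omega>. (L \<omega>)\<^sup>2)"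
  proof (rule integral_dominated_convergence[where w = "\<lambda>_. 1"])
    show "AE \<omega> in M. (\<lambda>k. (T k \<omega>)\<^sup>2) \<longlonglongrightarrow> (L \<omega>)\<^sup>2"
      using TL by eventually_elim (intro tendsto_power)
    show "AE \<omega> in M. norm ((T k \<omega>)\<^sup>2) \<le> 1" for k
      using S1 by (intro AE_I2) (auto simp: T_def abs_square_le_1)
  qed auto
  moreover have "(\<lambda>k. expectation (\<lambda>\<omega>. (T k \<omega>)\<^sup>2)) \<longlonglongrightarrow> c"
  proof (rule LIM_zero_cancel, rule Lim_null_comparison)
    show "\<forall>\<^sub>F k in sequentially. norm (expectation (\<lambda>\<omega>. (T k \<omega>)\<^sup>2) - c) \<le> C / real (Suc k ^ 4)"
      using ESS[of "Suc k ^ 4" "Suc k ^ 4" for k] unfolding T_def power2_eq_square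
      by (intro always_eventually allI) (auto simp: Suc_le_eq)
    show "(\<lambda>k. C / real (Suc k ^ 4)) \<longlonglongrightarrow> 0"
      by real_asymp
  qed
  ultimately have EL: "expectation (\<lambda>\<omega>. (L \<omega>)\<^sup>2) = c" by (rule LIMSEQ_unique)
  have "AE \<omega> in M. (\<lambda>N. S N \<omega>) \<longlonglongrightarrow> L \<omega>"
    using TL AE_space
  proof eventually_elim
    case (elim \<omega>)
    have step: "\<bar>S N \<omega> - T k \<omega>\<bar> \<le> 2 * (1 - ((1 + real k) / (2 + real k)) ^ (4 * m))"
      if "Suc k ^ 4 \<le> N" "N \<le> Suc (Suc k) ^ 4" for N k
    proof -
      have 1: "\<bar>S N \<omega> - T k \<omega>\<bar> \<le> 2 * (1 - (real (Suc k ^ 4) / N) ^ m)"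
        unfolding S_def T_def m_def
        by (rule sample_mean_change_size) (use I bound pos elim that in \<open>auto simp: Suc_le_eq\<close>)
      have "((1 + real k) / (2 + real k)) ^ (4 * m) \<le> (real (Suc k ^ 4) / N) ^ m"
      proof -
        have "real N \<le> real (Suc (Suc k) ^ 4)" using that of_nat_le_iff by blast
        moreover have "0 < N" using that by (metis neq0_conv power_eq_0_iff le_zero_eq nat.distinct(1))
        ultimately have "((1 + real k) / (2 + real k)) ^ 4 \<le> real (Suc k ^ 4) / N"
          unfolding power_divide by (intro frac_le) (auto simp: add.commute)
        then show ?thesis unfolding power_mult by (intro power_mono) auto
      qed
      then show ?thesis using 1 by argo
    qed
    show ?case
    proof (rule LIMSEQ_I)
      fix r :: real assume r: "r > 0"
      have "(\<lambda>k. 2 * (1 - ((1 + real k) / (2 + real k)) ^ (4 * m))) \<longlonglongrightarrow> 2 * (1 - 1 ^ (4 * m))"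
        by (intro tendsto_intros) real_asymp
      then have "\<forall>\<^sub>F k in sequentially. 2 * (1 - ((1 + real k) / (2 + real k)) ^ (4 * m)) < r / 2"
        using r by (intro order_tendstoD) auto
      moreover have "\<forall>\<^sub>F k in sequentially. norm (T k \<omega> - L \<omega>) < r / 2"
        using LIMSEQ_D[OF elim(1), of "r / 2"] r by (auto simp: eventually_sequentially)
      ultimately have "\<forall>\<^sub>F k in sequentially. 2 * (1 - ((1 + real k) / (2 + real k)) ^ (4 * m)) < r / 2
          \<and> norm (T k \<omega> - L \<omega>) < r / 2" by (rule eventually_conj)
      then obtain k0 where k0: "\<And>k. k \<ge> k0 \<Longrightarrow> 2 * (1 - ((1 + real k) / (2 + real k)) ^ (4 * m)) < r / 2 \<and>
          norm (T k \<omega> - L \<omega>) < r / 2"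
        unfolding eventually_sequentially by blast
      have "norm (S N \<omega> - L \<omega>) < r" if N: "N \<ge> Suc k0 ^ 4" for N
      proof -
        let ?P = "\<lambda>k. Suc k ^ 4 \<le> N"
        have b: "\<forall>k. ?P k \<longrightarrow> k \<le> N"
          using power_increasing[of 1 4] by (metis Suc_leD le_trans one_le_numeral power_one_right self_le_power le_add1 plus_1_eq_Suc)
        define k where "k = (GREATEST k. ?P k)"
        have k: "?P k" unfolding k_def by (rule GreatestI_nat[of ?P k0 N]) (use N b in auto)
        have k0k: "k0 \<le> k" unfolding k_def by (rule Greatest_le_nat[of ?P k0 N]) (use N b in auto)
        have "\<not> ?P (Suc k)"
        proof
          assume "?P (Suc k)"
          then have "Suc k \<le> k" by (subst (2) k_def) (rule Greatest_le_nat[of ?P "Suc k" N], use b in auto)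
          then show False by simp
        qed
        then have "N \<le> Suc (Suc k) ^ 4" by linarith
        from step[OF k this] have "\<bar>S N \<omega> - T k \<omega>\<bar> < r / 2" using k0[OF k0k] by linarith
        moreover have "\<bar>T k \<omega> - L \<omega>\<bar> < r / 2" using k0[OF k0k] by simp
        ultimately show ?thesis unfolding real_norm_def by linarith
      qed
      then show "\<exists>no. \<forall>n\<ge>no. norm (S n \<omega> - L \<omega>) < r" by blast
    qed
  qed
  then show ?thesis using that[OF mL EL] L1 unfolding S_def by blast
qed

end

section \<open>Relabelling and restriction\<close>

lemma structs_length: "M \<in> structs sig S \<Longrightarrow> length M = length sig"
  by (auto simp: structs_def dest: list_all2_lengthD)

lemma structs_mono: "S \<subseteq> T \<Longrightarrow> M \<in> structs sig S \<Longrightarrow> M \<in> structs sig T"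
  unfolding structs_def by (auto elim!: list_all2_mono)

lemma length_relabel [simp]: "length (relabel S \<phi> M) = length M"
  by (simp add: relabel_def)

lemma length_zero_struct [simp]: "length (zero_struct sig) = length sig"
  by (simp add: zero_struct_def)

lemma relabel_in_structs: "M \<in> structs sig T \<Longrightarrow> relabel S \<phi> M \<in> structs sig S"
  by (fastforce simp: structs_def relabel_def list_all2_conv_all_nth)

lemma zero_in_structs [simp]: "zero_struct sig \<in> structs sig S"
  by (auto simp: structs_def zero_struct_def list_all2_conv_all_nth)

lemma relabel_zero [simp]: "relabel S \<phi> (zero_struct sig) = zero_struct sig"
  by (simp add: relabel_def zero_struct_def)

lemma restr_eq_relabel: "restr S M = relabel S id M"
  by (auto simp: restr_def relabel_def)

lemma relabel_relabel: "\<psi> ` S \<subseteq> T \<Longrightarrow> relabel S \<psi> (relabel T \<phi> M) = relabel S (\<phi> \<circ> \<psi>) M"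
  by (auto simp: relabel_def subset_iff)

lemma relabel_restr: "\<phi> ` S \<subseteq> T \<Longrightarrow> relabel S \<phi> (restr T M) = relabel S \<phi> M"
  by (simp add: restr_eq_relabel relabel_relabel)

lemma relabel_cong: 
  assumes "\<And>x. x \<in> S \<Longrightarrow> \<phi> x = \<psi> x"
  shows "relabel S \<phi> M = relabel S \<psi> M"
proof -
  have h: "map \<phi> a = map \<psi> a" if "set a \<subseteq> S" for a using that assms by (auto simp: subset_iff)
  then show ?thesis unfolding relabel_def by (intro map_cong refl Collect_cong conj_cong) (simp only: h)
qed

lemma restr_relabel: "restr S (relabel T \<phi> M) = relabel (S \<inter> T) \<phi> M"
  by (auto simp: restr_def relabel_def)

lemma restr_structs: "M \<in> structs sig S \<Longrightarrow> restr S M = M"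
  by (auto simp: restr_def structs_def list_all2_conv_all_nth subset_iff intro!: nth_equalityI)

lemma relabel_eq_zero_iff:
  "length M = length sig \<Longrightarrow> relabel S \<phi> M = zero_struct sig \<longleftrightarrow> (\<forall>R\<in>set M. \<forall>a. set a \<subseteq> S \<longrightarrow> map \<phi> a \<notin> R)"
  unfolding relabel_def zero_struct_def by (auto simp: list_eq_iff_nth_eq all_set_conv_all_nth)

lemma relabel_symdiff:
  "length M = length N \<Longrightarrow> relabel S \<phi> (symdiff M N) = symdiff (relabel S \<phi> M) (relabel S \<phi> N)"
  by (auto simp: relabel_def symdiff_def list_eq_iff_nth_eq)

lemma symdiff_zero_right: "length M = length sig \<Longrightarrow> symdiff M (zero_struct sig) = M"
  by (auto simp: symdiff_def zero_struct_def list_eq_iff_nth_eq)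

section \<open>The space of structures\<close>

lemma open_restr_event:
  "openin (LN_top sig) {M \<in> structs sig {0<..}. Q (restr {1..n} M)}"
  unfolding LN_open_iff by (auto simp: cyl_def intro!: exI[of _ n])

lemma finite_subset_atLeast1:
  fixes S :: "nat set"
  assumes "finite S" "S \<subseteq> {0<..}" shows "S \<subseteq> {1..Max (insert 0 S)}"
  using assms by (auto simp: Suc_le_eq)

lemma open_relabel_event:
  assumes "finite S" "\<phi> ` S \<subseteq> {0<..}"
  shows "openin (LN_top sig) {M \<in> structs sig {0<..}. Q (relabel S \<phi> M)}"
proof -
  define n where "n = Max (insert 0 (\<phi> ` S))"
  have "\<phi> ` S \<subseteq> {1..n}" unfolding n_def using assms by (intro finite_subset_atLeast1) auto
  then have "relabel S \<phi> (restr {1..n} M) = relabel S \<phi> M" for M by (rule relabel_restr)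
  then show ?thesis using open_restr_event[of sig "\<lambda>A. Q (relabel S \<phi> A)" n] by simp
qed

lemma topspace_LN_top [simp]: "topspace (LN_top sig) = structs sig {0<..}"
  using Metric_space.topspace_mtopology[OF Metric_space_structs] by (simp add: LN_top_def)

lemma closed_relabel_event:
  assumes "finite S" "\<phi> ` S \<subseteq> {0<..}"
  shows "closedin (LN_top sig) {M \<in> structs sig {0<..}. Q (relabel S \<phi> M)}"
proof -
  have "structs sig {0<..} - {M \<in> structs sig {0<..}. Q (relabel S \<phi> M)} =
        {M \<in> structs sig {0<..}. \<not> Q (relabel S \<phi> M)}" by auto
  then show ?thesis unfolding closedin_def using open_relabel_event[OF assms] by auto
qed

lemma relabel_event_sets:
  assumes "finite S" "\<phi> ` S \<subseteq> {0<..}"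
  shows "{M \<in> structs sig {0<..}. Q (relabel S \<phi> M)} \<in> sets (LN_borel sig)"
  unfolding sets_LN_borel using open_relabel_event[OF assms] by blast

lemma restr_event_sets: "{M \<in> structs sig {0<..}. Q (restr {1..n} M)} \<in> sets (LN_borel sig)"
  unfolding restr_eq_relabel by (rule relabel_event_sets) auto

lemma measurable_relabel:
  assumes "T \<subseteq> {0<..}" "\<phi> ` T \<subseteq> {0<..}"
  shows "relabel T \<phi> \<in> measurable (LN_borel sig) (LN_borel sig)"
proof (rule measurable_sigma_sets[OF sets_LN_borel_cyl])
  show "relabel T \<phi> \<in> space (LN_borel sig) \<rightarrow> structs sig {0<..}"
    using relabel_in_structs structs_mono[OF assms(1)] by auto
  fix y assume "y \<in> {cyl sig n A |n A. 1 \<le> n \<and> A \<in> structs sig {1..n}} \<union> {{}}"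
  then consider "y = {}" | n A where "y = cyl sig n A" by auto
  then show "relabel T \<phi> -` y \<inter> space (LN_borel sig) \<in> sets (LN_borel sig)"
  proof cases
    case 2
    have "relabel T \<phi> -` y \<inter> space (LN_borel sig) = {M \<in> structs sig {0<..}. relabel ({1..n} \<inter> T) \<phi> M = A}"
      using relabel_in_structs[of _ sig "{0<..}" T \<phi>] structs_mono[OF assms(1)]
      by (auto simp: 2 cyl_def restr_relabel)
    moreover have "\<phi> ` ({1..n} \<inter> T) \<subseteq> {0<..}" using assms by blast
    ultimately show ?thesis using relabel_event_sets[of "{1..n} \<inter> T" \<phi> sig "\<lambda>B. B = A"] by simp
  qed simp
qed (auto simp: cyl_def)

lemma zero_struct_iff_restr:
  "M \<in> structs sig {0<..} \<Longrightarrow> M = zero_struct sig \<longleftrightarrow> (\<forall>n. restr {1..n} M = zero_struct sig)"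
  using structs_eqI[of M sig "zero_struct sig"] by (auto simp: restr_eq_relabel)

lemma zero_struct_sets: "{zero_struct sig} \<in> sets (LN_borel sig)"
proof -
  have "{zero_struct sig} = (\<Inter>n. {M \<in> structs sig {0<..}. restr {1..n} M = zero_struct sig})"
    using zero_struct_iff_restr[of _ sig] zero_in_structs[of sig "{0<..}"] by blast
  also have "\<dots> \<in> sets (LN_borel sig)" by (rule sets.countable_INT) (auto intro: restr_event_sets[unfolded One_nat_def])
  finally show ?thesis .
qed

text \<open>Only finitely many structures can be seen on \<open>{1..n}\<close>, which gives total boundedness; a Cauchy sequence is
eventually constant on every \<open>{1..n}\<close>, and the tuples that it eventually contains form its limit.\<close>

lemma compact_LN_top: "compact_space (LN_top sig)"
proof -
  interpret Metric_space "structs sig {0<..}" struct_dist by (rule Metric_space_structs)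
  have top: "mtopology = LN_top sig" by (simp add: LN_top_def)
  have small: "struct_dist M N < e" if "M \<in> structs sig {0<..}" "N \<in> structs sig {0<..}"
      "restr {1..n} M = restr {1..n} N" "1 / (1 + real n) < e" "e > 0" for M N n e
    using struct_dist_less_iff[OF that(1,2), of n] that by (cases "M = N") (auto simp: struct_dist_def)
  have arch: "\<exists>n. 1 / (1 + real n) < e" if "e > 0" for e :: real
    using reals_Archimedean[OF that] by (auto simp: inverse_eq_divide)
  have "mtotally_bounded (structs sig {0<..})"
    unfolding mtotally_bounded_def
  proof (intro allI impI)
    fix e :: real assume e: "e > 0"
    then obtain n where n: "1 / (1 + real n) < e" using arch by blast
    have sub: "structs sig {1..n} \<subseteq> structs sig {0<..}" by (auto intro: structs_mono[of "{1..n}"])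
    have "structs sig {0<..} \<subseteq> (\<Union>x\<in>structs sig {1..n}. mball x e)"
    proof
      fix M assume M: "M \<in> structs sig {0<..}"
      have r: "restr {1..n} M \<in> structs sig {1..n}" by (rule restr_in_structs[OF M])
      then have "restr {1..n} (restr {1..n} M) = restr {1..n} M" by (rule restr_structs)
      then have "struct_dist (restr {1..n} M) M < e" using small[of "restr {1..n} M" M n e] r sub M n e by auto
      then show "M \<in> (\<Union>x\<in>structs sig {1..n}. mball x e)" using r sub M by (intro UN_I[OF r]) auto
    qed
    then show "\<exists>K. finite K \<and> K \<subseteq> structs sig {0<..} \<and> structs sig {0<..} \<subseteq> (\<Union>x\<in>K. mball x e)"
      using finite_structs[of "{1..n}" sig] sub by blast
  qed
  moreover have "mcomplete"
    unfolding mcomplete_def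
  proof (intro allI impI)
    fix M assume C: "MCauchy M"
    then have MS: "M i \<in> structs sig {0<..}" for i by (auto simp: MCauchy_def)
    \<comment> \<open>The bound at \<open>Suc n\<close> covers the case \<open>n = 0\<close>: structures that differ on \<open>{1..1}\<close> have distance 1, whether
      or not their relations of arity 0 agree.\<close>
    have "\<exists>N. \<forall>i\<ge>N. \<forall>k\<ge>N. restr {1..n} (M i) = restr {1..n} (M k)" for n
    proof -
      have "1 / (1 + real (Suc n)) > 0" by simp
      then obtain N where N: "\<And>i k. N \<le> i \<Longrightarrow> N \<le> k \<Longrightarrow> struct_dist (M i) (M k) < 1 / (1 + real (Suc n))"
        using C unfolding MCauchy_def by blast
      have "restr {1..n} (M i) = restr {1..n} (M k)" if "i \<ge> N" "k \<ge> N" for i k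
      proof (cases "M i = M k")
        case False
        then have "restr {1..Suc n} (M i) = restr {1..Suc n} (M k)"
          using N[OF that] struct_dist_less_iff[OF MS MS False, of "Suc n"] by simp
        then show ?thesis by (rule restr_eq_mono) simp
      qed simp
      then show ?thesis by blast
    qed
    then obtain N where N: "\<And>n i k. i \<ge> N n \<Longrightarrow> k \<ge> N n \<Longrightarrow> restr {1..n} (M i) = restr {1..n} (M k)" by metis
    define L where "L = map (\<lambda>j. {a. \<forall>\<^sub>F i in sequentially. a \<in> M i ! j}) [0..<length sig]"
    have len: "length (M i) = length sig" for i using structs_length[OF MS] .
    have LS: "L \<in> structs sig {0<..}"
    proof -
      have "M i ! j \<subseteq> {a. length a = sig ! j \<and> set a \<subseteq> {0<..}}" if "j < length sig" for i j
        using MS[of i] that by (simp add: structs_def list_all2_conv_all_nth)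
      then have "L ! j \<subseteq> {a. length a = sig ! j \<and> set a \<subseteq> {0<..}}" if "j < length sig" for j
        using that by (fastforce simp: L_def eventually_sequentially)
      then show ?thesis by (simp add: structs_def list_all2_conv_all_nth L_def)
    qed
    have LM: "restr {1..n} L = restr {1..n} (M k)" if k: "k \<ge> N n" for n k
    proof (rule nth_equalityI)
      fix j assume "j < length (restr {1..n} L)"
      then have j: "j < length sig" by (simp add: L_def restr_def)
      have e: "a \<in> M i ! j \<longleftrightarrow> a \<in> M k ! j" if "i \<ge> N n" "set a \<subseteq> {1..n}" for i a
        using N[OF that(1) k] that(2) j len by (auto simp: restr_def list_eq_iff_nth_eq)
      have "(\<forall>\<^sub>F i in sequentially. a \<in> M i ! j) \<longleftrightarrow> a \<in> M k ! j" if a: "set a \<subseteq> {1..n}" for a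
      proof
        assume "\<forall>\<^sub>F i in sequentially. a \<in> M i ! j"
        then obtain i where "i \<ge> N n" "a \<in> M i ! j"
          unfolding eventually_sequentially by (metis max.cobounded1 max.cobounded2)
        then show "a \<in> M k ! j" using e a by blast
      qed (use e a in \<open>auto simp: eventually_sequentially\<close>)
      then show "restr {1..n} L ! j = restr {1..n} (M k) ! j"
        using j len by (auto simp: restr_def L_def)
    qed (simp add: restr_def L_def len)
    have "limitin mtopology M L sequentially"
      unfolding limitin_metric
    proof (intro conjI allI impI LS)
      fix e :: real assume e: "e > 0"
      then obtain n where n: "1 / (1 + real n) < e" using arch by blast
      have "struct_dist (M k) L < e" if "k \<ge> N n" for k
        using small[OF MS LS, of n k e] LM[OF that] n e by simp
      then show "\<forall>\<^sub>F k in sequentially. M k \<in> structs sig {0<..} \<and> struct_dist (M k) L < e"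
        using MS by (auto simp: eventually_sequentially)
    qed
    then show "\<exists>L. limitin mtopology M L sequentially" by blast
  qed
  ultimately show ?thesis using compact_space_eq_mcomplete_mtotally_bounded top by simp
qed

abbreviation visible :: "signature \<Rightarrow> nat \<Rightarrow> rel_struct set" where
  "visible sig n \<equiv> {M \<in> structs sig {0<..}. restr {1..n} M \<noteq> zero_struct sig}"

abbreviation hitting :: "signature \<Rightarrow> nat \<Rightarrow> (nat \<Rightarrow> nat) \<Rightarrow> rel_struct set" where
  "hitting sig m \<phi> \<equiv> {M \<in> structs sig {0<..}. relabel {1..m} \<phi> M \<noteq> zero_struct sig}"

abbreviation invisible_hitting :: "signature \<Rightarrow> nat \<Rightarrow> nat \<Rightarrow> (nat \<Rightarrow> nat) \<Rightarrow> rel_struct set" where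
  "invisible_hitting sig p m \<phi> \<equiv>
     {M \<in> structs sig {0<..}. restr {1..p} M = zero_struct sig \<and> relabel {1..m} \<phi> M \<noteq> zero_struct sig}"

section \<open>Exchangeable laws\<close>

text \<open>Invariance is required only on events that depend on finitely many labels.  In this form it can be
checked directly for measures, such as \<open>mixture\<close>, that are given by a formula.\<close>

definition exchangeable_law :: "signature \<Rightarrow> rel_struct measure \<Rightarrow> bool" where
  "exchangeable_law sig W \<longleftrightarrow> (\<forall>\<sigma>\<in>LN_perms. \<forall>n Q.
     emeasure W {M \<in> structs sig {0<..}. Q (relabel {1..n} \<sigma> M)} =
     emeasure W {M \<in> structs sig {0<..}. Q (restr {1..n} M)})"

lemma injection_extends_to_perm:
  assumes F: "finite F" "F \<subseteq> {0<..}" and \<xi>: "inj_on \<xi> F" "\<xi> ` F \<subseteq> {0<..}"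
  obtains \<sigma> where "\<sigma> \<in> LN_perms" "\<And>x. x \<in> F \<Longrightarrow> \<sigma> x = \<xi> x"
proof -
  define A where "A = {0::nat<..} - F"
  define B where "B = {0::nat<..} - \<xi> ` F"
  have inf: "infinite A" "infinite B"
    using F by (auto simp: A_def B_def infinite_Ioi intro!: Diff_infinite_finite)
  have "bij_betw (enumerate B \<circ> inv_into UNIV (enumerate A)) A B"
    using bij_enumerate[OF inf(1)] bij_enumerate[OF inf(2)]
    by (intro bij_betw_trans[of _ _ UNIV] bij_betw_inv_into)
  then obtain g where g: "bij_betw g A B" by blast
  have "bij_betw (\<lambda>x. if x \<in> F then \<xi> x else g x) (F \<union> A) (\<xi> ` F \<union> B)"
    by (rule bij_betw_disjoint_Un) (use \<xi> g in \<open>auto simp: bij_betw_def A_def B_def\<close>)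
  moreover have "F \<union> A = {0<..}" "\<xi> ` F \<union> B = {0<..}" using F \<xi> by (auto simp: A_def B_def)
  ultimately have "(\<lambda>x. if x \<in> F then \<xi> x else g x) \<in> LN_perms" by (simp add: LN_perms_def)
  then show ?thesis by (rule that) simp
qed

text \<open>An injection of a finite set of labels extends to a permutation of all labels, because the complements
of its domain and of its range are both countably infinite.\<close>

lemma exchangeable_lawD:
  assumes W: "exchangeable_law sig W" and F: "finite F" "F \<subseteq> {0<..}" and \<xi>: "inj_on \<xi> F" "\<xi> ` F \<subseteq> {0<..}"
  shows "emeasure W {M \<in> structs sig {0<..}. Q (relabel F \<xi> M)} =
         emeasure W {M \<in> structs sig {0<..}. Q (restr F M)}"
proof -
  obtain \<sigma> where \<sigma>: "\<sigma> \<in> LN_perms" "\<And>x. x \<in> F \<Longrightarrow> \<sigma> x = \<xi> x"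
    using injection_extends_to_perm[OF assms(2-)] by blast
  define n where "n = Max (insert 0 F)"
  have sub: "F \<subseteq> {1..n}" unfolding n_def using F by (intro finite_subset_atLeast1) auto
  have "restr F (relabel {1..n} \<sigma> M) = relabel F \<xi> M" for M
    unfolding restr_relabel Int_absorb2[OF sub] by (rule relabel_cong) (rule \<sigma>(2))
  moreover have "restr F (restr {1..n} M) = restr F M" for M
    unfolding restr_eq_relabel[of F] by (rule relabel_restr) (use sub in auto)
  ultimately show ?thesis
    using W \<sigma>(1) unfolding exchangeable_law_def by (auto dest!: bspec spec[of _ n] spec[of _ "\<lambda>A. Q (restr F A)"])
qed

section \<open>Combinatorial limits as laws\<close>

lemma labels_subset [simp]: "{Suc 0..n} \<subseteq> {0<..}" "{Suc 0..n} \<inter> {0<..} = {Suc 0..n}"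
  by auto

text \<open>In contrast to \<open>inj_density\<close> all maps are counted, which makes \<open>sample_mean_mult\<close> and \<open>sample_mean_marginal\<close>
applicable.\<close>

definition sampling_density :: "nat \<Rightarrow> rel_struct \<Rightarrow> rel_struct \<Rightarrow> nat \<Rightarrow> real" where
  "sampling_density m A M N = sample_mean {1..m} N (\<lambda>\<phi>. of_bool (relabel {1..m} \<phi> M = A))"

text \<open>Restricting the count to injections and changing the denominator from \<open>N ^ m\<close> to the number of injections
each changes the quotient by at most the proportion of maps with a collision.\<close>

lemma inj_density_approx: "(\<lambda>N. inj_density m A M N - sampling_density m A M N) \<longlonglongrightarrow> 0"
proof (rule Lim_null_comparison)
  show "(\<lambda>N. 2 * (real m * real m) / real N) \<longlonglongrightarrow> 0" by real_asymp
  have "norm (inj_density m A M N - sampling_density m A M N) \<le> 2 * (real m * real m) / real N"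
    if N: "N \<ge> Suc m" for N
  proof -
    define P where "P = {1..m} \<rightarrow>\<^sub>E {1..N}"
    define G where "G = {\<phi> \<in> P. inj_on \<phi> {1..m} \<and> relabel {1..m} \<phi> M = A}"
    define inj where "inj = {\<phi> \<in> P. inj_on \<phi> {1..m}}"
    have finP: "finite P" by (simp add: P_def finite_PiE)
    have cP: "card P = N ^ m" by (simp add: P_def card_funcsetE)
    have pos: "real N ^ m > 0" using N by simp
    have cinj: "real (card inj) = (\<Prod>i<m. real N - real i)"
    proof -
      have "card inj = prod ((-) N) {0..<m}"
        using card_inj_on_subset_funcset[of "{1..m}" "{1..N}" "{1..m}"] by (simp add: inj_def P_def)
      then show ?thesis using N by (simp add: atLeast0LessThan of_nat_diff)
    qed
    have injpos: "card inj > 0"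
    proof -
      have "(\<Prod>i<m. real N - real i) > 0" using N by (intro prod_pos) auto
      then show ?thesis using cinj by linarith
    qed
    have G_eq: "{\<phi> \<in> {1..m} \<rightarrow>\<^sub>E {1..N}. inj_on \<phi> {1..m} \<and> relabel {1..m} \<phi> (restr {1..N} M) = A} = G"
    proof -
      have "relabel {1..m} \<phi> (restr {1..N} M) = relabel {1..m} \<phi> M" if "\<phi> \<in> {1..m} \<rightarrow>\<^sub>E {1..N}" for \<phi>
        using that by (intro relabel_restr) (auto simp: PiE_iff)
      then show ?thesis unfolding G_def P_def by (intro Collect_cong) auto
    qed
    have d: "inj_density m A M N = real (card G) / real (card inj)"
      unfolding inj_density_def G_eq cinj by (rule refl)
    have mean_card: "sample_mean {1..m} N (\<lambda>\<phi>. of_bool (Q \<phi>)) = card {\<phi> \<in> P. Q \<phi>} / real N ^ m" for Q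
      unfolding sample_mean_def P_def of_bool_def
      by (subst sum.If_cases) (auto simp: finite_PiE Int_def)
    define B where "B = {\<phi> \<in> P. \<not> inj_on \<phi> {1..m} \<and> relabel {1..m} \<phi> M = A}"
    have "{\<phi> \<in> P. relabel {1..m} \<phi> M = A} = G \<union> B" "G \<inter> B = {}" by (auto simp: G_def B_def)
    moreover have "finite G" "finite B" using finP by (auto simp: G_def B_def)
    ultimately have "sampling_density m A M N = card G / real N ^ m + card B / real N ^ m"
      unfolding sampling_density_def mean_card by (simp add: card_Un_disjoint add_divide_distrib)
    moreover define e where "e = card (P - inj) / real N ^ m"
    have e: "e \<le> real m * real m / N"
    proof -
      have "P - inj = {\<phi> \<in> P. \<not> spread {} {1..m} \<phi>}" by (auto simp: inj_def spread_def)
      then have "e = sample_mean {1..m} N (\<lambda>\<phi>. of_bool (\<not> spread {} {1..m} \<phi>))" unfolding e_def mean_card by (simp only:)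
      also have "\<dots> \<le> card {1..m} * (card {1..m} + card ({} :: nat set)) / N"
        by (rule sample_mean_not_spread) (use N in auto)
      finally show ?thesis by simp
    qed
    have "card B / real N ^ m \<le> e"
      unfolding e_def using pos finP by (intro divide_right_mono of_nat_mono card_mono) (auto simp: B_def inj_def)
    moreover have "0 \<le> card B / real N ^ m" by simp
    moreover have "card G / real (card inj) - card G / real N ^ m \<le> e"
    proof -
      have "card G \<le> card inj" using finP by (intro card_mono) (auto simp: G_def inj_def)
      moreover have inj_le: "card inj \<le> card P" using finP by (intro card_mono) (auto simp: inj_def)
      moreover have e_eq: "e = 1 - card inj / real N ^ m"
        using pos inj_le finP cP unfolding e_def by (subst card_Diff_subset) (auto simp: inj_def diff_divide_distrib of_nat_diff)
      moreover have "card G / real (card inj) - card G / real N ^ m = card G / real (card inj) * (1 - card inj / real N ^ m)"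
        using injpos pos by (simp add: field_simps)
      moreover have "0 \<le> e" by (simp add: e_def)
      moreover have "card G / real (card inj) * e \<le> 1 * e"
        using injpos \<open>card G \<le> card inj\<close> \<open>0 \<le> e\<close> by (intro mult_right_mono) auto
      ultimately show ?thesis by simp
    qed
    moreover have "0 \<le> card G / real (card inj) - card G / real N ^ m"
    proof -
      have "card inj \<le> card P" using finP by (intro card_mono) (auto simp: inj_def)
      then have "real (card inj) \<le> real N ^ m" using cP by (metis of_nat_mono of_nat_power)
      then show ?thesis using injpos pos by (simp add: frac_le)
    qed
    ultimately have "\<bar>inj_density m A M N - sampling_density m A M N\<bar> \<le> 2 * (real m * real m / N)"
      using e unfolding d by linarith
    then show ?thesis by simp
  qed
  then show "\<forall>\<^sub>F N in sequentially. norm (inj_density m A M N - sampling_density m A M N) \<le> 2 * (real m * real m) / real N"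
    unfolding eventually_sequentially by blast
qed

lemma inj_density_tendsto_iff: "inj_density m A M \<longlonglongrightarrow> d \<longleftrightarrow> sampling_density m A M \<longlonglongrightarrow> d"
  using tendsto_diff[OF _ inj_density_approx[of m A M], of "inj_density m A M" d]
    tendsto_add[OF _ inj_density_approx[of m A M], of "sampling_density m A M" d] by auto

text \<open>The law of the structure seen by \<open>N\<close> independent uniform points of \<open>{1..N}\<close>.  Letting the number of points grow
with \<open>N\<close> makes this a single additive set function for each \<open>N\<close>, without reference to the number of
labels on which an event depends.\<close>

definition sampled_mass :: "rel_struct \<Rightarrow> nat \<Rightarrow> rel_struct set \<Rightarrow> real" where
  "sampled_mass M N S = sample_mean {1..N} N (\<lambda>\<phi>. of_bool (relabel {1..N} \<phi> M \<in> S))"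

lemma sampled_mass_event:
  assumes M: "M \<in> structs sig {0<..}" and \<psi>: "inj_on \<psi> T" "\<psi> ` T \<subseteq> {1..N}" and N: "N \<ge> 1"
  shows "sampled_mass M N {M' \<in> structs sig {0<..}. Q (relabel T \<psi> M')} =
         sample_mean T N (\<lambda>\<phi>. of_bool (Q (relabel T \<phi> M)))"
proof -
  have "relabel {1..N} \<phi> M \<in> structs sig {0<..}" for \<phi>
    by (rule structs_mono[OF _ relabel_in_structs[OF M]]) auto
  moreover have "relabel T \<psi> (relabel {1..N} \<phi> M) = relabel T (restrict (\<phi> \<circ> \<psi>) T) M" for \<phi>
    by (subst relabel_relabel[OF \<psi>(2)], rule relabel_cong) simp
  ultimately have "sampled_mass M N {M' \<in> structs sig {0<..}. Q (relabel T \<psi> M')} =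
      sample_mean {1..N} N (\<lambda>\<phi>. (\<lambda>\<phi>. of_bool (Q (relabel T \<phi> M))) (restrict (\<phi> \<circ> \<psi>) T))"
    by (simp add: sampled_mass_def)
  also have "\<dots> = sample_mean T N (\<lambda>\<phi>. of_bool (Q (relabel T \<phi> M)))"
    by (rule sample_mean_marginal) (use \<psi> N in auto)
  finally show ?thesis .
qed

definition cylinder_algebra :: "signature \<Rightarrow> rel_struct set set" where
  "cylinder_algebra sig = {{M \<in> structs sig {0<..}. Q (restr {1..n} M)} | n Q. True}"

lemma cylinder_algebraI: "{M \<in> structs sig {0<..}. Q (restr {1..n} M)} \<in> cylinder_algebra sig"
  unfolding cylinder_algebra_def by blast

lemma restr_restr: "restr S (restr T M) = restr (S \<inter> T) M"
  by (auto simp: restr_def)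

lemma cylinder_algebra_two:
  assumes "S \<in> cylinder_algebra sig" "T \<in> cylinder_algebra sig"
  obtains n Q R where "S = {M \<in> structs sig {0<..}. Q (restr {1..n} M)}"
    "T = {M \<in> structs sig {0<..}. R (restr {1..n} M)}"
proof -
  obtain n Q k R where S: "S = {M \<in> structs sig {0<..}. Q (restr {1..n} M)}"
    and T: "T = {M \<in> structs sig {0<..}. R (restr {1..k} M)}"
    using assms unfolding cylinder_algebra_def by blast
  have r: "restr {1..n} (restr {1..max n k} M) = restr {1..n} M" "restr {1..k} (restr {1..max n k} M) = restr {1..k} M" for M
    unfolding restr_restr by (auto intro!: arg_cong2[of _ _ _ _ restr])
  show ?thesis by (rule that[of "\<lambda>A. Q (restr {1..n} A)" "max n k" "\<lambda>A. R (restr {1..k} A)"]) (simp_all only: r S T)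
qed

lemma algebra_cylinder: "algebra (structs sig {0<..}) (cylinder_algebra sig)"
  unfolding algebra_iff_Un
proof (intro conjI ballI)
  show "cylinder_algebra sig \<subseteq> Pow (structs sig {0<..})" by (auto simp: cylinder_algebra_def)
  show "{} \<in> cylinder_algebra sig" using cylinder_algebraI[of sig "\<lambda>_. False" 0] by simp
next
  fix S assume "S \<in> cylinder_algebra sig"
  then obtain n Q where S: "S = {M \<in> structs sig {0<..}. Q (restr {1..n} M)}" unfolding cylinder_algebra_def by blast
  have "structs sig {0<..} - S = {M \<in> structs sig {0<..}. \<not> Q (restr {1..n} M)}" by (auto simp: S)
  then show "structs sig {0<..} - S \<in> cylinder_algebra sig" using cylinder_algebraI[of sig "\<lambda>A. \<not> Q A" n] by simp
  fix T assume "T \<in> cylinder_algebra sig"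
  with \<open>S \<in> cylinder_algebra sig\<close> obtain n Q R where S: "S = {M \<in> structs sig {0<..}. Q (restr {1..n} M)}"
    and T: "T = {M \<in> structs sig {0<..}. R (restr {1..n} M)}" by (rule cylinder_algebra_two)
  have "S \<union> T = {M \<in> structs sig {0<..}. Q (restr {1..n} M) \<or> R (restr {1..n} M)}" by (auto simp: S T)
  then show "S \<union> T \<in> cylinder_algebra sig" using cylinder_algebraI[of sig "\<lambda>A. Q A \<or> R A" n] by simp
qed

lemma sigma_cylinder: "sigma_sets (structs sig {0<..}) (cylinder_algebra sig) = sets (LN_borel sig)"
proof
  show "sigma_sets (structs sig {0<..}) (cylinder_algebra sig) \<subseteq> sets (LN_borel sig)"
    using sets.sigma_sets_subset[of "cylinder_algebra sig" "LN_borel sig"] restr_event_sets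
    by (auto simp: cylinder_algebra_def)
  have "cyl sig n A \<in> cylinder_algebra sig" for n A
    unfolding cyl_def by (rule cylinder_algebraI)
  moreover have "{} \<in> cylinder_algebra sig" using cylinder_algebraI[of sig "\<lambda>_. False" 0] by simp
  ultimately show "sets (LN_borel sig) \<subseteq> sigma_sets (structs sig {0<..}) (cylinder_algebra sig)"
    unfolding sets_LN_borel_cyl by (intro sigma_sets_mono) auto
qed

text \<open>The mass of an event that depends on \<open>n\<close> labels is a finite sum of densities.\<close>

lemma sampled_mass_converges:
  assumes M: "M \<in> structs sig {0<..}" and ex: "climit_exists sig M" and S: "S \<in> cylinder_algebra sig"
  shows "convergent (\<lambda>N. sampled_mass M N S)"
proof -
  obtain n\<^sub>0 Q\<^sub>0 where S\<^sub>0: "S = {M \<in> structs sig {0<..}. Q\<^sub>0 (restr {1..n\<^sub>0} M)}"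
    using S unfolding cylinder_algebra_def by blast
  define n where "n = Suc n\<^sub>0"
  define Q where "Q = (\<lambda>A. Q\<^sub>0 (restr {1..n\<^sub>0} A))"
  have n: "n \<ge> 1" by (simp add: n_def)
  have "restr {1..n\<^sub>0} (restr {1..n} M) = restr {1..n\<^sub>0} M" for M
    unfolding restr_restr by (rule arg_cong2[of _ _ _ _ restr]) (auto simp: n_def)
  then have S: "S = {M \<in> structs sig {0<..}. Q (relabel {1..n} id M)}"
    unfolding S\<^sub>0 Q_def restr_eq_relabel[symmetric] by simp
  have "convergent (sampling_density n A M)" if "A \<in> structs sig {1..n}" for A
    using ex n that unfolding climit_exists_def convergent_def inj_density_tendsto_iff by blast
  then have "convergent (\<lambda>N. \<Sum>A\<in>structs sig {1..n}. of_bool (Q A) * sampling_density n A M N)"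
    by (intro convergent_sum convergent_mult convergent_const)
  moreover have "sampled_mass M N S = (\<Sum>A\<in>structs sig {1..n}. of_bool (Q A) * sampling_density n A M N)" if "N \<ge> n" for N
  proof -
    have "sampled_mass M N S = sample_mean {1..n} N (\<lambda>\<phi>. of_bool (Q (relabel {1..n} \<phi> M)))"
      unfolding S by (rule sampled_mass_event[OF M]) (use that n in auto)
    also have "\<dots> = sample_mean {1..n} N (\<lambda>\<phi>. \<Sum>A\<in>structs sig {1..n}. of_bool (Q A) * of_bool (relabel {1..n} \<phi> M = A))"
    proof (rule sample_mean_cong)
      fix \<phi>
      have "relabel {1..n} \<phi> M \<in> structs sig {1..n}" by (rule relabel_in_structs[OF M])
      then have "(\<Sum>A\<in>structs sig {1..n}. of_bool (Q A) * of_bool (relabel {1..n} \<phi> M = A)) =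
          (\<Sum>A\<in>{relabel {1..n} \<phi> M}. (of_bool (Q A) :: real))"
        by (intro sum.mono_neutral_cong_right) (auto simp: finite_structs)
      then show "of_bool (Q (relabel {1..n} \<phi> M)) = (\<Sum>A\<in>structs sig {1..n}. of_bool (Q A) * (of_bool (relabel {1..n} \<phi> M = A) :: real))"
        by simp
    qed
    also have "\<dots> = (\<Sum>A\<in>structs sig {1..n}. of_bool (Q A) * sampling_density n A M N)"
      by (simp only: sample_mean_sum sample_mean_cmult sampling_density_def)
    finally show ?thesis .
  qed
  then have "\<forall>\<^sub>F N in sequentially. sampled_mass M N S = (\<Sum>A\<in>structs sig {1..n}. of_bool (Q A) * sampling_density n A M N)"
    unfolding eventually_sequentially by blast
  ultimately show ?thesis by (subst convergent_cong)
qed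

lemma sampled_mass_nonneg: "0 \<le> sampled_mass M N S"
  unfolding sampled_mass_def by (intro sample_mean_nonneg) simp

lemma sampled_mass_space:
  assumes "M \<in> structs sig {0<..}" "N \<ge> 1" shows "sampled_mass M N (structs sig {0<..}) = 1"
proof -
  have "relabel {1..N} \<phi> M \<in> structs sig {0<..}" for \<phi>
    by (rule structs_mono[OF _ relabel_in_structs[OF assms(1)]]) auto
  then show ?thesis using assms(2) by (simp add: sampled_mass_def sample_mean_const)
qed

lemma sampled_mass_Un: "S \<inter> T = {} \<Longrightarrow> sampled_mass M N (S \<union> T) = sampled_mass M N S + sampled_mass M N T"
  unfolding sampled_mass_def sample_mean_add[symmetric] by (rule sample_mean_cong) auto

text \<open>The limits of the sampled masses form an additive set function on the algebra of cylinder events.  These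
events are closed in a compact space, so a decreasing sequence of them with empty intersection is eventually
empty, and the set function extends to a measure.\<close>

lemma limit_law_exists:
  assumes M: "M \<in> structs sig {0<..}" and ex: "climit_exists sig M"
  obtains W where "W \<in> space (prob_algebra (LN_borel sig))"
    "\<And>S. S \<in> cylinder_algebra sig \<Longrightarrow> (\<lambda>N. sampled_mass M N S) \<longlonglongrightarrow> measure W S"
proof -
  let ?\<Omega> = "structs sig {0<..}" and ?G = "cylinder_algebra sig"
  interpret algebra ?\<Omega> ?G by (rule algebra_cylinder)
  define f where "f = (\<lambda>S. ennreal (lim (\<lambda>N. sampled_mass M N S)))"
  have lim: "(\<lambda>N. sampled_mass M N S) \<longlonglongrightarrow> lim (\<lambda>N. sampled_mass M N S)" if "S \<in> ?G" for S
    using sampled_mass_converges[OF M ex that] by (simp add: convergent_LIMSEQ_iff)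
  have lim0: "0 \<le> lim (\<lambda>N. sampled_mass M N S)" if "S \<in> ?G" for S
    using LIMSEQ_le_const[OF lim[OF that]] sampled_mass_nonneg by blast
  have empty: "f {} = 0"
    unfolding f_def sampled_mass_def by (simp add: sample_mean_def)
  have "\<exists>\<mu> :: rel_struct set \<Rightarrow> ennreal. (\<forall>s \<in> ?G. \<mu> s = f s) \<and> measure_space ?\<Omega> (sigma_sets ?\<Omega> ?G) \<mu>"
  proof (rule caratheodory_empty_continuous)
    show "positive ?G f" using empty by (simp add: positive_def)
    show "additive ?G f"
      unfolding additive_def
    proof (intro ballI impI)
      fix S T assume ST: "S \<in> ?G" "T \<in> ?G" "S \<inter> T = {}"
      have "(\<lambda>N. sampled_mass M N (S \<union> T)) \<longlonglongrightarrow> lim (\<lambda>N. sampled_mass M N S) + lim (\<lambda>N. sampled_mass M N T)"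
        unfolding sampled_mass_Un[OF ST(3)] by (intro tendsto_add lim ST)
      then show "f (S \<union> T) = f S + f T"
        unfolding f_def using lim0 ST by (simp add: limI ennreal_plus)
    qed
    show "f S \<noteq> \<infinity>" for S by (simp add: f_def)
    fix A :: "nat \<Rightarrow> rel_struct set"
    assume A: "range A \<subseteq> ?G" "decseq A" "(\<Inter>i. A i) = {}"
    have "closedin (LN_top sig) (A i)" for i
    proof -
      obtain n Q where "A i = {M \<in> ?\<Omega>. Q (restr {1..n} M)}"
        using A(1) unfolding cylinder_algebra_def by blast
      then show ?thesis using closed_relabel_event[of "{1..n}" id sig Q] by (simp add: restr_eq_relabel)
    qed
    then obtain i where "A i = {}"
      using compact_space_imp_nest[OF compact_LN_top, of sig A] A(2,3) by blast
    then have "A k = {}" if "k \<ge> i" for k using A(2) that by (auto simp: decseq_def)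
    then have "\<forall>\<^sub>F k in sequentially. f (A k) = 0"
      using empty by (auto simp: eventually_sequentially intro!: exI[of _ i])
    then show "(\<lambda>i. f (A i)) \<longlonglongrightarrow> 0" by (rule tendsto_eventually)
  qed
  then obtain \<mu> where \<mu>: "\<And>S. S \<in> ?G \<Longrightarrow> \<mu> S = f S" and ms: "measure_space ?\<Omega> (sigma_sets ?\<Omega> ?G) \<mu>" by blast
  define W where "W = measure_of ?\<Omega> ?G \<mu>"
  have sub: "?G \<subseteq> Pow ?\<Omega>" by (rule space_closed)
  have sets: "sets W = sets (LN_borel sig)" and space: "space W = ?\<Omega>"
    using sub by (simp_all add: W_def sigma_cylinder)
  have em: "emeasure W S = f S" if "S \<in> ?G" for S
    unfolding W_def using that \<mu>[OF that] ms sub by (subst emeasure_measure_of_conv) (auto)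
  have "(\<lambda>N. sampled_mass M N ?\<Omega>) \<longlonglongrightarrow> 1"
    using sampled_mass_space[OF M] by (intro tendsto_eventually) (auto simp: eventually_sequentially)
  then have "emeasure W (space W) = 1" unfolding space by (subst em) (auto simp: f_def limI top)
  then have "prob_space W" by (rule prob_spaceI)
  then have "W \<in> space (prob_algebra (LN_borel sig))" using sets by (simp add: space_prob_algebra)
  moreover have "(\<lambda>N. sampled_mass M N S) \<longlonglongrightarrow> measure W S" if "S \<in> ?G" for S
    using lim[OF that] lim0[OF that] em[OF that] by (simp add: measure_def f_def)
  ultimately show ?thesis by (rule that)
qed

lemma
  assumes M: "M \<in> structs sig {0<..}" and ex: "climit_exists sig M"
  shows climit_prob: "climit sig M \<in> space (prob_algebra (LN_borel sig))"
    and climit_sampled_mass: "S \<in> cylinder_algebra sig \<Longrightarrow> (\<lambda>N. sampled_mass M N S) \<longlonglongrightarrow> measure (climit sig M) S"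
    and climit_density: "m \<ge> 1 \<Longrightarrow> sampling_density m A M \<longlonglongrightarrow> measure (climit sig M) (cyl sig m A)"
proof -
  obtain W where W: "W \<in> space (prob_algebra (LN_borel sig))"
    and mass: "\<And>S. S \<in> cylinder_algebra sig \<Longrightarrow> (\<lambda>N. sampled_mass M N S) \<longlonglongrightarrow> measure W S"
    using limit_law_exists[OF M ex] by blast
  have dens: "sampling_density m A M \<longlonglongrightarrow> measure W (cyl sig m A)" if "m \<ge> 1" for m A
  proof -
    have "sampled_mass M N (cyl sig m A) = sampling_density m A M N" if "N \<ge> m" for N
      unfolding cyl_def restr_eq_relabel sampling_density_def
      by (rule sampled_mass_event[OF M, where Q = "\<lambda>B. B = A"]) (use that \<open>m \<ge> 1\<close> in auto)
    moreover have "cyl sig m A \<in> cylinder_algebra sig" unfolding cyl_def by (rule cylinder_algebraI)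
    ultimately show ?thesis
      using mass by (metis (mono_tags, lifting) Lim_transform_eventually eventually_sequentially)
  qed
  have "climit sig M = W"
    unfolding climit_def
  proof (rule the_equality)
    show "W \<in> space (prob_algebra (LN_borel sig)) \<and>
      (\<forall>m\<ge>1. \<forall>A\<in>structs sig {1..m}. measure W (cyl sig m A) = lim (inj_density m A M))"
      using W dens unfolding inj_density_tendsto_iff[symmetric] by (auto intro!: limI[symmetric])
    fix V assume V: "V \<in> space (prob_algebra (LN_borel sig)) \<and>
      (\<forall>m\<ge>1. \<forall>A\<in>structs sig {1..m}. measure V (cyl sig m A) = lim (inj_density m A M))"
    show "V = W"
      using V W dens unfolding inj_density_tendsto_iff[symmetric] by (intro limit_eqI[of V sig W]) (auto intro!: limI)
  qed
  then show "climit sig M \<in> space (prob_algebra (LN_borel sig))"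
    "S \<in> cylinder_algebra sig \<Longrightarrow> (\<lambda>N. sampled_mass M N S) \<longlonglongrightarrow> measure (climit sig M) S"
    "m \<ge> 1 \<Longrightarrow> sampling_density m A M \<longlonglongrightarrow> measure (climit sig M) (cyl sig m A)"
    using W mass dens by auto
qed

text \<open>Reading a random sample through an injection gives a random sample again, so the limit law of \<open>relabel T \<psi>\<close> is
the same for every injection \<open>\<psi>\<close>.  Exchangeability and dissociation are both consequences.\<close>

lemma climit_event:
  assumes M: "M \<in> structs sig {0<..}" and ex: "climit_exists sig M"
    and T: "finite T" "inj_on \<psi> T" "\<psi> ` T \<subseteq> {0<..}"
  shows "(\<lambda>N. sample_mean T N (\<lambda>\<phi>. of_bool (Q (relabel T \<phi> M)))) \<longlonglongrightarrow>
         measure (climit sig M) {M' \<in> structs sig {0<..}. Q (relabel T \<psi> M')}"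
proof -
  define n where "n = Max (insert 0 (\<psi> ` T))"
  have sub: "\<psi> ` T \<subseteq> {1..n}" unfolding n_def using T by (intro finite_subset_atLeast1) auto
  let ?S = "{M' \<in> structs sig {0<..}. Q (relabel T \<psi> M')}"
  have "?S = {M' \<in> structs sig {0<..}. Q (relabel T \<psi> (restr {1..n} M'))}" using relabel_restr[OF sub] by simp
  then have "?S \<in> cylinder_algebra sig" using cylinder_algebraI[of sig "\<lambda>A. Q (relabel T \<psi> A)" n] by simp
  then have "(\<lambda>N. sampled_mass M N ?S) \<longlonglongrightarrow> measure (climit sig M) ?S" by (rule climit_sampled_mass[OF M ex])
  moreover have "sampled_mass M N ?S = sample_mean T N (\<lambda>\<phi>. of_bool (Q (relabel T \<phi> M)))" if "N \<ge> Suc n" for N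
    by (rule sampled_mass_event[OF M T(2)]) (use sub that in auto)
  ultimately show ?thesis
    by (metis (mono_tags, lifting) Lim_transform_eventually eventually_sequentially)
qed

text \<open>For exchangeability, \<open>climit_event\<close> is applied to a permutation and to the identity.  For dissociation, the
restrictions of a uniformly chosen map to disjoint sets are independent, so the probability of an
intersection factorizes before the limit, on generators that are stable under intersection.\<close>

lemma climit_in_E_space:
  assumes M: "M \<in> structs sig {0<..}" and ex: "climit_exists sig M"
  shows "climit sig M \<in> E_space sig"
proof -
  define W where "W = climit sig M"
  have W: "W \<in> space (prob_algebra (LN_borel sig))" unfolding W_def by (rule climit_prob[OF M ex])
  then interpret prob_space W by (simp add: space_prob_algebra)
  have sets: "sets W = sets (LN_borel sig)" using W by (simp add: space_prob_algebra)
  then have space: "space W = structs sig {0<..}" by (metis sets_eq_imp_space_eq space_LN_borel)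
  have meas: "relabel T \<sigma> \<in> measurable W (LN_borel sig)" if "T \<subseteq> {0<..}" "\<sigma> ` T \<subseteq> {0<..}" for T \<sigma>
    using measurable_relabel[OF that] measurable_cong_sets[OF sets refl] by blast
  have "distr W (LN_borel sig) (relabel {0<..} \<sigma>) = W" if "\<sigma> \<in> LN_perms" for \<sigma>
  proof (rule limit_eqI[OF _ W])
    have \<sigma>: "inj_on \<sigma> {0<..}" "\<sigma> ` {0<..} = {0<..}" using that by (auto simp: LN_perms_def bij_betw_def)
    note m = meas[of "{0<..}" \<sigma>]
    show "distr W (LN_borel sig) (relabel {0<..} \<sigma>) \<in> space (prob_algebra (LN_borel sig))"
      using prob_space_distr[OF m] \<sigma> by (simp add: space_prob_algebra)
    fix n A assume "1 \<le> n" "A \<in> structs sig {1..n}"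
    have "measure (distr W (LN_borel sig) (relabel {0<..} \<sigma>)) (cyl sig n A) =
          measure W (relabel {0<..} \<sigma> -` cyl sig n A \<inter> space W)"
      by (rule measure_distr[OF m cyl_sets]) (use \<sigma> in auto)
    also have "relabel {0<..} \<sigma> -` cyl sig n A \<inter> space W = {M \<in> structs sig {0<..}. relabel {1..n} \<sigma> M = A}"
      using relabel_in_structs[of _ sig "{0<..}" "{0<..}" \<sigma>] by (auto simp: space cyl_def restr_relabel Int_absorb2)
    also have "measure W \<dots> = measure W (cyl sig n A)"
    proof (rule LIMSEQ_unique)
      show "(\<lambda>N. sample_mean {1..n} N (\<lambda>\<phi>. of_bool (relabel {1..n} \<phi> M = A))) \<longlonglongrightarrow>
          measure W {M \<in> structs sig {0<..}. relabel {1..n} \<sigma> M = A}"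
        unfolding W_def by (rule climit_event[OF M ex, of "{1..n}" \<sigma> "\<lambda>B. B = A"])
          (use \<sigma> in \<open>auto intro: inj_on_subset\<close>)
      show "(\<lambda>N. sample_mean {1..n} N (\<lambda>\<phi>. of_bool (relabel {1..n} \<phi> M = A))) \<longlonglongrightarrow> measure W (cyl sig n A)"
        unfolding W_def cyl_def restr_eq_relabel
        by (rule climit_event[OF M ex, of "{1..n}" id "\<lambda>B. B = A"]) auto
    qed
    finally show "measure (distr W (LN_borel sig) (relabel {0<..} \<sigma>)) (cyl sig n A) = measure W (cyl sig n A)" .
  qed
  moreover have "indep_var (LN_borel sig) (restr T) (LN_borel sig) (restr T')"
    if T: "T \<subseteq> {0<..}" "T' \<subseteq> {0<..}" "T \<inter> T' = {}" for T T'
  proof -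
    let ?\<Omega> = "structs sig {0<..}"
    define H where "H = (\<lambda>T. {{M \<in> ?\<Omega>. Q (restr ({1..n::nat} \<inter> T) M)} | n Q. True})"
    have HI: "{M \<in> ?\<Omega>. Q (restr ({1..n::nat} \<inter> T) M)} \<in> H T" for Q n T
      unfolding H_def by blast
    have gen: "sigma_sets (space W) {restr T -` A \<inter> space W | A. A \<in> sets (LN_borel sig)} = sigma_sets (space W) (H T)"
      if "T \<subseteq> {0<..}" for T
    proof -
      have im: "restr T M \<in> ?\<Omega>" if "M \<in> ?\<Omega>" for M
        using that \<open>T \<subseteq> {0<..}\<close> structs_mono relabel_in_structs unfolding restr_eq_relabel by metis
      then have "restr T \<in> space W \<rightarrow> ?\<Omega>" by (auto simp: space)
      then have "{restr T -` A \<inter> space W | A. A \<in> sets (LN_borel sig)} =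
          sigma_sets (space W) {restr T -` A \<inter> space W | A. A \<in> cylinder_algebra sig}"
        unfolding sigma_cylinder[symmetric] by (rule sigma_sets_vimage_commute)
      also have "{restr T -` A \<inter> space W | A. A \<in> cylinder_algebra sig} = H T"
      proof -
        have eq: "restr T -` {M \<in> ?\<Omega>. Q (restr {1..n} M)} \<inter> space W = {M \<in> ?\<Omega>. Q (restr ({1..n} \<inter> T) M)}" for n Q
          using im by (auto simp: space restr_restr)
        show ?thesis
        proof (intro equalityI subsetI)
          fix x assume "x \<in> {restr T -` A \<inter> space W | A. A \<in> cylinder_algebra sig}"
          then obtain n Q where "x = restr T -` {M \<in> ?\<Omega>. Q (restr {1..n} M)} \<inter> space W"
            unfolding cylinder_algebra_def by blast
          then show "x \<in> H T" unfolding eq H_def by blast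
        next
          fix x assume "x \<in> H T"
          then obtain n Q where "x = {M \<in> ?\<Omega>. Q (restr ({1..n} \<inter> T) M)}" unfolding H_def by blast
          then have "x = restr T -` {M \<in> ?\<Omega>. Q (restr {1..n} M)} \<inter> space W" by (simp only: eq)
          then show "x \<in> {restr T -` A \<inter> space W | A. A \<in> cylinder_algebra sig}"
            using cylinder_algebraI[of sig Q n] by blast
        qed
      qed
      finally have eq: "{restr T -` A \<inter> space W | A. A \<in> sets (LN_borel sig)} = sigma_sets (space W) (H T)" .
      have "H T \<subseteq> Pow (space W)" by (auto simp: H_def space)
      then show ?thesis unfolding eq by (rule sigma_sets_sigma_sets_eq)
    qed
    have HS: "H T \<subseteq> sets (LN_borel sig)" if "T \<subseteq> {0<..}" for T
      unfolding H_def restr_eq_relabel by (auto intro!: relabel_event_sets)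
    have stable: "Int_stable (H T)" for T
    proof (rule Int_stableI)
      fix a b assume "a \<in> H T" "b \<in> H T"
      then obtain n Q k R where a: "a = {M \<in> ?\<Omega>. Q (restr ({1..n} \<inter> T) M)}" and b: "b = {M \<in> ?\<Omega>. R (restr ({1..k} \<inter> T) M)}"
        unfolding H_def by blast
      have r: "restr ({1..n} \<inter> T) (restr ({1..max n k} \<inter> T) M) = restr ({1..n} \<inter> T) M"
        "restr ({1..k} \<inter> T) (restr ({1..max n k} \<inter> T) M) = restr ({1..k} \<inter> T) M" for M
        unfolding restr_restr by (auto intro!: arg_cong2[of _ _ _ _ restr])
      have "a \<inter> b = {M \<in> ?\<Omega>. (\<lambda>A. Q (restr ({1..n} \<inter> T) A) \<and> R (restr ({1..k} \<inter> T) A)) (restr ({1..max n k} \<inter> T) M)}"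
        unfolding a b r by blast
      then show "a \<inter> b \<in> H T"
        using HI[of "\<lambda>A. Q (restr ({1..n} \<inter> T) A) \<and> R (restr ({1..k} \<inter> T) A)" "max n k" T] by (simp only:)
    qed
    have "prob (a \<inter> b) = prob a * prob b" if ab: "a \<in> H T" "b \<in> H T'" for a b
    proof -
      obtain n Q k R where a: "a = {M \<in> ?\<Omega>. Q (restr ({1..n} \<inter> T) M)}" and b: "b = {M \<in> ?\<Omega>. R (restr ({1..k} \<inter> T') M)}"
        using ab unfolding H_def by blast
      define I where "I = {1..n} \<inter> T"
      define J where "J = {1..k} \<inter> T'"
      have IJ: "finite I" "finite J" "I \<subseteq> {0<..}" "J \<subseteq> {0<..}" "I \<inter> J = {}" using T by (auto simp: I_def J_def)
      have "(\<lambda>N. sample_mean (I \<union> J) N (\<lambda>\<phi>. of_bool (Q (restr I (relabel (I \<union> J) \<phi> M)) \<and> R (restr J (relabel (I \<union> J) \<phi> M)))))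
          \<longlonglongrightarrow> prob {M' \<in> ?\<Omega>. Q (restr I (relabel (I \<union> J) id M')) \<and> R (restr J (relabel (I \<union> J) id M'))}"
        unfolding W_def
        by (rule climit_event[OF M ex, of "I \<union> J" id "\<lambda>A. Q (restr I A) \<and> R (restr J A)"]) (use IJ in auto)
      also have "{M' \<in> ?\<Omega>. Q (restr I (relabel (I \<union> J) id M')) \<and> R (restr J (relabel (I \<union> J) id M'))} = a \<inter> b"
        unfolding a b I_def[symmetric] J_def[symmetric] restr_eq_relabel[of "I \<union> J", symmetric] restr_restr
        by (auto simp: Int_absorb2)
      also have "(\<lambda>N. sample_mean (I \<union> J) N (\<lambda>\<phi>. of_bool (Q (restr I (relabel (I \<union> J) \<phi> M)) \<and> R (restr J (relabel (I \<union> J) \<phi> M))))) =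
        (\<lambda>N. sample_mean I N (\<lambda>\<phi>. of_bool (Q (relabel I \<phi> M))) * sample_mean J N (\<lambda>\<phi>. of_bool (R (relabel J \<phi> M))))"
      proof
        fix N
        have "relabel I (restrict \<phi> I) M = relabel I \<phi> M" "relabel J (restrict \<phi> J) M = relabel J \<phi> M" for \<phi>
          by (auto intro!: relabel_cong)
        then show "sample_mean (I \<union> J) N (\<lambda>\<phi>. of_bool (Q (restr I (relabel (I \<union> J) \<phi> M)) \<and> R (restr J (relabel (I \<union> J) \<phi> M)))) =
           sample_mean I N (\<lambda>\<phi>. of_bool (Q (relabel I \<phi> M))) * sample_mean J N (\<lambda>\<phi>. of_bool (R (relabel J \<phi> M)))"
          unfolding sample_mean_mult[OF IJ(1,2,5), symmetric] by (simp add: restr_relabel Int_absorb2 of_bool_conj)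
      qed
      finally have "(\<lambda>N. sample_mean I N (\<lambda>\<phi>. of_bool (Q (relabel I \<phi> M))) * sample_mean J N (\<lambda>\<phi>. of_bool (R (relabel J \<phi> M)))) \<longlonglongrightarrow> prob (a \<inter> b)" .
      moreover have "(\<lambda>N. sample_mean I N (\<lambda>\<phi>. of_bool (Q (relabel I \<phi> M))) * sample_mean J N (\<lambda>\<phi>. of_bool (R (relabel J \<phi> M)))) \<longlonglongrightarrow> prob a * prob b"
        unfolding a b W_def I_def[symmetric] J_def[symmetric] restr_eq_relabel
        by (intro tendsto_mult climit_event[OF M ex]) (use IJ in auto)
      ultimately show ?thesis by (rule LIMSEQ_unique)
    qed
    then have "indep_set (H T) (H T')"
      by (intro indep_setI) (use HS T sets in auto)
    then have "indep_set (sigma_sets (space W) (H T)) (sigma_sets (space W) (H T'))"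
      by (rule indep_set_sigma_sets) (rule stable)+
    then show ?thesis
      unfolding indep_var_eq gen[OF T(1)] gen[OF T(2)] using meas T unfolding restr_eq_relabel by auto
  qed
  ultimately show ?thesis unfolding E_space_def W_def[symmetric] using W by blast
qed

section \<open>Convergence of limits\<close>

text \<open>The \<open>n\<close>-th term of the distance is at most \<open>2 * (1/2) ^ n\<close>, so convergence of all cylinder
probabilities suffices, by dominated convergence of series.\<close>

lemma limitin_E_top:
  assumes W: "W \<in> E_space sig" and ev: "\<forall>\<^sub>F s in F. V s \<in> E_space sig"
    and lim: "\<And>n A. n \<ge> 1 \<Longrightarrow> A \<in> structs sig {1..n} \<Longrightarrow>
      ((\<lambda>s. measure (V s) (cyl sig n A)) \<longlongrightarrow> measure W (cyl sig n A)) F"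
  shows "limitin (E_top sig) V W F"
proof (cases "F = bot")
  case True
  interpret Metric_space "E_space sig" "limit_dist sig" by (rule Metric_space_limits)
  show ?thesis using W True unfolding E_top_def limitin_metric by simp
next
  case False
  interpret Metric_space "E_space sig" "limit_dist sig" by (rule Metric_space_limits)
  define h where "h = (\<lambda>n U. (1/2)^n * (\<Sum>A\<in>structs sig {1..n}. \<bar>measure U (cyl sig n A) - measure W (cyl sig n A)\<bar>))"
  define g where "g = (\<lambda>n U. if n = 0 then 0 else h n U)"
  have g_le: "norm (g n U) \<le> 2 * (1/2)^n" if U: "U \<in> E_space sig" for n U
  proof -
    have *: "(\<Sum>A\<in>structs sig {1..n}. measure V (cyl sig n A)) \<le> 1" if "V \<in> E_space sig" for V
    proof -
      have V: "prob_space V" "sets V = sets (LN_borel sig)"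
        using that by (auto simp: E_space_def space_prob_algebra)
      interpret V: prob_space V by fact
      have "(\<Sum>A\<in>structs sig {1..n}. measure V (cyl sig n A)) = measure V (\<Union>A\<in>structs sig {1..n}. cyl sig n A)"
        by (rule V.finite_measure_finite_Union[symmetric])
          (use cyl_sets in \<open>auto simp: finite_structs V(2) disjoint_family_on_def, auto simp: cyl_def\<close>)
      then show ?thesis by simp
    qed
    have "(\<Sum>A\<in>structs sig {1..n}. \<bar>measure U (cyl sig n A) - measure W (cyl sig n A)\<bar>) \<le>
        (\<Sum>A\<in>structs sig {1..n}. measure U (cyl sig n A) + measure W (cyl sig n A))"
      by (intro sum_mono order.trans[OF abs_triangle_ineq4]) simp
    also have "\<dots> \<le> 2" using *[OF U] *[OF W] by (simp add: sum.distrib)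
    finally show ?thesis by (simp add: g_def h_def mult_left_mono abs_mult sum_nonneg mult.commute)
  qed
  have summ: "summable (\<lambda>n. 2 * (1/2)^n :: real)" by (intro summable_mult summable_geometric) simp
  have dist: "limit_dist sig U W = (\<Sum>n. g n U)" if U: "U \<in> E_space sig" for U
  proof -
    have "summable (\<lambda>n. norm (g n U))"
      by (rule summable_comparison_test'[OF summ]) (use g_le[OF U] in simp)
    then have "((\<lambda>n. g n U) has_sum (\<Sum>n. g n U)) UNIV"
      by (intro norm_summable_imp_has_sum summable_sums) (auto intro: summable_norm_cancel)
    then have "(\<Sum>\<^sub>\<infinity>n. g n U) = (\<Sum>n. g n U)" by (rule infsumI)
    moreover have "(\<Sum>\<^sub>\<infinity>n\<in>{0<..}. h n U) = (\<Sum>\<^sub>\<infinity>n. g n U)"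
      by (rule infsum_cong_neutral) (auto simp: g_def)
    ultimately show ?thesis by (simp add: limit_dist_def h_def)
  qed
  have "((\<lambda>s. \<Sum>n. g n (V s)) \<longlongrightarrow> (\<Sum>n. 0)) F"
  proof (rule tannerys_theorem[where M = "\<lambda>n. 2 * (1/2)^n", THEN conjunct2, THEN conjunct2])
    show "((\<lambda>s. g n (V s)) \<longlongrightarrow> 0) F" for n
    proof (cases "n = 0")
      case False
      then have n: "n \<ge> 1" by simp
      have "((\<lambda>s. h n (V s)) \<longlongrightarrow> (1/2)^n * (\<Sum>A\<in>structs sig {1..n}. \<bar>measure W (cyl sig n A) - measure W (cyl sig n A)\<bar>)) F"
        unfolding h_def by (intro tendsto_mult tendsto_const tendsto_sum tendsto_rabs tendsto_diff lim[OF n])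
      then show ?thesis using False by (simp add: g_def)
    qed (simp add: g_def)
    show "\<forall>\<^sub>F (n, s) in sequentially \<times>\<^sub>F F. norm (g n (V s)) \<le> 2 * (1 / 2) ^ n"
      using eventually_prodI[of "\<lambda>_. True" sequentially, OF _ ev]
      by (rule eventually_mono) (use g_le in auto)
  qed (use summ False in auto)
  then have l0: "((\<lambda>s. \<Sum>n. g n (V s)) \<longlongrightarrow> 0) F" by simp
  show ?thesis
    unfolding E_top_def limitin_metric
  proof (intro conjI allI impI W)
    fix e :: real assume "e > 0"
    then have "\<forall>\<^sub>F s in F. (\<Sum>n. g n (V s)) < e" using l0 by (rule order_tendstoD(2)[rotated])
    then show "\<forall>\<^sub>F s in F. V s \<in> E_space sig \<and> limit_dist sig (V s) W < e"
      using ev by eventually_elim (simp add: dist)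
  qed
qed

section \<open>Paths driven by atoms\<close>

text \<open>A canonical path is described between atoms visible on \<open>{1..n}\<close>, where it is constant on \<open>{1..n}\<close>, and at such an atom in
terms of the values immediately before it.  The induction removes the last visible atom before \<open>t\<close>;
if that atom does not hit \<open>\<phi>\<close>, then \<open>\<phi>\<close> reads the same before and after it.\<close>

lemma path_changes_only_at_hits:
  assumes can: "canonical_path sig A x"
    and X: "\<And>u. u \<ge> 0 \<Longrightarrow> x u \<in> structs sig {0<..}"
    and A: "\<And>u M. (u, M) \<in> A \<Longrightarrow> M \<in> structs sig {0<..}"
    and fin: "finite {u \<in> {s<..t}. \<exists>M. (u, M) \<in> A \<and> restr {1..n} M \<noteq> zero_struct sig}"
    and s: "0 \<le> s" "s \<le> t" and \<phi>: "\<phi> ` I \<subseteq> {1..n}"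
    and no: "\<And>u M. (u, M) \<in> A \<Longrightarrow> s < u \<Longrightarrow> u \<le> t \<Longrightarrow> relabel I \<phi> M = zero_struct sig"
  shows "relabel I \<phi> (x t) = relabel I \<phi> (x s)"
  using fin s(2) no
proof (induction "card {u \<in> {s<..t}. \<exists>M. (u, M) \<in> A \<and> restr {1..n} M \<noteq> zero_struct sig}" arbitrary: t rule: less_induct)
  case less
  define J where "J = (\<lambda>t. {u \<in> {s<..t}. \<exists>M. (u, M) \<in> A \<and> restr {1..n} M \<noteq> zero_struct sig})"
  have const: "relabel I \<phi> (x b) = relabel I \<phi> (x a)"
    if "0 \<le> a" "a \<le> b" "\<And>u M. a < u \<Longrightarrow> u \<le> b \<Longrightarrow> (u, M) \<in> A \<Longrightarrow> restr {1..n} M = zero_struct sig" for a b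
  proof -
    have "restr {1..n} (x b) = restr {1..n} (x a)"
      using can that unfolding canonical_path_def by blast
    then have "relabel I \<phi> (restr {1..n} (x b)) = relabel I \<phi> (restr {1..n} (x a))" by (rule arg_cong)
    then show ?thesis by (simp only: relabel_restr[OF \<phi>])
  qed
  show ?case
  proof (cases "J t = {}")
    case True
    then show ?thesis using less.prems(2) s(1) by (intro const) (auto simp: J_def)
  next
    case False
    have fin: "finite (J t)" using less.prems(1) by (simp add: J_def)
    define u where "u = Max (J t)"
    have uJ: "u \<in> J t" unfolding u_def using fin False by (rule Max_in)
    then obtain M where u: "s < u" "u \<le> t" and M: "(u, M) \<in> A" "restr {1..n} M \<noteq> zero_struct sig"
      by (auto simp: J_def)
    have "relabel I \<phi> (x t) = relabel I \<phi> (x u)"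
    proof (rule const)
      fix v N assume v: "u < v" "v \<le> t" "(v, N) \<in> A"
      then have "v \<notin> J t" using Max_ge[OF fin, of v] unfolding u_def[symmetric] by fastforce
      then show "restr {1..n} N = zero_struct sig" using v u by (auto simp: J_def)
    qed (use u s in auto)
    also have "\<dots> = relabel I \<phi> (x s)"
    proof -
      have "\<forall>\<^sub>F v in at_left u. restr {1..n} (x u) = symdiff (restr {1..n} (x v)) (restr {1..n} M)"
        using can M u s(1) unfolding canonical_path_def by fastforce
      moreover have "\<forall>\<^sub>F v in at_left u. v \<in> {s<..<u}" using u by (intro eventually_at_leftI)
      ultimately have "\<forall>\<^sub>F v in at_left u. restr {1..n} (x u) = symdiff (restr {1..n} (x v)) (restr {1..n} M) \<and> v \<in> {s<..<u}"
        by (rule eventually_conj)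
      then obtain v where v: "restr {1..n} (x u) = symdiff (restr {1..n} (x v)) (restr {1..n} M)" "s < v" "v < u"
        using eventually_happens[of _ "at_left u"] by auto
      have len: "length (x v) = length sig" "length M = length sig"
        using structs_length[OF X[of v]] structs_length[OF A[OF M(1)]] s v by auto
      have "relabel I \<phi> (restr {1..n} (x u)) = symdiff (relabel I \<phi> (restr {1..n} (x v))) (relabel I \<phi> (restr {1..n} M))"
        unfolding v(1) by (rule relabel_symdiff) (simp add: len restr_def)
      then have "relabel I \<phi> (x u) = symdiff (relabel I \<phi> (x v)) (relabel I \<phi> M)"
        by (simp only: relabel_restr[OF \<phi>])
      also have "\<dots> = relabel I \<phi> (x v)"
        using less.prems(3)[OF M(1) u] len by (simp add: symdiff_zero_right)
      also have "\<dots> = relabel I \<phi> (x s)"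
      proof (rule less.hyps)
        have "J v \<subseteq> J t" using v u by (auto simp: J_def)
        moreover have "u \<notin> J v" using v by (simp add: J_def)
        ultimately have "J v \<subset> J t" using uJ by blast
        then show "card {u \<in> {s<..v}. \<exists>M. (u, M) \<in> A \<and> restr {1..n} M \<noteq> zero_struct sig} <
            card {u \<in> {s<..t}. \<exists>M. (u, M) \<in> A \<and> restr {1..n} M \<noteq> zero_struct sig}"
          using psubset_card_mono[OF fin] by (simp add: J_def)
        show "finite {u \<in> {s<..v}. \<exists>M. (u, M) \<in> A \<and> restr {1..n} M \<noteq> zero_struct sig}"
          using finite_subset[OF psubset_imp_subset[OF \<open>J v \<subset> J t\<close>] fin] by (simp add: J_def)
        show "s \<le> v" using v by simp
        show "relabel I \<phi> N = zero_struct sig" if "(w, N) \<in> A" "s < w" "w \<le> v" for w N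
          by (rule less.prems(3)[OF that(1,2)]) (use that v u in linarith)
      qed
      finally show ?thesis .
    qed
    finally show ?thesis .
  qed
qed

section \<open>Poisson point processes\<close>

lemma num_atoms_eq_0 [simp]: "num_atoms A = 0 \<longleftrightarrow> A = {}"
  by (auto simp: num_atoms_def emeasure_count_space)

lemma num_atoms_eq_nat: "num_atoms A = of_nat k \<Longrightarrow> finite A"
  by (auto simp: num_atoms_def emeasure_count_space split: if_splits)

context prob_space
begin

lemma void_sets:
  assumes D: "poisson_point_process M \<nu> D" and B: "B \<in> sets \<nu>"
  shows "{\<omega> \<in> space M. D \<omega> \<inter> B = {}} \<in> events"
proof -
  have "(\<lambda>\<omega>. num_atoms (D \<omega> \<inter> B)) \<in> borel_measurable M"
    using D B unfolding poisson_point_process_def by blast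
  then have "(\<lambda>\<omega>. num_atoms (D \<omega> \<inter> B)) -` {0} \<inter> space M \<in> events"
    by (rule measurable_sets) simp
  also have "(\<lambda>\<omega>. num_atoms (D \<omega> \<inter> B)) -` {0} \<inter> space M = {\<omega> \<in> space M. D \<omega> \<inter> B = {}}" by auto
  finally show ?thesis .
qed

lemma void_probability:
  assumes D: "poisson_point_process M \<nu> D" and B: "B \<in> sets \<nu>" "emeasure \<nu> B < \<infinity>"
  shows "prob {\<omega> \<in> space M. D \<omega> \<inter> B = {}} = exp (- measure \<nu> B)"
proof -
  have "\<forall>k::nat. prob {\<omega> \<in> space M. num_atoms (D \<omega> \<inter> B) = of_nat k} = exp (- measure \<nu> B) * measure \<nu> B ^ k / fact k"
    using D B unfolding poisson_point_process_def by auto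
  from this[rule_format, of 0] show ?thesis by simp
qed

text \<open>The Poisson weights sum to 1, so the number of atoms is almost surely one of the natural numbers.\<close>

lemma finitely_many_atoms:
  assumes D: "poisson_point_process M \<nu> D" and B: "B \<in> sets \<nu>" "emeasure \<nu> B < \<infinity>"
  shows "AE \<omega> in M. finite (D \<omega> \<inter> B)"
proof -
  define E where "E = (\<lambda>k::nat. {\<omega> \<in> space M. num_atoms (D \<omega> \<inter> B) = of_nat k})"
  define r where "r = measure \<nu> B"
  have meas: "(\<lambda>\<omega>. num_atoms (D \<omega> \<inter> B)) \<in> borel_measurable M"
    using D B unfolding poisson_point_process_def by blast
  have E: "E k \<in> events" for k
  proof -
    have "(\<lambda>\<omega>. num_atoms (D \<omega> \<inter> B)) -` {of_nat k} \<inter> space M \<in> events"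
      using meas by (rule measurable_sets) simp
    also have "(\<lambda>\<omega>. num_atoms (D \<omega> \<inter> B)) -` {of_nat k} \<inter> space M = E k" by (auto simp: E_def)
    finally show ?thesis .
  qed
  have pE: "prob (E k) = exp (- r) * (r ^ k /\<^sub>R fact k)" for k
    using D B unfolding poisson_point_process_def E_def r_def by (auto simp: field_simps)
  have "(\<lambda>k. prob (E k)) sums prob (\<Union>k. E k)"
    by (rule finite_measure_UNION) (use E in \<open>auto simp: disjoint_family_on_def E_def\<close>)
  moreover have "(\<lambda>k. prob (E k)) sums (exp (- r) * exp r)"
    unfolding pE by (intro sums_mult exp_converges)
  ultimately have "prob (\<Union>k. E k) = 1"
    by (simp add: sums_unique2 exp_minus_inverse mult.commute[of "exp (- r)"])
  then have "AE \<omega> in M. \<omega> \<in> (\<Union>k. E k)" by (subst (asm) prob_eq_1) (use E in auto)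
  then show ?thesis by eventually_elim (auto simp: E_def dest: num_atoms_eq_nat)
qed

lemma hit_measurable:
  assumes D: "poisson_point_process M \<nu> D" and B: "B \<in> sets \<nu>"
  shows "(\<lambda>\<omega>. of_bool (D \<omega> \<inter> B \<noteq> {}) :: real) \<in> borel_measurable M"
proof -
  have "{\<omega> \<in> space M. D \<omega> \<inter> B \<noteq> {}} = space M - {\<omega> \<in> space M. D \<omega> \<inter> B = {}}" by auto
  then have "{\<omega> \<in> space M. D \<omega> \<inter> B \<noteq> {}} \<in> events" using void_sets[OF assms] by auto
  then have "(indicator {\<omega> \<in> space M. D \<omega> \<inter> B \<noteq> {}} :: _ \<Rightarrow> real) \<in> borel_measurable M" by simp
  then show ?thesis by (rule measurable_cong[THEN iffD1, rotated]) (auto simp: indicator_def)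
qed

lemma expectation_void:
  assumes D: "poisson_point_process M \<nu> D" and B: "B \<in> sets \<nu>" "emeasure \<nu> B < \<infinity>"
  shows "expectation (\<lambda>\<omega>. of_bool (D \<omega> \<inter> B = {})) = exp (- measure \<nu> B)"
    and "integrable M (\<lambda>\<omega>. of_bool (D \<omega> \<inter> B = {}) :: real)"
proof -
  let ?V = "{\<omega> \<in> space M. D \<omega> \<inter> B = {}}"
  have V: "?V \<in> events" by (rule void_sets[OF D B(1)])
  have eq: "of_bool (D \<omega> \<inter> B = {}) = (indicator ?V \<omega> :: real)" if "\<omega> \<in> space M" for \<omega>
    using that by (auto simp: indicator_def)
  have "expectation (\<lambda>\<omega>. of_bool (D \<omega> \<inter> B = {})) = expectation (indicator ?V)"
    by (rule Bochner_Integration.integral_cong) (use eq in auto)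
  also have "\<dots> = exp (- measure \<nu> B)" using V void_probability[OF assms] by simp
  finally show "expectation (\<lambda>\<omega>. of_bool (D \<omega> \<inter> B = {})) = exp (- measure \<nu> B)" .
  have "integrable M (indicator ?V :: _ \<Rightarrow> real)" using V by (simp add: emeasure_eq_measure)
  then show "integrable M (\<lambda>\<omega>. of_bool (D \<omega> \<inter> B = {}) :: real)"
    by (rule Bochner_Integration.integrable_cong[THEN iffD1, rotated 2]) (use eq in auto)
qed

lemma expectation_hit:
  assumes D: "poisson_point_process M \<nu> D" and B: "B \<in> sets \<nu>" "emeasure \<nu> B < \<infinity>"
  shows "expectation (\<lambda>\<omega>. of_bool (D \<omega> \<inter> B \<noteq> {}) :: real) = 1 - exp (- measure \<nu> B)"
proof -
  have "expectation (\<lambda>\<omega>. of_bool (D \<omega> \<inter> B \<noteq> {}) :: real) = expectation (\<lambda>\<omega>. 1 - of_bool (D \<omega> \<inter> B = {}))"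
    by (rule Bochner_Integration.integral_cong) auto
  also have "\<dots> = 1 - exp (- measure \<nu> B)"
    using expectation_void[OF assms] by (simp add: prob_space)
  finally show ?thesis .
qed

text \<open>Inclusion and exclusion reduces joint hits to the probability that a set, here the union, has no atom.\<close>

lemma expectation_hit_both:
  assumes D: "poisson_point_process M \<nu> D" and B: "B \<in> sets \<nu>" "emeasure \<nu> B < \<infinity>"
    and B': "B' \<in> sets \<nu>" "emeasure \<nu> B' < \<infinity>"
  shows "expectation (\<lambda>\<omega>. of_bool (D \<omega> \<inter> B \<noteq> {}) * of_bool (D \<omega> \<inter> B' \<noteq> {}) :: real) =
    1 - exp (- measure \<nu> B) - exp (- measure \<nu> B') + exp (- measure \<nu> (B \<union> B'))"
proof -
  have "emeasure \<nu> (B \<union> B') \<le> emeasure \<nu> B + emeasure \<nu> B'" using B B' by (intro emeasure_subadditive)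
  also have "\<dots> < \<infinity>" using B B' by simp
  finally have U: "B \<union> B' \<in> sets \<nu>" "emeasure \<nu> (B \<union> B') < \<infinity>" using B B' by auto
  have "expectation (\<lambda>\<omega>. of_bool (D \<omega> \<inter> B \<noteq> {}) * of_bool (D \<omega> \<inter> B' \<noteq> {}) :: real) =
    expectation (\<lambda>\<omega>. 1 - of_bool (D \<omega> \<inter> B = {}) - of_bool (D \<omega> \<inter> B' = {}) + of_bool (D \<omega> \<inter> (B \<union> B') = {}))"
    by (rule Bochner_Integration.integral_cong) (auto simp: Int_Un_distrib)
  also have "\<dots> = 1 - exp (- measure \<nu> B) - exp (- measure \<nu> B') + exp (- measure \<nu> (B \<union> B'))"
    using expectation_void[OF D B] expectation_void[OF D B'] expectation_void[OF D U] by (simp add: prob_space)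
  finally show ?thesis .
qed

end

lemma time_intensity_box:
  assumes \<nu>: "sigma_finite_measure \<nu>" and J: "J \<in> sets borel" "J \<subseteq> {0..}" and B: "B \<in> sets \<nu>"
  shows "J \<times> B \<in> sets (time_intensity \<nu>)"
    and "emeasure (time_intensity \<nu>) (J \<times> B) = emeasure lborel J * emeasure \<nu> B"
proof -
  interpret sigma_finite_measure \<nu> by fact
  have J': "J \<in> sets (restrict_space lborel {0..})" using J by (auto simp: sets_restrict_space_iff)
  then show "J \<times> B \<in> sets (time_intensity \<nu>)"
    unfolding time_intensity_def using B by (intro pair_measureI)
  show "emeasure (time_intensity \<nu>) (J \<times> B) = emeasure lborel J * emeasure \<nu> B"
    unfolding time_intensity_def using J J' B
    by (subst emeasure_pair_measure_Times) (auto simp: emeasure_restrict_space)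
qed

text \<open>If \<open>\<phi>\<close> and \<open>\<phi>'\<close> are injective with ranges disjoint from each other and from \<open>{1..p}\<close>, then together with the identity on
\<open>{1..p}\<close> they form one injection of \<open>{1..p + 2 * m}\<close>.  Hence their joint law is that of a reference pair.\<close>

lemma exchangeable_pair:
  assumes W: "exchangeable_law sig W"
    and \<phi>: "\<phi> \<in> {1..m} \<rightarrow>\<^sub>E {0<..}" "spread {1..p} {1..m} \<phi>"
    and \<phi>': "\<phi>' \<in> {1..m} \<rightarrow>\<^sub>E {0<..}" "spread ({1..p} \<union> \<phi> ` {1..m}) {1..m} \<phi>'"
  shows "emeasure W {M \<in> structs sig {0<..}. Q (restr {1..p} M) (relabel {1..m} \<phi> M) (relabel {1..m} \<phi>' M)} =
    emeasure W {M \<in> structs sig {0<..}. Q (restr {1..p} M) (relabel {1..m} (\<lambda>i. p + i) M) (relabel {1..m} (\<lambda>i. p + m + i) M)}"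
proof -
  define F where "F = {1..p + m + m}"
  define \<xi> where "\<xi> = (\<lambda>i. if i \<le> p then i else if i \<le> p + m then \<phi> (i - p) else \<phi>' (i - p - m))"
  define Q' where "Q' = (\<lambda>A. Q (restr {1..p} A) (relabel {1..m} (\<lambda>i. p + i) A) (relabel {1..m} (\<lambda>i. p + m + i) A))"
  have "\<xi> i \<noteq> \<xi> j" if ij: "i \<in> F" "j \<in> F" "i < j" for i j
  proof -
    have a: "\<phi> (k - p) \<in> \<phi> ` {1..m}" "\<phi> (k - p) \<notin> {1..p}" "k - p \<in> {1..m}" if "p < k" "k \<le> p + m" for k
    proof -
      show k: "k - p \<in> {1..m}" using that by auto
      then show "\<phi> (k - p) \<in> \<phi> ` {1..m}" by (rule imageI)
      then show "\<phi> (k - p) \<notin> {1..p}" using \<phi>(2) unfolding spread_def by blast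
    qed
    have b: "\<phi>' (k - p - m) \<notin> {1..p} \<union> \<phi> ` {1..m}" "k - p - m \<in> {1..m}" if "p + m < k" "k \<in> F" for k
    proof -
      show "k - p - m \<in> {1..m}" using that by (auto simp: F_def)
      then have "\<phi>' (k - p - m) \<in> \<phi>' ` {1..m}" by (rule imageI)
      then show "\<phi>' (k - p - m) \<notin> {1..p} \<union> \<phi> ` {1..m}" using \<phi>'(2) unfolding spread_def by blast
    qed
    have low: "\<xi> i = i" "i \<in> {1..p}" if "i \<le> p" using that ij by (auto simp: \<xi>_def F_def)
    have mid: "\<xi> k = \<phi> (k - p)" if "p < k" "k \<le> p + m" for k using that by (simp add: \<xi>_def)
    have high: "\<xi> k = \<phi>' (k - p - m)" if "p + m < k" for k using that by (simp add: \<xi>_def)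
    consider "j \<le> p" | "p < j" "j \<le> p + m" "i \<le> p" | "p < i" "j \<le> p + m" | "p + m < j" "i \<le> p"
      | "p + m < j" "p < i" "i \<le> p + m" | "p + m < i" by linarith
    then show ?thesis
    proof cases
      case 1 then show ?thesis using ij by (simp add: \<xi>_def)
    next
      case 2 then show ?thesis unfolding low(1)[OF 2(3)] mid[OF 2(1,2)] using low(2) a(2)[of j] by metis
    next
      case 3
      then have "i - p \<noteq> j - p" "p < j" "i \<le> p + m" using ij by auto
      then show ?thesis
        using inj_onD[of \<phi> "{1..m}" "i - p" "j - p"] \<phi>(2) a(3)[of i] a(3)[of j] 3 mid[of i] mid[of j]
        unfolding spread_def by metis
    next
      case 4 then show ?thesis unfolding low(1)[OF 4(2)] high[OF 4(1)] using low(2) b(1)[of j] ij(2) by (metis UnI1)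
    next
      case 5 then show ?thesis unfolding mid[OF 5(2,3)] high[OF 5(1)] using a(1)[of i] b(1)[of j] ij(2) by (metis UnI2)
    next
      case 6
      then have "i - p - m \<noteq> j - p - m" "p + m < j" using ij by auto
      then show ?thesis
        using inj_onD[of \<phi>' "{1..m}" "i - p - m" "j - p - m"] \<phi>'(2) b(2)[of i] b(2)[of j] 6 high[of i] high[of j] ij
        unfolding spread_def by metis
    qed
  qed
  then have "inj_on \<xi> F" by (rule linorder_inj_onI') auto
  moreover have "\<xi> ` F \<subseteq> {0<..}"
    using \<phi>(1) \<phi>'(1) unfolding F_def by (auto simp: \<xi>_def PiE_iff not_le)
  moreover have "finite F" "F \<subseteq> {0<..}" by (auto simp: F_def)
  ultimately have "emeasure W {M \<in> structs sig {0<..}. Q' (relabel F \<xi> M)} = emeasure W {M \<in> structs sig {0<..}. Q' (restr F M)}"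
    by (intro exchangeable_lawD[OF W])
  moreover have "Q' (relabel F \<xi> M) = Q (restr {1..p} M) (relabel {1..m} \<phi> M) (relabel {1..m} \<phi>' M)" for M
  proof -
    have "restr {1..p} (relabel F \<xi> M) = restr {1..p} M"
      unfolding restr_eq_relabel by (subst relabel_relabel) (auto simp: F_def \<xi>_def intro!: relabel_cong)
    moreover have "relabel {1..m} (\<lambda>i. p + i) (relabel F \<xi> M) = relabel {1..m} \<phi> M"
      by (subst relabel_relabel) (auto simp: F_def \<xi>_def intro!: relabel_cong)
    moreover have "relabel {1..m} (\<lambda>i. p + m + i) (relabel F \<xi> M) = relabel {1..m} \<phi>' M"
      by (subst relabel_relabel) (auto simp: F_def \<xi>_def intro!: relabel_cong)
    ultimately show ?thesis by (simp add: Q'_def)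
  qed
  moreover have "Q' (restr F M) = Q (restr {1..p} M) (relabel {1..m} (\<lambda>i. p + i) M) (relabel {1..m} (\<lambda>i. p + m + i) M)" for M
  proof -
    have "restr {1..p} (restr F M) = restr {1..p} M"
      unfolding restr_eq_relabel[of "{1..p}"] by (rule relabel_restr) (auto simp: F_def)
    moreover have "relabel {1..m} (\<lambda>i. p + i) (restr F M) = relabel {1..m} (\<lambda>i. p + i) M"
      "relabel {1..m} (\<lambda>i. p + m + i) (restr F M) = relabel {1..m} (\<lambda>i. p + m + i) M"
      by (rule relabel_restr, force simp: F_def)+
    ultimately show ?thesis by (simp add: Q'_def)
  qed
  ultimately show ?thesis by simp
qed

section \<open>Proportions of maps that are hit\<close>

abbreviation hit_share :: "signature \<Rightarrow> nat \<Rightarrow> nat \<Rightarrow> (real \<times> rel_struct) set \<Rightarrow> real set \<Rightarrow> real" where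
  "hit_share sig m N A J \<equiv> sample_mean {1..m} N (\<lambda>\<phi>. of_bool (A \<inter> J \<times> hitting sig m \<phi> \<noteq> {}))"

abbreviation invisible_hit_share :: "signature \<Rightarrow> nat \<Rightarrow> nat \<Rightarrow> nat \<Rightarrow> (real \<times> rel_struct) set \<Rightarrow> real \<Rightarrow> real" where
  "invisible_hit_share sig p m N A T \<equiv>
     sample_mean {1..m} N (\<lambda>\<phi>. of_bool (A \<inter> {0..T} \<times> invisible_hitting sig p m \<phi> \<noteq> {}))"

context prob_space
begin

text \<open>If no atom hits two maps with disjoint ranges, the hits of such maps are uncorrelated.  Centred hit indicators
thus satisfy the law of large numbers with correlation 0, so their averages tend to 0, and the proportion of
maps hit is asymptotically at most the largest hitting probability of an injection.\<close>

lemma independent_hits_mean: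
  assumes D: "poisson_point_process M (time_intensity \<nu>) D"
    and \<nu>: "sigma_finite_measure \<nu>" "sets \<nu> = sets (LN_borel sig)"
    and fin: "\<And>\<phi>. \<phi> \<in> {1..m} \<rightarrow>\<^sub>E {0<..} \<Longrightarrow>
      emeasure \<nu> (hitting sig m \<phi>) < \<infinity>"
    and C: "\<And>\<phi>. \<phi> \<in> {1..m} \<rightarrow>\<^sub>E {0<..} \<Longrightarrow> inj_on \<phi> {1..m} \<Longrightarrow>
      measure \<nu> (hitting sig m \<phi>) \<le> C"
    and null: "\<And>\<phi> \<phi>'. \<phi> \<in> {1..m} \<rightarrow>\<^sub>E {0<..} \<Longrightarrow> \<phi>' \<in> {1..m} \<rightarrow>\<^sub>E {0<..} \<Longrightarrow> \<phi> ` {1..m} \<inter> \<phi>' ` {1..m} = {} \<Longrightarrow>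
      emeasure \<nu> {M \<in> structs sig {0<..}. relabel {1..m} \<phi> M \<noteq> zero_struct sig \<and> relabel {1..m} \<phi>' M \<noteq> zero_struct sig} = 0"
    and q: "0 \<le> q" "q \<le> q'"
  shows "AE \<omega> in M. \<forall>e>0. \<forall>\<^sub>F N in sequentially. hit_share sig m N (D \<omega>) {q<..q'} \<le> C * (q' - q) + e"
proof -
  define H where "H = (\<lambda>\<phi>. hitting sig m \<phi>)"
  define B where "B = (\<lambda>\<phi>. {q<..q'} \<times> H \<phi>)"
  let ?I = "time_intensity \<nu>" and ?P = "{1..m} \<rightarrow>\<^sub>E {0::nat<..}"
  have box: "{q<..q'} \<times> S \<in> sets ?I" "emeasure ?I ({q<..q'} \<times> S) = ennreal (q' - q) * emeasure \<nu> S" if "S \<in> sets \<nu>" for S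
  proof -
    have "{q<..q'} \<subseteq> {0..}" using q by auto
    from time_intensity_box[OF \<nu>(1) _ this that] q
    show "{q<..q'} \<times> S \<in> sets ?I" "emeasure ?I ({q<..q'} \<times> S) = ennreal (q' - q) * emeasure \<nu> S" by auto
  qed
  have H: "H \<phi> \<in> sets \<nu>" if "\<phi> \<in> ?P" for \<phi>
    unfolding H_def \<nu>(2) by (rule relabel_event_sets[where Q = "\<lambda>A. A \<noteq> zero_struct sig"]) (use that in \<open>auto simp: PiE_iff\<close>)
  have B: "B \<phi> \<in> sets ?I" "emeasure ?I (B \<phi>) < \<infinity>" "measure ?I (B \<phi>) = (q' - q) * measure \<nu> (H \<phi>)" if "\<phi> \<in> ?P" for \<phi>
    using box[OF H[OF that]] fin[OF that] q unfolding B_def H_def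
    by (auto simp: ennreal_mult_less_top measure_def enn2real_mult)
  have hit: "expectation (\<lambda>\<omega>. of_bool (D \<omega> \<inter> B \<phi> \<noteq> {})) = 1 - exp (- measure ?I (B \<phi>))" if "\<phi> \<in> ?P" for \<phi>
    by (rule expectation_hit[OF D B(1,2)[OF that]])
  define r where "r = (\<lambda>\<phi>. 1 - exp (- measure ?I (B \<phi>)))"
  define Z where "Z = (\<lambda>\<phi> \<omega>. of_bool (D \<omega> \<inter> B \<phi> \<noteq> {}) - r \<phi>)"
  have r01: "0 \<le> r \<phi>" "r \<phi> \<le> 1" for \<phi> by (auto simp: r_def)
  have hm: "(\<lambda>\<omega>. of_bool (D \<omega> \<inter> B \<phi> \<noteq> {}) :: real) \<in> borel_measurable M" if "\<phi> \<in> ?P" for \<phi>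
    by (rule hit_measurable[OF D B(1)[OF that]])
  have hi: "integrable M (\<lambda>\<omega>. of_bool (D \<omega> \<inter> B \<phi> \<noteq> {}) :: real)" if "\<phi> \<in> ?P" for \<phi>
    by (rule integrable_const_bound[where B = 1]) (use hm[OF that] in auto)
  have Zm: "Z \<phi> \<in> borel_measurable M" if "\<phi> \<in> ?P" for \<phi>
    unfolding Z_def using hm[OF that] by measurable
  have cov: "expectation (\<lambda>\<omega>. Z \<phi> \<omega> * Z \<phi>' \<omega>) = 0"
    if P: "\<phi> \<in> ?P" "\<phi>' \<in> ?P" and s: "spread ({} \<union> \<phi> ` {1..m}) {1..m} \<phi>'" for \<phi> \<phi>'
  proof -
    have "B \<phi> \<inter> B \<phi>' = {q<..q'} \<times> (H \<phi> \<inter> H \<phi>')" by (auto simp: B_def)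
    moreover have "H \<phi> \<inter> H \<phi>' = {M \<in> structs sig {0<..}. relabel {1..m} \<phi> M \<noteq> zero_struct sig \<and> relabel {1..m} \<phi>' M \<noteq> zero_struct sig}"
      by (auto simp: H_def)
    moreover have "\<phi> ` {1..m} \<inter> \<phi>' ` {1..m} = {}" using s unfolding spread_def by blast
    ultimately have "B \<phi> \<inter> B \<phi>' = {q<..q'} \<times> (H \<phi> \<inter> H \<phi>')" "emeasure \<nu> (H \<phi> \<inter> H \<phi>') = 0"
      using null[OF P] by simp_all
    moreover have "H \<phi> \<inter> H \<phi>' \<in> sets \<nu>" using H P by auto
    ultimately have "emeasure ?I (B \<phi> \<inter> B \<phi>') = 0" using box(2)[of "H \<phi> \<inter> H \<phi>'"] by simp
    moreover have "B \<phi> \<in> fmeasurable ?I" "B \<phi>' \<in> fmeasurable ?I"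
      using B P by (auto intro!: fmeasurableI)
    ultimately have U: "measure ?I (B \<phi> \<union> B \<phi>') = measure ?I (B \<phi>) + measure ?I (B \<phi>')"
      by (subst measure_Un3) (auto simp: measure_def)
    have "integrable M (\<lambda>\<omega>. of_bool (D \<omega> \<inter> B \<phi> \<noteq> {}) * of_bool (D \<omega> \<inter> B \<phi>' \<noteq> {}) :: real)"
      by (rule integrable_const_bound[where B = 1]) (use hm[OF P(1)] hm[OF P(2)] in \<open>auto intro!: borel_measurable_times\<close>)
    then have "expectation (\<lambda>\<omega>. of_bool (D \<omega> \<inter> B \<phi> \<noteq> {}) * of_bool (D \<omega> \<inter> B \<phi>' \<noteq> {})
        - r \<phi>' * of_bool (D \<omega> \<inter> B \<phi> \<noteq> {}) - r \<phi> * of_bool (D \<omega> \<inter> B \<phi>' \<noteq> {}) + r \<phi> * r \<phi>') = 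
        (1 - exp (- measure ?I (B \<phi>)) - exp (- measure ?I (B \<phi>')) + exp (- measure ?I (B \<phi> \<union> B \<phi>')))
         - r \<phi>' * r \<phi> - r \<phi> * r \<phi>' + r \<phi> * r \<phi>'"
      using hi[OF P(1)] hi[OF P(2)] hit[OF P(1)] hit[OF P(2)]
        expectation_hit_both[OF D B(1,2)[OF P(1)] B(1,2)[OF P(2)]]
      by (simp add: prob_space r_def)
    also have "\<dots> = 0" unfolding U r_def by (simp add: exp_add[symmetric] algebra_simps)
    finally show ?thesis unfolding Z_def by (simp add: algebra_simps)
  qed
  obtain L where L: "L \<in> borel_measurable M" "expectation (\<lambda>\<omega>. (L \<omega>)\<^sup>2) = 0" "\<And>\<omega>. \<omega> \<in> space M \<Longrightarrow> \<bar>L \<omega>\<bar> \<le> 1"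
    and conv: "AE \<omega> in M. (\<lambda>N. sample_mean {1..m} N (\<lambda>\<phi>. Z \<phi> \<omega>)) \<longlonglongrightarrow> L \<omega>"
  proof (rule sample_means_converge[of "{1..m}" "{}" Z 0])
    show "\<bar>Z \<phi> \<omega>\<bar> \<le> 1" for \<phi> \<omega> using r01[of \<phi>] by (auto simp: Z_def of_bool_def)
  qed (use Zm cov in auto)
  have L0: "AE \<omega> in M. (L \<omega>)\<^sup>2 = 0"
  proof -
    have "integrable M (\<lambda>\<omega>. (L \<omega>)\<^sup>2)"
      by (rule integrable_const_bound[where B = 1]) (use L(1,3) in \<open>auto simp: abs_square_le_1\<close>)
    then show ?thesis using integral_nonneg_eq_0_iff_AE[of M "\<lambda>\<omega>. (L \<omega>)\<^sup>2"] L(2) by simp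
  qed
  show ?thesis
  proof (rule AE_mp[OF conv], rule AE_mp[OF L0], rule AE_I2, intro impI)
    fix \<omega> assume elim: "(\<lambda>N. sample_mean {1..m} N (\<lambda>\<phi>. Z \<phi> \<omega>)) \<longlonglongrightarrow> L \<omega>" "(L \<omega>)\<^sup>2 = 0"
    show "\<forall>e>0. \<forall>\<^sub>F N in sequentially. hit_share sig m N (D \<omega>) {q<..q'} \<le> C * (q' - q) + e"
    proof (intro allI impI)
      fix e :: real assume e: "e > 0"
      have "0 \<le> measure \<nu> (hitting sig m (restrict id {1..m}))" by simp
      also have "\<dots> \<le> C" by (rule C) (auto simp: inj_on_def)
      finally have C0: "0 \<le> C" .
      have "(\<lambda>N. sample_mean {1..m} N (\<lambda>\<phi>. Z \<phi> \<omega>)) \<longlonglongrightarrow> 0" using elim by simp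
      then have "\<forall>\<^sub>F N in sequentially. sample_mean {1..m} N (\<lambda>\<phi>. Z \<phi> \<omega>) < e / 2"
        by (rule order_tendstoD) (use e in simp)
      moreover have "(\<lambda>N. real m * real m / real N) \<longlonglongrightarrow> 0" by real_asymp
      then have "\<forall>\<^sub>F N in sequentially. real m * real m / real N < e / 2"
        by (rule order_tendstoD) (use e in simp)
      moreover have "\<forall>\<^sub>F N in sequentially. N \<ge> (1::nat)" by (rule eventually_ge_at_top)
      ultimately show "\<forall>\<^sub>F N in sequentially. hit_share sig m N (D \<omega>) {q<..q'} \<le> C * (q' - q) + e"
      proof eventually_elim
        case (elim N)
        have "sample_mean {1..m} N (\<lambda>\<phi>. of_bool (D \<omega> \<inter> B \<phi> \<noteq> {})) =
            sample_mean {1..m} N (\<lambda>\<phi>. Z \<phi> \<omega> + r \<phi>)" by (simp add: Z_def)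
        also have "\<dots> = sample_mean {1..m} N (\<lambda>\<phi>. Z \<phi> \<omega>) + sample_mean {1..m} N r"
          by (rule sample_mean_add)
        also have "sample_mean {1..m} N r \<le> sample_mean {1..m} N (\<lambda>\<phi>. C * (q' - q) + of_bool (\<not> spread {} {1..m} \<phi>))"
        proof (rule sample_mean_mono)
          fix \<phi> assume "\<phi> \<in> {1..m} \<rightarrow>\<^sub>E {1..N}"
          then have \<phi>: "\<phi> \<in> ?P" by (rule maps_pos)
          have "r \<phi> \<le> measure ?I (B \<phi>)" using exp_ge_add_one_self[of "- measure ?I (B \<phi>)"] by (simp add: r_def)
          also have "\<dots> = (q' - q) * measure \<nu> (H \<phi>)" by (rule B(3)[OF \<phi>])
          finally have "r \<phi> \<le> C * (q' - q)" if "inj_on \<phi> {1..m}"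
            using mult_left_mono[OF C[OF \<phi> that], of "q' - q"] q by (simp add: H_def mult.commute)
          moreover have "0 \<le> C * (q' - q)" using C0 q by simp
          ultimately show "r \<phi> \<le> C * (q' - q) + of_bool (\<not> spread {} {1..m} \<phi>)"
            using r01(2)[of \<phi>] by (auto simp: spread_def)
        qed
        also have "\<dots> = C * (q' - q) + sample_mean {1..m} N (\<lambda>\<phi>. of_bool (\<not> spread {} {1..m} \<phi>))"
          using elim(3) by (simp add: sample_mean_add sample_mean_const)
        also have "sample_mean {1..m} N (\<lambda>\<phi>. of_bool (\<not> spread {} {1..m} \<phi>)) \<le> real m * real m / N"
          using sample_mean_not_spread[of "{1..m}" "{}" N] elim(3) by simp
        finally show ?case using elim(1,2) unfolding B_def H_def by linarith
      qed
    qed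
  qed
qed

text \<open>Hits are counted only if they are due to atoms that are empty on \<open>{1..p}\<close>.  By exchangeability, all pairs of maps
with disjoint ranges outside \<open>{1..p}\<close> have the same probability \<open>c\<close> of being both hit, so the law of large
numbers applies with the forbidden set \<open>{1..p}\<close>; and \<open>c\<close> is at most the probability that the first of them is hit.\<close>

lemma invisible_hits_mean:
  assumes D: "poisson_point_process M (time_intensity \<nu>) D"
    and \<nu>: "sigma_finite_measure \<nu>" "sets \<nu> = sets (LN_borel sig)" "exchangeable_law sig \<nu>"
    and fin: "\<And>\<phi>. \<phi> ` {1..m} \<subseteq> {0<..} \<Longrightarrow>
      emeasure \<nu> (hitting sig m \<phi>) < \<infinity>"
    and T: "0 \<le> T"
  obtains L where "L \<in> borel_measurable M" "\<And>\<omega>. \<omega> \<in> space M \<Longrightarrow> \<bar>L \<omega>\<bar> \<le> 1"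
    "expectation (\<lambda>\<omega>. (L \<omega>)\<^sup>2) \<le> T * measure \<nu> (invisible_hitting sig p m (\<lambda>i. p + i))"
    "AE \<omega> in M. (\<lambda>N. invisible_hit_share sig p m N (D \<omega>) T) \<longlonglongrightarrow> L \<omega>"
proof -
  define H where "H = (\<lambda>\<phi>. invisible_hitting sig p m \<phi>)"
  define B where "B = (\<lambda>\<phi>. {0..T} \<times> H \<phi>)"
  let ?I = "time_intensity \<nu>" and ?P = "{1..m} \<rightarrow>\<^sub>E {0::nat<..}"
  \<comment> \<open>The reference pair of maps in \<open>exchangeable_pair\<close>.\<close>
  define a where "a = (\<lambda>i. p + i)"
  define b where "b = (\<lambda>i. p + m + i)"
  have box: "{0..T} \<times> S \<in> sets ?I" "emeasure ?I ({0..T} \<times> S) = ennreal T * emeasure \<nu> S" if "S \<in> sets \<nu>" for S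
    using time_intensity_box[OF \<nu>(1) _ _ that, of "{0..T}"] T by auto
  have rs: "hitting sig m \<phi> \<in> sets \<nu>" if "\<phi> ` {1..m} \<subseteq> {0<..}" for \<phi>
    unfolding \<nu>(2) by (rule relabel_event_sets[where Q = "\<lambda>A. A \<noteq> zero_struct sig"]) (use that in auto)
  have H: "H \<phi> \<in> sets \<nu>" if "\<phi> ` {1..m} \<subseteq> {0<..}" for \<phi>
  proof -
    have "H \<phi> = {M \<in> structs sig {0<..}. restr {1..p} M = zero_struct sig} \<inter> hitting sig m \<phi>"
      by (auto simp: H_def)
    then show ?thesis using rs[OF that] restr_event_sets[of sig "\<lambda>A. A = zero_struct sig" p] \<nu>(2) by auto
  qed
  have Hfin: "emeasure \<nu> (H \<phi>) < \<infinity>" if "\<phi> ` {1..m} \<subseteq> {0<..}" for \<phi>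
    by (rule le_less_trans[OF emeasure_mono fin[OF that]]) (use rs[OF that] in \<open>auto simp: H_def\<close>)
  have B: "B \<phi> \<in> sets ?I" "emeasure ?I (B \<phi>) < \<infinity>" if "\<phi> ` {1..m} \<subseteq> {0<..}" for \<phi>
    using box[OF H[OF that]] Hfin[OF that] unfolding B_def by (auto simp: ennreal_mult_less_top)
  have mB: "measure ?I (B \<phi>) = T * measure \<nu> (H \<phi>)" if "\<phi> ` {1..m} \<subseteq> {0<..}" for \<phi>
    using box[OF H[OF that]] T unfolding B_def by (simp add: measure_def enn2real_mult)
  have mBU: "measure ?I (B \<phi> \<union> B \<phi>') = T * measure \<nu> (H \<phi> \<union> H \<phi>')" if "\<phi> ` {1..m} \<subseteq> {0<..}" "\<phi>' ` {1..m} \<subseteq> {0<..}" for \<phi> \<phi>'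
    using box[of "H \<phi> \<union> H \<phi>'"] H[OF that(1)] H[OF that(2)] T unfolding B_def Sigma_Un_distrib2[symmetric]
    by (simp add: measure_def enn2real_mult)
  have PI: "\<phi> ` {1..m} \<subseteq> {0<..}" if "\<phi> \<in> ?P" for \<phi> using that by (auto simp: PiE_iff)
  have ab: "a ` {1..m} \<subseteq> {0<..}" "b ` {1..m} \<subseteq> {0<..}" by (auto simp: a_def b_def)
  define Z where "Z = (\<lambda>\<phi> \<omega>. of_bool (D \<omega> \<inter> B \<phi> \<noteq> {}) :: real)"
  have Zm: "Z \<phi> \<in> borel_measurable M" if "\<phi> ` {1..m} \<subseteq> {0<..}" for \<phi>
    unfolding Z_def by (rule hit_measurable[OF D B(1)[OF that]])
  define c where "c = expectation (\<lambda>\<omega>. Z a \<omega> * Z b \<omega>)"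
  have cov: "expectation (\<lambda>\<omega>. Z \<phi> \<omega> * Z \<phi>' \<omega>) = c"
    if P: "\<phi> \<in> ?P" "\<phi>' \<in> ?P" and s: "spread {1..p} {1..m} \<phi>" "spread ({1..p} \<union> \<phi> ` {1..m}) {1..m} \<phi>'" for \<phi> \<phi>'
  proof -
    note ex = exchangeable_pair[OF \<nu>(3) P(1) s(1) P(2) s(2)]
    have "emeasure \<nu> (H \<phi>) = emeasure \<nu> (H a)" "emeasure \<nu> (H \<phi>') = emeasure \<nu> (H b)"
      unfolding H_def a_def b_def
      by (rule ex[of "\<lambda>x y z. x = zero_struct sig \<and> y \<noteq> zero_struct sig"],
          rule ex[of "\<lambda>x y z. x = zero_struct sig \<and> z \<noteq> zero_struct sig"])
    moreover have "emeasure \<nu> (H \<phi> \<union> H \<phi>') = emeasure \<nu> (H a \<union> H b)"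
    proof -
      have "H \<phi> \<union> H \<phi>' = {M \<in> structs sig {0<..}. restr {1..p} M = zero_struct sig \<and>
          (relabel {1..m} \<phi> M \<noteq> zero_struct sig \<or> relabel {1..m} \<phi>' M \<noteq> zero_struct sig)}" for \<phi> \<phi>'
        by (auto simp: H_def)
      then show ?thesis unfolding a_def b_def
        by (simp only: ex[of "\<lambda>x y z. x = zero_struct sig \<and> (y \<noteq> zero_struct sig \<or> z \<noteq> zero_struct sig)"])
    qed
    ultimately have "measure ?I (B \<phi>) = measure ?I (B a)" "measure ?I (B \<phi>') = measure ?I (B b)"
      "measure ?I (B \<phi> \<union> B \<phi>') = measure ?I (B a \<union> B b)"
      unfolding mB[OF PI[OF P(1)]] mB[OF PI[OF P(2)]] mB[OF ab(1)] mB[OF ab(2)] mBU[OF PI[OF P(1)] PI[OF P(2)]] mBU[OF ab]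
      by (simp_all add: measure_def)
    then show ?thesis
      unfolding c_def Z_def expectation_hit_both[OF D B(1,2)[OF PI[OF P(1)]] B(1,2)[OF PI[OF P(2)]]]
        expectation_hit_both[OF D B(1,2)[OF ab(1)] B(1,2)[OF ab(2)]] by simp
  qed
  have iZ: "integrable M (Z a)" "integrable M (\<lambda>\<omega>. Z a \<omega> * Z b \<omega>)"
    by (rule integrable_const_bound[where B = 1]; use Zm[OF ab(1)] Zm[OF ab(2)] in \<open>auto simp: Z_def intro!: borel_measurable_times\<close>)+
  have cle: "c \<le> T * measure \<nu> (H a)"
  proof -
    have "c \<le> expectation (Z a)" unfolding c_def by (rule integral_mono) (use iZ in \<open>auto simp: Z_def\<close>)
    also have "\<dots> = 1 - exp (- measure ?I (B a))" unfolding Z_def by (rule expectation_hit[OF D B[OF ab(1)]])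
    also have "\<dots> \<le> measure ?I (B a)" using exp_ge_add_one_self[of "- measure ?I (B a)"] by simp
    finally show ?thesis by (simp add: mB[OF ab(1)])
  qed
  have c01: "0 \<le> c" unfolding c_def by (rule Bochner_Integration.integral_nonneg) (auto simp: Z_def)
  have "c \<le> expectation (\<lambda>_. 1)" unfolding c_def by (rule integral_mono) (use iZ in \<open>auto simp: Z_def\<close>)
  then have c1: "\<bar>c\<bar> \<le> 1" using c01 by (simp add: prob_space)
  obtain L where L: "L \<in> borel_measurable M" "expectation (\<lambda>\<omega>. (L \<omega>)\<^sup>2) = c" "\<And>\<omega>. \<omega> \<in> space M \<Longrightarrow> \<bar>L \<omega>\<bar> \<le> 1"
    and conv: "AE \<omega> in M. (\<lambda>N. sample_mean {1..m} N (\<lambda>\<phi>. Z \<phi> \<omega>)) \<longlonglongrightarrow> L \<omega>"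
  proof (rule sample_means_converge[of "{1..m}" "{1..p}" Z c])
    show "Z \<phi> \<in> borel_measurable M" if "\<phi> \<in> ?P" for \<phi> by (rule Zm[OF PI[OF that]])
    show "\<bar>Z \<phi> \<omega>\<bar> \<le> 1" for \<phi> \<omega> by (simp add: Z_def)
  qed (use cov c1 in auto)
  have le: "expectation (\<lambda>\<omega>. (L \<omega>)\<^sup>2) \<le> T * measure \<nu> (H a)" using L(2) cle by simp
  show ?thesis
  proof (rule that[of L])
    show "\<bar>L \<omega>\<bar> \<le> 1" if "\<omega> \<in> space M" for \<omega> by (rule L(3)[OF that])
  qed (fact L(1), fact le[unfolded H_def a_def], fact conv[unfolded Z_def B_def H_def])
qed

text \<open>The limits \<open>L p\<close> of the previous lemma have second moments tending to 0, so the infimum of their squares over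
\<open>p\<close> is almost surely 0.\<close>

lemma invisible_hits_vanish:
  assumes D: "poisson_point_process M (time_intensity \<nu>) D"
    and \<nu>: "sigma_finite_measure \<nu>" "sets \<nu> = sets (LN_borel sig)" "exchangeable_law sig \<nu>"
    and fin: "\<And>\<phi>. \<phi> ` {1..m} \<subseteq> {0<..} \<Longrightarrow>
      emeasure \<nu> (hitting sig m \<phi>) < \<infinity>"
    and T: "0 \<le> T"
    and lim: "(\<lambda>p. measure \<nu> (invisible_hitting sig p m (\<lambda>i. p + i))) \<longlonglongrightarrow> 0"
  shows "AE \<omega> in M. \<forall>e>0. \<exists>p. \<forall>\<^sub>F N in sequentially. invisible_hit_share sig p m N (D \<omega>) T \<le> e"
proof -
  define x where "x = (\<lambda>p. measure \<nu> (invisible_hitting sig p m (\<lambda>i. p + i)))"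
  define S where "S = (\<lambda>p N \<omega>. invisible_hit_share sig p m N (D \<omega>) T)"
  define good where "good = (\<lambda>p L. L \<in> borel_measurable M \<and> (\<forall>\<omega>\<in>space M. \<bar>L \<omega>\<bar> \<le> 1) \<and>
     expectation (\<lambda>\<omega>. (L \<omega>)\<^sup>2) \<le> T * x p \<and> (AE \<omega> in M. (\<lambda>N. S p N \<omega>) \<longlonglongrightarrow> L \<omega>))"
  have "\<exists>L. good p L" for p
    unfolding good_def x_def S_def
    by (rule invisible_hits_mean[OF D \<nu>, of m T p], erule fin, rule T) blast
  then obtain L\<^sub>0 where L\<^sub>0: "\<And>p. good p (L\<^sub>0 p)" by metis
  define L where "L = L\<^sub>0"
  have L: "\<And>p. L p \<in> borel_measurable M" "\<And>p \<omega>. \<omega> \<in> space M \<Longrightarrow> \<bar>L p \<omega>\<bar> \<le> 1"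
      "\<And>p. expectation (\<lambda>\<omega>. (L p \<omega>)\<^sup>2) \<le> T * x p" and conv: "\<And>p. AE \<omega> in M. (\<lambda>N. S p N \<omega>) \<longlonglongrightarrow> L p \<omega>"
    using L\<^sub>0 unfolding good_def L_def by blast+
  note [measurable] = L(1)
  have "(\<integral>\<^sup>+\<omega>. (INF p. ennreal ((L p \<omega>)\<^sup>2)) \<partial>M) \<le> ennreal (T * x p)" for p
  proof -
    have i: "integrable M (\<lambda>\<omega>. (L p \<omega>)\<^sup>2)"
      by (rule integrable_const_bound[where B = 1]) (use L(2) in \<open>auto simp: abs_square_le_1\<close>)
    have "(\<integral>\<^sup>+\<omega>. (INF p. ennreal ((L p \<omega>)\<^sup>2)) \<partial>M) \<le> (\<integral>\<^sup>+\<omega>. ennreal ((L p \<omega>)\<^sup>2) \<partial>M)"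
      by (intro nn_integral_mono INF_lower) simp
    also have "\<dots> = ennreal (expectation (\<lambda>\<omega>. (L p \<omega>)\<^sup>2))"
      by (rule nn_integral_eq_integral[OF i]) simp
    also have "\<dots> \<le> ennreal (T * x p)" by (rule ennreal_leI[OF L(3)])
    finally show ?thesis .
  qed
  moreover have "(\<lambda>p. ennreal (T * x p)) \<longlonglongrightarrow> ennreal (T * 0)"
    using lim unfolding x_def[symmetric] by (intro tendsto_ennrealI tendsto_mult tendsto_const)
  ultimately have "(\<integral>\<^sup>+\<omega>. (INF p. ennreal ((L p \<omega>)\<^sup>2)) \<partial>M) \<le> 0"
    by (intro LIMSEQ_le_const[of _ "0::ennreal"]) auto
  then have "AE \<omega> in M. (INF p. ennreal ((L p \<omega>)\<^sup>2)) = 0"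
    by (subst (asm) le_zero_eq, subst (asm) nn_integral_0_iff_AE) auto
  moreover have "AE \<omega> in M. \<forall>p. (\<lambda>N. S p N \<omega>) \<longlonglongrightarrow> L p \<omega>"
    using conv by (simp add: AE_all_countable)
  ultimately have *: "AE \<omega> in M. (INF p. ennreal ((L p \<omega>)\<^sup>2)) = 0 \<and> (\<forall>p. (\<lambda>N. S p N \<omega>) \<longlonglongrightarrow> L p \<omega>)"
    by (rule AE_conjI)
  show ?thesis
  proof (rule AE_mp[OF *], rule AE_I2, rule impI)
    fix \<omega> assume elim: "(INF p. ennreal ((L p \<omega>)\<^sup>2)) = 0 \<and> (\<forall>p. (\<lambda>N. S p N \<omega>) \<longlonglongrightarrow> L p \<omega>)"
    show "\<forall>e>0. \<exists>p. \<forall>\<^sub>F N in sequentially. invisible_hit_share sig p m N (D \<omega>) T \<le> e"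
    proof (intro allI impI)
      fix e :: real assume e: "e > 0"
      then have "(INF p. ennreal ((L p \<omega>)\<^sup>2)) < ennreal (e\<^sup>2)" using elim by simp
      then obtain p where "ennreal ((L p \<omega>)\<^sup>2) < ennreal (e\<^sup>2)" by (auto simp: INF_less_iff)
      then have "(L p \<omega>)\<^sup>2 < e\<^sup>2" by (simp add: ennreal_less_iff)
      then have "L p \<omega> < e" using e by (meson less_imp_le power_less_imp_less_base)
      then have "\<forall>\<^sub>F N in sequentially. S p N \<omega> < e" using elim by (auto dest: order_tendstoD)
      then show "\<exists>p. \<forall>\<^sub>F N in sequentially. invisible_hit_share sig p m N (D \<omega>) T \<le> e"
        unfolding S_def by (intro exI[of _ p]) (auto elim!: eventually_mono)
    qed
  qed
qed

text \<open>The law of large numbers for the indicators of \<open>relabel {1..m} \<phi> X = A\<close>, with empty forbidden set.\<close>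

lemma exchangeable_densities_converge:
  assumes X: "X \<in> measurable M (LN_borel sig)" and ex: "exchangeable_law sig (distr M (LN_borel sig) X)"
  shows "AE \<omega> in M. \<forall>m. \<forall>A\<in>structs sig {1..m}. convergent (sampling_density m A (X \<omega>))"
  unfolding AE_all_countable
proof (intro allI)
  fix m :: nat
  let ?P = "{1..m} \<rightarrow>\<^sub>E {0::nat<..}"
  have "AE \<omega> in M. convergent (sampling_density m A (X \<omega>))" for A
  proof -
    define Z where "Z = (\<lambda>\<phi> \<omega>. of_bool (relabel {1..m} \<phi> (X \<omega>) = A) :: real)"
    have XS: "X \<omega> \<in> structs sig {0<..}" if "\<omega> \<in> space M" for \<omega>
      using measurable_space[OF X that] by simp
    have ev: "{M \<in> structs sig {0<..}. relabel {1..m} \<phi> M = A} \<in> sets (LN_borel sig)" if "\<phi> ` {1..m} \<subseteq> {0<..}" for \<phi>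
      by (rule relabel_event_sets[where Q = "\<lambda>B. B = A"]) (use that in auto)
    have Zm: "Z \<phi> \<in> borel_measurable M" if "\<phi> \<in> ?P" for \<phi>
    proof -
      have "X -` {M \<in> structs sig {0<..}. relabel {1..m} \<phi> M = A} \<inter> space M \<in> events"
        using X ev by (rule measurable_sets) (use that in \<open>auto simp: PiE_iff\<close>)
      then have "(indicator (X -` {M \<in> structs sig {0<..}. relabel {1..m} \<phi> M = A} \<inter> space M) :: _ \<Rightarrow> real) \<in> borel_measurable M"
        by simp
      then show ?thesis
        by (rule measurable_cong[THEN iffD1, rotated]) (use XS in \<open>auto simp: Z_def indicator_def\<close>)
    qed
    define G where "G = (\<lambda>\<phi> \<phi>'. {M \<in> structs sig {0<..}. relabel {1..m} \<phi> M = A \<and> relabel {1..m} \<phi>' M = A})"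
    have G: "G \<phi> \<phi>' \<in> sets (LN_borel sig)" if "\<phi> ` {1..m} \<subseteq> {0<..}" "\<phi>' ` {1..m} \<subseteq> {0<..}" for \<phi> \<phi>'
    proof -
      have "G \<phi> \<phi>' = {M \<in> structs sig {0<..}. relabel {1..m} \<phi> M = A} \<inter> {M \<in> structs sig {0<..}. relabel {1..m} \<phi>' M = A}"
        by (auto simp: G_def)
      then show ?thesis using ev that by auto
    qed
    have E: "expectation (\<lambda>\<omega>. Z \<phi> \<omega> * Z \<phi>' \<omega>) = measure (distr M (LN_borel sig) X) (G \<phi> \<phi>')"
      if "\<phi> ` {1..m} \<subseteq> {0<..}" "\<phi>' ` {1..m} \<subseteq> {0<..}" for \<phi> \<phi>'
    proof -
      have "measure (distr M (LN_borel sig) X) (G \<phi> \<phi>') = prob (X -` G \<phi> \<phi>' \<inter> space M)"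
        by (rule measure_distr[OF X G[OF that]])
      also have "\<dots> = expectation (indicator (X -` G \<phi> \<phi>' \<inter> space M))"
        using measurable_sets[OF X G[OF that]] by simp
      also have "\<dots> = expectation (\<lambda>\<omega>. Z \<phi> \<omega> * Z \<phi>' \<omega>)"
        by (rule Bochner_Integration.integral_cong) (use XS in \<open>auto simp: Z_def G_def indicator_def\<close>)
      finally show ?thesis by simp
    qed
    define c where "c = measure (distr M (LN_borel sig) X) (G (\<lambda>i. 0 + i) (\<lambda>i. 0 + m + i))"
    interpret D: prob_space "distr M (LN_borel sig) X" by (rule prob_space_distr[OF X])
    obtain L where "AE \<omega> in M. (\<lambda>N. sample_mean {1..m} N (\<lambda>\<phi>. Z \<phi> \<omega>)) \<longlonglongrightarrow> L \<omega>"
    proof (rule sample_means_converge[of "{1..m}" "{1..0}" Z c])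
      fix \<phi> \<phi>' assume P: "\<phi> \<in> ?P" "\<phi>' \<in> ?P" and s: "spread {1..0} {1..m} \<phi>" "spread ({1..0} \<union> \<phi> ` {1..m}) {1..m} \<phi>'"
      have "expectation (\<lambda>\<omega>. Z \<phi> \<omega> * Z \<phi>' \<omega>) = measure (distr M (LN_borel sig) X) (G \<phi> \<phi>')"
        by (rule E) (use P in \<open>auto simp: PiE_iff\<close>)
      also have "\<dots> = c"
        unfolding c_def G_def measure_def
        by (rule arg_cong[of _ _ enn2real],
            rule exchangeable_pair[OF ex P(1) s(1) P(2) s(2), of "\<lambda>x y z. y = A \<and> z = A"])
      finally show "expectation (\<lambda>\<omega>. Z \<phi> \<omega> * Z \<phi>' \<omega>) = c" .
    qed (use Zm in \<open>auto simp: Z_def c_def\<close>)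
    then show ?thesis unfolding sampling_density_def Z_def by eventually_elim (auto simp: convergent_def)
  qed
  then show "AE \<omega> in M. \<forall>A\<in>structs sig {1..m}. convergent (sampling_density m A (X \<omega>))"
    by (simp add: AE_ball_countable countable_finite finite_structs)
qed

end

section \<open>Exchangeability of the driving measures\<close>

lemma exchangeable_lawI:
  assumes sets: "sets W = sets (LN_borel sig)"
    and inv: "\<And>\<sigma>. \<sigma> \<in> LN_perms \<Longrightarrow> distr W (LN_borel sig) (relabel {0<..} \<sigma>) = W"
  shows "exchangeable_law sig W"
  unfolding exchangeable_law_def
proof (intro ballI allI)
  fix \<sigma> n Q assume \<sigma>: "\<sigma> \<in> LN_perms"
  then have im: "\<sigma> ` {0<..} = {0<..}" by (simp add: LN_perms_def bij_betw_def)
  have space: "space W = structs sig {0<..}" using sets_eq_imp_space_eq[OF sets] by simp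
  have meas: "relabel {0<..} \<sigma> \<in> measurable W (LN_borel sig)"
    using measurable_relabel[of "{0<..}" \<sigma> sig] im measurable_cong_sets[OF sets refl] by auto
  let ?S = "{M \<in> structs sig {0<..}. Q (restr {1..n} M)}"
  have "emeasure W ?S = emeasure (distr W (LN_borel sig) (relabel {0<..} \<sigma>)) ?S" using inv[OF \<sigma>] by simp
  also have "\<dots> = emeasure W (relabel {0<..} \<sigma> -` ?S \<inter> space W)"
    by (rule emeasure_distr[OF meas restr_event_sets])
  also have "relabel {0<..} \<sigma> -` ?S \<inter> space W = {M \<in> structs sig {0<..}. Q (relabel {1..n} \<sigma> M)}"
    using relabel_in_structs[of _ sig "{0<..}" "{0<..}" \<sigma>] by (auto simp: space restr_relabel)
  finally show "emeasure W {M \<in> structs sig {0<..}. Q (relabel {1..n} \<sigma> M)} = emeasure W ?S" by simp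
qed

lemma E_space_exchangeable: "W \<in> E_space sig \<Longrightarrow> exchangeable_law sig W"
  by (rule exchangeable_lawI) (auto simp: E_space_def space_prob_algebra)

lemma exchangeable_process_marginal:
  assumes ex: "exchangeable_process P sig X" and X: "X t \<in> measurable P (LN_borel sig)" and t: "0 \<le> t"
  shows "exchangeable_law sig (distr P (LN_borel sig) (X t))"
proof (rule exchangeable_lawI)
  fix \<sigma> assume \<sigma>: "\<sigma> \<in> LN_perms"
  then have r: "relabel {0<..} \<sigma> \<in> measurable (LN_borel sig) (LN_borel sig)"
    by (intro measurable_relabel) (auto simp: LN_perms_def bij_betw_def)
  let ?\<Pi> = "\<Pi>\<^sub>M s\<in>{t}. LN_borel sig"
  have rX: "(\<lambda>\<omega>. relabel {0<..} \<sigma> (X t \<omega>)) \<in> measurable P (LN_borel sig)" using measurable_compose[OF X r] .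
  have proj: "(\<lambda>f. f t) \<in> measurable ?\<Pi> (LN_borel sig)" by (rule measurable_component_singleton) simp
  have vec: "(\<lambda>\<omega>. \<lambda>s\<in>{t}. Y s \<omega>) \<in> measurable P ?\<Pi>" if "Y t \<in> measurable P (LN_borel sig)" for Y
    using that by (intro measurable_restrict) auto
  have "distr P ?\<Pi> (\<lambda>\<omega>. \<lambda>s\<in>{t}. relabel {0<..} \<sigma> (X s \<omega>)) = distr P ?\<Pi> (\<lambda>\<omega>. \<lambda>s\<in>{t}. X s \<omega>)"
    using ex \<sigma> t unfolding exchangeable_process_def by auto
  then have "distr (distr P ?\<Pi> (\<lambda>\<omega>. \<lambda>s\<in>{t}. relabel {0<..} \<sigma> (X s \<omega>))) (LN_borel sig) (\<lambda>f. f t) =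
      distr (distr P ?\<Pi> (\<lambda>\<omega>. \<lambda>s\<in>{t}. X s \<omega>)) (LN_borel sig) (\<lambda>f. f t)" by simp
  then have "distr P (LN_borel sig) (\<lambda>\<omega>. relabel {0<..} \<sigma> (X t \<omega>)) = distr P (LN_borel sig) (X t)"
    using vec[of "\<lambda>s \<omega>. relabel {0<..} \<sigma> (X s \<omega>)", OF rX] vec[of X, OF X]
    by (simp add: distr_distr[OF proj] comp_def)
  then show "distr (distr P (LN_borel sig) (X t)) (LN_borel sig) (relabel {0<..} \<sigma>) = distr P (LN_borel sig) (X t)"
    by (simp add: distr_distr[OF r X] comp_def)
qed simp

text \<open>\<open>mixture\<close> and \<open>symmetrized\<close> are defined by prescribing a set function.  If that function were not a measure,
the result would be the zero measure; the invariance and nullity statements below hold in either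
case.\<close>

lemma emeasure_measure_of_sets:
  "emeasure (measure_of (space M) (sets M) f) B =
    (if B \<in> sets M \<and> measure_space (space M) (sets M) f then f B else 0)"
  using sets.space_closed[of M] by (simp add: emeasure_measure_of_conv sets.sigma_sets_eq)

lemma sets_mixture [simp]: "sets (mixture sig \<nu>) = sets (LN_borel sig)"
  unfolding mixture_def by (rule sets.sets_measure_of_eq)

lemma sets_symmetrized [simp]: "sets (symmetrized sig \<tau> l m) = sets (LN_borel sig)"
  unfolding symmetrized_def by (rule sets.sets_measure_of_eq)

lemma space_E_borel: "sets \<nu> = sets (E_borel sig) \<Longrightarrow> space \<nu> = E_space sig"
proof -
  assume "sets \<nu> = sets (E_borel sig)"
  then have "space \<nu> = space (E_borel sig)" by (rule sets_eq_imp_space_eq)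
  also have "\<dots> = E_space sig"
    unfolding E_borel_def E_top_def
    by (rule space_measure_of) (use Metric_space.topspace_mtopology[OF Metric_space_limits, of sig] openin_subset in fastforce)
  finally show ?thesis .
qed

lemma mixture_exchangeable:
  assumes "sets \<nu> = sets (E_borel sig)" shows "exchangeable_law sig (mixture sig \<nu>)"
  unfolding exchangeable_law_def
proof (intro ballI allI)
  fix \<sigma> n Q assume \<sigma>: "\<sigma> \<in> LN_perms"
  let ?S = "{M \<in> structs sig {0<..}. Q (relabel {1..n} \<sigma> M)}" and ?T = "{M \<in> structs sig {0<..}. Q (restr {1..n} M)}"
  have "\<sigma> ` {1..n} \<subseteq> {0<..}" using \<sigma> by (auto simp: LN_perms_def bij_betw_def)
  then have sets: "?S \<in> sets (LN_borel sig)" "?T \<in> sets (LN_borel sig)"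
    using relabel_event_sets[of "{1..n}" \<sigma> sig Q] restr_event_sets[of sig Q n] by auto
  have "(\<integral>\<^sup>+W. emeasure W ?S \<partial>\<nu>) = (\<integral>\<^sup>+W. emeasure W ?T \<partial>\<nu>)"
    by (rule nn_integral_cong)
      (use E_space_exchangeable \<sigma> in \<open>auto simp: space_E_borel[OF assms] exchangeable_law_def\<close>)
  then show "emeasure (mixture sig \<nu>) ?S = emeasure (mixture sig \<nu>) ?T"
    unfolding mixture_def emeasure_measure_of_sets using sets by simp
qed

lemma mixture_null:
  assumes "AE W in \<nu>. emeasure W B = 0" shows "emeasure (mixture sig \<nu>) B = 0"
proof -
  have "(\<integral>\<^sup>+W. emeasure W B \<partial>\<nu>) = (\<integral>\<^sup>+W. 0 \<partial>\<nu>)" using assms by (rule nn_integral_cong_AE)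
  then show ?thesis unfolding mixture_def emeasure_measure_of_sets by simp
qed

text \<open>Let \<open>z\<close> be the probability of the empty structure.  By exchangeability the probability of being empty
beyond \<open>m\<close> is at most the limit of the probabilities of being empty on \<open>{1..k}\<close>, which is \<open>z\<close>.  By dissociation,
\<open>z\<close> is at most the probability of being empty on \<open>{1..n}\<close> times \<open>z\<close>.  If \<open>z\<close> were positive, all the former
probabilities would be 1, and the law would be the point mass at the empty structure.\<close>

lemma dissociated_never_locally_empty:
  assumes W: "W \<in> E_space sig" "W \<noteq> zero_limit sig"
  shows "emeasure W {M \<in> structs sig {0<..}. \<forall>k. relabel {1..k} (\<lambda>i. m + i) M = zero_struct sig} = 0"
proof -
  have Wp: "W \<in> space (prob_algebra (LN_borel sig))" using W by (simp add: E_space_def)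
  then interpret prob_space W by (simp add: space_prob_algebra)
  have sets: "sets W = sets (LN_borel sig)" using Wp by (simp add: space_prob_algebra)
  then have space: "space W = structs sig {0<..}" by (metis sets_eq_imp_space_eq space_LN_borel)
  let ?\<Omega> = "structs sig {0<..}"
  define Vk where "Vk = (\<lambda>m k. {M \<in> ?\<Omega>. relabel {1..k} (\<lambda>i. m + i) M = zero_struct sig})"
  define V where "V = (\<lambda>m. {M \<in> ?\<Omega>. \<forall>k. relabel {1..k} (\<lambda>i. m + i) M = zero_struct sig})"
  define R where "R = (\<lambda>k. {M \<in> ?\<Omega>. restr {1..k} M = zero_struct sig})"
  have Vk: "Vk m k \<in> events" for m k
    unfolding Vk_def sets by (rule relabel_event_sets[where Q = "\<lambda>A. A = zero_struct sig"]) auto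
  have R: "R k \<in> events" for k unfolding R_def sets by (rule restr_event_sets)
  have V_eq: "V m = (\<Inter>k. Vk m k)" for m by (auto simp: V_def Vk_def)
  have V: "V m \<in> events" for m unfolding V_eq by (rule sets.countable_INT) (use Vk in auto)
  have Z: "{zero_struct sig} \<in> events" unfolding sets by (rule zero_struct_sets)
  have lim: "(\<lambda>k. prob (R k)) \<longlonglongrightarrow> prob {zero_struct sig}"
  proof -
    have "{zero_struct sig} = (\<Inter>k. R k)"
      using zero_struct_iff_restr[of _ sig] zero_in_structs[of sig "{0<..}"] unfolding R_def by blast
    moreover have "decseq R"
    proof (rule antimonoI)
      fix k n :: nat assume "k \<le> n"
      then show "R n \<subseteq> R k" unfolding R_def
        using restr_eq_mono[of n _ "zero_struct sig" k] by (auto simp: restr_eq_relabel)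
    qed
    ultimately show ?thesis using finite_Lim_measure_decseq[of R] R by auto
  qed
  have V_le: "prob (V m) \<le> prob {zero_struct sig}" for m
  proof (rule LIMSEQ_le_const[OF lim], intro exI allI impI)
    fix k :: nat
    have "prob (V m) \<le> prob (Vk m k)" by (rule finite_measure_mono) (use Vk in \<open>auto simp: V_def Vk_def\<close>)
    also have "emeasure W (Vk m k) = emeasure W (R k)"
      unfolding Vk_def R_def
      by (rule exchangeable_lawD[OF E_space_exchangeable[OF W(1)], where Q = "\<lambda>A. A = zero_struct sig"]) auto
    then have "prob (Vk m k) = prob (R k)" by (simp add: measure_def)
    finally show "prob (V m) \<le> prob (R k)" .
  qed
  have le_V: "prob {zero_struct sig} \<le> prob (R n) * prob (V n)" for n
  proof -
    have "indep_var (LN_borel sig) (restr {1..n}) (LN_borel sig) (restr {n<..})"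
    proof -
      have "\<forall>T T'. T \<subseteq> {0<..} \<and> T' \<subseteq> {0<..} \<and> T \<inter> T' = {} \<longrightarrow>
          indep_var (LN_borel sig) (restr T) (LN_borel sig) (restr T')"
        using W(1) unfolding E_space_def by blast
      then show ?thesis by (elim allE[of _ "{1..n}"] allE[of _ "{n<..}"] impE) auto
    qed
    from indep_varD[OF this, of "R n" "V n"] R V
    have "prob ((\<lambda>M. (restr {1..n} M, restr {n<..} M)) -` (R n \<times> V n) \<inter> space W) =
        prob (restr {1..n} -` R n \<inter> space W) * prob (restr {n<..} -` V n \<inter> space W)" by (simp add: sets)
    moreover have S: "restr T M \<in> ?\<Omega>" if "M \<in> ?\<Omega>" "T \<subseteq> {0<..}" for T M
      using structs_mono[OF that(2) relabel_in_structs[OF that(1), of T id]] by (simp add: restr_eq_relabel)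
    have "restr {1..n} -` R n \<inter> space W = R n"
      using S by (auto simp: R_def space restr_restr)
    moreover have "restr {n<..} -` V n \<inter> space W = V n"
    proof -
      have "relabel {1..k} (\<lambda>i. n + i) (restr {n<..} M) = relabel {1..k} (\<lambda>i. n + i) M" for k M
        by (rule relabel_restr) auto
      then show ?thesis using S[of _ "{n<..}"] by (auto simp: V_def space)
    qed
    ultimately have "prob ((\<lambda>M. (restr {1..n} M, restr {n<..} M)) -` (R n \<times> V n) \<inter> space W) = prob (R n) * prob (V n)"
      by simp
    moreover have "prob {zero_struct sig} \<le> prob ((\<lambda>M. (restr {1..n} M, restr {n<..} M)) -` (R n \<times> V n) \<inter> space W)"
    proof (rule finite_measure_mono)
      show "{zero_struct sig} \<subseteq> (\<lambda>M. (restr {1..n} M, restr {n<..} M)) -` (R n \<times> V n) \<inter> space W"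
        by (auto simp: R_def V_def space restr_eq_relabel)
      have "(\<lambda>M. (restr {1..n} M, restr {n<..} M)) -` (R n \<times> V n) \<inter> space W =
          (restr {1..n} -` R n \<inter> space W) \<inter> (restr {n<..} -` V n \<inter> space W)" by auto
      then show "(\<lambda>M. (restr {1..n} M, restr {n<..} M)) -` (R n \<times> V n) \<inter> space W \<in> events"
        using \<open>restr {1..n} -` R n \<inter> space W = R n\<close> \<open>restr {n<..} -` V n \<inter> space W = V n\<close> R V by simp
    qed
    ultimately show ?thesis by simp
  qed
  have key: "prob {zero_struct sig} \<le> prob (R n) * prob {zero_struct sig}" for n
    by (rule order.trans[OF le_V mult_left_mono[OF V_le measure_nonneg]])
  have "prob {zero_struct sig} = 0"
  proof (rule ccontr)
    assume "prob {zero_struct sig} \<noteq> 0"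
    then have pos: "prob {zero_struct sig} > 0" using measure_nonneg[of W "{zero_struct sig}"] by linarith
    have "prob (R n) = 1" for n
    proof -
      have "1 * prob {zero_struct sig} \<le> prob (R n) * prob {zero_struct sig}" using key[of n] by simp
      then have "1 \<le> prob (R n)" using pos by (rule mult_right_le_imp_le)
      then show ?thesis using prob_le_1[of "R n"] by linarith
    qed
    then have z1: "prob {zero_struct sig} = 1" using lim by (simp add: LIMSEQ_const_iff)
    have "W = zero_limit sig"
    proof (rule limit_eqI[OF Wp])
      show "zero_limit sig \<in> space (prob_algebra (LN_borel sig))"
        by (simp add: zero_limit_def space_prob_algebra prob_space_return)
      fix n A
      have C: "cyl sig n A \<in> events" using cyl_sets sets by simp
      show "prob (cyl sig n A) = measure (zero_limit sig) (cyl sig n A)"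
      proof (cases "zero_struct sig \<in> cyl sig n A")
        case True
        then have "1 \<le> prob (cyl sig n A)" using finite_measure_mono[of "{zero_struct sig}" "cyl sig n A"] C z1 by simp
        then show ?thesis using True prob_le_1[of "cyl sig n A"] by (simp add: zero_limit_def measure_return cyl_sets)
      next
        case False
        then have "prob (cyl sig n A) + prob {zero_struct sig} = prob (cyl sig n A \<union> {zero_struct sig})"
          using C Z by (intro finite_measure_Union[symmetric]) auto
        then have "prob (cyl sig n A) \<le> 0" using z1 prob_le_1[of "cyl sig n A \<union> {zero_struct sig}"] by linarith
        then show ?thesis using False measure_nonneg[of W "cyl sig n A"] by (simp add: zero_limit_def measure_return cyl_sets)
      qed
    qed
    with W(2) show False by contradiction
  qed
  then have "prob (V m) = 0" using V_le[of m] measure_nonneg[of W "V m"] by linarith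
  then show ?thesis using V[of m] by (simp add: emeasure_eq_measure V_def)
qed

lemma AE_not_zero_limit:
  assumes \<nu>: "sets \<nu> = sets (E_borel sig)" "emeasure \<nu> {zero_limit sig} = 0"
  shows "AE W in \<nu>. W \<in> E_space sig \<and> W \<noteq> zero_limit sig"
proof (cases "zero_limit sig \<in> E_space sig")
  case True
  interpret Metric_space "E_space sig" "limit_dist sig" by (rule Metric_space_limits)
  have "closedin mtopology {zero_limit sig}" using True by (intro closedin_t1_singleton t1_space_mtopology) simp
  then have op: "openin (E_top sig) (E_space sig - {zero_limit sig})" by (simp add: E_top_def closedin_def)
  have "E_space sig - {zero_limit sig} \<in> sets \<nu>"
    unfolding \<nu>(1) E_borel_def by (rule in_measure_of) (use op openin_subset[of "E_top sig"] in \<open>auto simp: E_top_def\<close>)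
  then have "space \<nu> - (E_space sig - {zero_limit sig}) \<in> sets \<nu>" by (rule sets.compl_sets)
  then have "{zero_limit sig} \<in> null_sets \<nu>" using \<nu>(2) True by (auto simp: space_E_borel[OF \<nu>(1)] Diff_Diff_Int)
  then show ?thesis by (rule AE_not_in[THEN AE_mp]) (auto simp: space_E_borel[OF \<nu>(1)])
next
  case False
  then show ?thesis by (auto simp: space_E_borel[OF \<nu>(1)])
qed

text \<open>Exchanging the labels \<open>{1..p}\<close> with labels beyond \<open>m\<close> turns the events into a decreasing sequence, whose
intersection requires emptiness beyond \<open>m\<close> and is therefore null.\<close>

lemma mixture_invisible_vanishes:
  assumes \<nu>: "sets \<nu> = sets (E_borel sig)" "emeasure \<nu> {zero_limit sig} = 0"
    and fin: "emeasure (mixture sig \<nu>) (visible sig m) < \<infinity>"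
  shows "(\<lambda>p. measure (mixture sig \<nu>) (invisible_hitting sig p m (\<lambda>i. p + i))) \<longlonglongrightarrow> 0"
proof -
  define G where "G = (\<lambda>p. {M \<in> structs sig {0<..}. relabel {1..p} (\<lambda>i. m + i) M = zero_struct sig \<and> restr {1..m} M \<noteq> zero_struct sig})"
  have R: "visible sig m \<in> sets (LN_borel sig)"
    by (rule restr_event_sets)
  have G: "G p \<in> sets (LN_borel sig)" for p
  proof -
    have "G p = {M \<in> structs sig {0<..}. relabel {1..p} (\<lambda>i. m + i) M = zero_struct sig} \<inter> visible sig m"
      by (auto simp: G_def)
    moreover have "{M \<in> structs sig {0<..}. relabel {1..p} (\<lambda>i. m + i) M = zero_struct sig} \<in> sets (LN_borel sig)"
      by (rule relabel_event_sets[where Q = "\<lambda>A. A = zero_struct sig"]) auto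
    ultimately show ?thesis using R by auto
  qed
  have Gfin: "emeasure (mixture sig \<nu>) (G p) < \<infinity>" for p
    by (rule le_less_trans[OF emeasure_mono fin]) (use R in \<open>auto simp: G_def\<close>)
  have "emeasure (mixture sig \<nu>) (invisible_hitting sig p m (\<lambda>i. p + i))
      = emeasure (mixture sig \<nu>) (G p)" for p
  proof -
    define F where "F = {1..p + m}"
    define \<xi> where "\<xi> = (\<lambda>i. if i \<le> p then m + i else i - p)"
    define Q where "Q = (\<lambda>A. restr {1..p} A = zero_struct sig \<and> relabel {1..m} (\<lambda>i. p + i) A \<noteq> zero_struct sig)"
    have "inj_on \<xi> F" by (auto simp: inj_on_def \<xi>_def F_def)
    moreover have "\<xi> ` F \<subseteq> {0<..}" by (auto simp: \<xi>_def F_def)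
    moreover have "finite F" "F \<subseteq> {0<..}" by (auto simp: F_def)
    ultimately have "emeasure (mixture sig \<nu>) {M \<in> structs sig {0<..}. Q (relabel F \<xi> M)} =
        emeasure (mixture sig \<nu>) {M \<in> structs sig {0<..}. Q (restr F M)}"
      by (intro exchangeable_lawD[OF mixture_exchangeable[OF \<nu>(1)]])
    moreover have "restr {1..p} (relabel F \<xi> M) = relabel {1..p} (\<lambda>i. m + i) M" for M
      unfolding restr_eq_relabel by (subst relabel_relabel) (auto simp: F_def \<xi>_def intro!: relabel_cong)
    moreover have "relabel {1..m} (\<lambda>i. p + i) (relabel F \<xi> M) = restr {1..m} M" for M
      unfolding restr_eq_relabel by (subst relabel_relabel) (auto simp: F_def \<xi>_def intro!: relabel_cong)
    moreover have "restr {1..p} (restr F M) = restr {1..p} M" for M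
      unfolding restr_eq_relabel[of "{1..p}"] by (rule relabel_restr) (auto simp: F_def)
    moreover have "relabel {1..m} (\<lambda>i. p + i) (restr F M) = relabel {1..m} (\<lambda>i. p + i) M" for M
      by (rule relabel_restr) (auto simp: F_def)
    ultimately show ?thesis by (simp add: Q_def G_def)
  qed
  then have eq: "measure (mixture sig \<nu>) (invisible_hitting sig p m (\<lambda>i. p + i))
      = measure (mixture sig \<nu>) (G p)" for p by (simp add: measure_def)
  have "decseq G"
  proof (rule antimonoI)
    fix k n :: nat assume kn: "k \<le> n"
    have "relabel {1..k} (\<lambda>i. m + i) M = zero_struct sig"
      if "relabel {1..n} (\<lambda>i. m + i) M = zero_struct sig" for M
      using restr_relabel[of "{1..k}" "{1..n}" "\<lambda>i. m + i" M] kn that by (simp add: restr_eq_relabel Int_absorb2)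
    then show "G n \<subseteq> G k" by (auto simp: G_def)
  qed
  moreover have "range G \<subseteq> sets (mixture sig \<nu>)" using G by auto
  moreover have "emeasure (mixture sig \<nu>) (G p) \<noteq> \<infinity>" for p using Gfin[of p] by auto
  ultimately have "(\<lambda>p. emeasure (mixture sig \<nu>) (G p)) \<longlonglongrightarrow> emeasure (mixture sig \<nu>) (\<Inter>p. G p)"
    by (intro Lim_emeasure_decseq)
  moreover have "emeasure (mixture sig \<nu>) (\<Inter>p. G p) = 0"
  proof (rule mixture_null, rule AE_mp[OF AE_not_zero_limit[OF \<nu>]], rule AE_I2, rule impI)
    fix W assume W: "W \<in> E_space sig \<and> W \<noteq> zero_limit sig"
    let ?V = "{M \<in> structs sig {0<..}. \<forall>k. relabel {1..k} (\<lambda>i. m + i) M = zero_struct sig}"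
    have "?V = (\<Inter>k. {M \<in> structs sig {0<..}. relabel {1..k} (\<lambda>i. m + i) M = zero_struct sig})" by auto
    also have "\<dots> \<in> sets (LN_borel sig)"
      by (rule sets.countable_INT, clarsimp, rule relabel_event_sets[where Q = "\<lambda>A. A = zero_struct sig"]) auto
    finally have "?V \<in> sets W" using W by (simp add: E_space_def space_prob_algebra)
    then have "emeasure W (\<Inter>p. G p) \<le> emeasure W ?V" by (intro emeasure_mono) (auto simp: G_def)
    then show "emeasure W (\<Inter>p. G p) = 0" using dissociated_never_locally_empty[of W sig m] W by simp
  qed
  ultimately have "(\<lambda>p. enn2real (emeasure (mixture sig \<nu>) (G p))) \<longlonglongrightarrow> enn2real 0"
    by (intro tendsto_enn2real) auto
  then show ?thesis unfolding eq by (simp add: measure_def)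
qed

section \<open>The remaining jump measures\<close>

lemma finite_int_partitions: "finite (int_partitions q)"
proof (rule finite_subset)
  show "int_partitions q \<subseteq> {l. set l \<subseteq> {..q} \<and> length l \<le> q}"
  proof
    fix l assume "l \<in> int_partitions q"
    then have l: "0 \<notin> set l" "sum_list l = q" by (auto simp: int_partitions_def)
    have "length l \<le> sum_list l" using l(1) by (induction l) auto
    moreover have "set l \<subseteq> {..q}" using member_le_sum_list[of _ l] l(2) by auto
    ultimately show "l \<in> {l. set l \<subseteq> {..q} \<and> length l \<le> q}" using l by auto
  qed
  show "finite {l. set l \<subseteq> {..q} \<and> length l \<le> q}" by (rule finite_lists_length_le) simp
qed

text \<open>Consequently the label 1 occurs in every tuple of a structure that coincides with its substructure for
this multiset.\<close>

lemma label_1_in_canon_mset: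
  assumes "l \<in> int_partitions q" "q \<ge> 1" shows "1 \<in># canon_mset l"
proof -
  have "l \<noteq> []" using assms by (auto simp: int_partitions_def)
  moreover from this have "l ! 0 \<noteq> 0" using assms(1) by (auto simp: int_partitions_def in_set_conv_nth)
  ultimately have "0 \<in> {..<length l}" "1 \<in># replicate_mset (l ! 0) (Suc 0)" by auto
  then show ?thesis unfolding canon_mset_def set_mset_sum[OF finite_lessThan] by blast
qed

text \<open>Stated for every set \<open>B\<close>: a set that is not measurable has measure 0 by convention.\<close>

lemma symmetrized_null:
  assumes "\<And>s. s \<in> label_multisets \<Longrightarrow> mult_partition s = l \<Longrightarrow>
    emeasure m {M \<in> structs sig {0<..}. relabel {0<..} (inv_into {0<..} (\<tau> s)) M \<in> B} = 0"
  shows "emeasure (symmetrized sig \<tau> l m) B = 0"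
proof -
  have "(\<integral>\<^sup>+s. emeasure m {M \<in> structs sig {0<..}. relabel {0<..} (inv_into {0<..} (\<tau> s)) M \<in> B}
        \<partial>count_space {s \<in> label_multisets. mult_partition s = l}) =
      (\<integral>\<^sup>+s. 0 \<partial>count_space {s \<in> label_multisets. mult_partition s = l})"
    by (rule nn_integral_cong) (use assms in auto)
  then show ?thesis unfolding symmetrized_def emeasure_measure_of_sets by simp
qed

lemma substruct_tuple_label:
  assumes "substruct s M = M" "x \<in># s" "R \<in> set M" "a \<in> R" shows "x \<in> set a"
proof -
  define keep where "keep = (\<lambda>a. length a \<le> size s \<and> mset a \<subseteq># s \<and> set a = set_mset s \<or> length a > size s \<and> s \<subseteq># mset a)"
  obtain j where j: "j < length M" "R = M ! j" using assms(3) by (auto simp: in_set_conv_nth)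
  have "substruct s M ! j = {a \<in> M ! j. keep a}" using j by (simp add: substruct_def keep_def)
  then have "keep a" using assms(1,4) j by auto
  then show ?thesis using assms(2) unfolding keep_def by (auto dest: mset_subset_eqD)
qed

text \<open>For \<open>m\<close>-almost every structure, all tuples contain the label 1; after relabelling they all
contain \<open>\<tau> s 1\<close>.  A map that reads a nonempty structure must have this label in its range.\<close>

lemma symmetrized_hits_not_disjoint:
  assumes sub: "AE M in m. substruct (canon_mset l) M = M" and m: "sets m = sets (LN_borel sig)"
    and l: "l \<in> int_partitions q" "q \<ge> 1" and \<tau>: "\<And>s. s \<in> label_multisets \<Longrightarrow> \<tau> s \<in> LN_perms"
    and \<phi>: "\<phi> ` I \<subseteq> {0<..}" "\<phi>' ` I \<subseteq> {0<..}" "\<phi> ` I \<inter> \<phi>' ` I = {}"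
  shows "emeasure (symmetrized sig \<tau> l m)
    {M \<in> structs sig {0<..}. relabel I \<phi> M \<noteq> zero_struct sig \<and> relabel I \<phi>' M \<noteq> zero_struct sig} = 0"
    (is "emeasure _ ?B = 0")
proof (rule symmetrized_null)
  fix s assume s: "s \<in> label_multisets"
  define \<rho> where "\<rho> = inv_into {0<..} (\<tau> s)"
  have bij: "bij_betw (\<tau> s) {0<..} {0<..}" using \<tau>[OF s] by (simp add: LN_perms_def)
  let ?S = "{M \<in> structs sig {0<..}. relabel {0<..} \<rho> M \<in> ?B}"
  have hit: "\<tau> s 1 \<in> \<psi> ` I"
    if M: "M \<in> structs sig {0<..}" "substruct (canon_mset l) M = M" and \<psi>: "\<psi> ` I \<subseteq> {0<..}"
      and h: "relabel I \<psi> (relabel {0<..} \<rho> M) \<noteq> zero_struct sig" for M \<psi>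
  proof -
    have "relabel I \<psi> (relabel {0<..} \<rho> M) = relabel I (\<rho> \<circ> \<psi>) M" by (rule relabel_relabel[OF \<psi>])
    with h obtain R a where a: "R \<in> set M" "set a \<subseteq> I" "map (\<rho> \<circ> \<psi>) a \<in> R"
      using relabel_eq_zero_iff[OF structs_length[OF M(1)]] by metis
    then have "1 \<in> set (map (\<rho> \<circ> \<psi>) a)" using substruct_tuple_label[OF M(2) label_1_in_canon_mset[OF l]] by blast
    then obtain x where x: "x \<in> I" "\<rho> (\<psi> x) = 1" using a(2) by auto
    have "\<psi> x \<in> \<tau> s ` {0<..}" using x \<psi> bij by (auto simp: bij_betw_def)
    then have "\<tau> s 1 = \<psi> x" using x(2) f_inv_into_f[of "\<psi> x" "\<tau> s" "{0<..}"] by (simp add: \<rho>_def)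
    then show ?thesis using x by auto
  qed
  have "AE M in m. M \<notin> ?S"
    using sub
  proof (rule AE_mp, intro AE_I2 impI notI)
    fix M assume M: "substruct (canon_mset l) M = M" "M \<in> ?S"
    then have "\<tau> s 1 \<in> \<phi> ` I" "\<tau> s 1 \<in> \<phi>' ` I" using hit[of M \<phi>] hit[of M \<phi>'] \<phi> by auto
    then show False using \<phi>(3) by blast
  qed
  then obtain N where N: "{M \<in> space m. \<not> M \<notin> ?S} \<subseteq> N" "emeasure m N = 0" "N \<in> sets m" by (rule AE_E)
  have "space m = structs sig {0<..}" using sets_eq_imp_space_eq[OF m] by simp
  then have "?S \<subseteq> N" using N(1) by auto
  then have "emeasure m ?S \<le> emeasure m N" using N(3) by (rule emeasure_mono)
  then show "emeasure m {M \<in> structs sig {0<..}. relabel {0<..} (inv_into {0<..} (\<tau> s)) M \<in> ?B} = 0"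
    using N(2) by (simp add: \<rho>_def)
qed

lemma
  assumes dec: "rate_decomposition sig \<tau> \<mu> \<nu> m"
  shows mixture_le_rate: "B \<in> sets (LN_borel sig) \<Longrightarrow> emeasure (mixture sig \<nu>) B \<le> emeasure \<mu> B"
    and symmetrized_le_rate: "l \<in> jump_partitions sig \<Longrightarrow> B \<in> sets (LN_borel sig) \<Longrightarrow>
      emeasure (symmetrized sig \<tau> l (m l)) B \<le> emeasure \<mu> B"
proof -
  have eq: "emeasure \<mu> B = emeasure (mixture sig \<nu>) B +
        (\<Sum>q\<in>{1..last sig}. \<Sum>l\<in>int_partitions q. emeasure (symmetrized sig \<tau> l (m l)) B)"
    if "B \<in> sets (LN_borel sig)" for B
    using dec that unfolding rate_decomposition_def by blast
  show "emeasure (mixture sig \<nu>) B \<le> emeasure \<mu> B" if "B \<in> sets (LN_borel sig)" 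
    unfolding eq[OF that] by simp
  show "emeasure (symmetrized sig \<tau> l (m l)) B \<le> emeasure \<mu> B"
    if l: "l \<in> jump_partitions sig" and B: "B \<in> sets (LN_borel sig)"
  proof -
    obtain q where q: "q \<in> {1..last sig}" "l \<in> int_partitions q" using l by (auto simp: jump_partitions_def)
    let ?f = "\<lambda>l. emeasure (symmetrized sig \<tau> l (m l)) B"
    have "?f l \<le> (\<Sum>l\<in>int_partitions q. ?f l)"
      by (rule member_le_sum[OF q(2)]) (auto simp: finite_int_partitions)
    also have "\<dots> \<le> (\<Sum>q\<in>{1..last sig}. \<Sum>l\<in>int_partitions q. ?f l)"
      by (rule member_le_sum[OF q(1), of "\<lambda>q. \<Sum>l\<in>int_partitions q. ?f l"]) auto
    also have "\<dots> \<le> emeasure \<mu> B" unfolding eq[OF B] by simp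
    finally show ?thesis .
  qed
qed

text \<open>A structure is empty or visible on some \<open>{1..n}\<close>, and both events have finite measure.\<close>

lemma sigma_finite_below_rate:
  assumes \<mu>: "finite_off_zero sig \<mu>" and \<nu>: "sets \<nu> = sets (LN_borel sig)"
    and le: "\<And>B. B \<in> sets (LN_borel sig) \<Longrightarrow> emeasure \<nu> B \<le> emeasure \<mu> B"
  shows "sigma_finite_measure \<nu>"
proof
  define R where "R = (\<lambda>n. visible sig n)"
  define A where "A = insert {zero_struct sig} (range R)"
  have R: "R n \<in> sets (LN_borel sig)" for n unfolding R_def by (rule restr_event_sets)
  have "\<Union>A = space \<nu>"
    using zero_struct_iff_restr[of _ sig] zero_in_structs[of sig "{0<..}"] sets_eq_imp_space_eq[OF \<nu>]
    by (auto simp: A_def R_def)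
  moreover have "countable A" by (simp add: A_def)
  moreover have "A \<subseteq> sets \<nu>" using R zero_struct_sets[of sig] \<nu> by (auto simp: A_def)
  moreover have "emeasure \<nu> a \<noteq> \<infinity>" if "a \<in> A" for a
  proof -
    have f: "emeasure \<mu> a < \<infinity>" using that \<mu> unfolding A_def R_def finite_off_zero_def by auto
    have a: "a \<in> sets (LN_borel sig)" using that R zero_struct_sets[of sig] by (auto simp: A_def)
    have "emeasure \<nu> a < \<infinity>" by (rule le_less_trans[OF le[OF a] f])
    then show ?thesis by simp
  qed
  ultimately show "\<exists>A. countable A \<and> A \<subseteq> sets \<nu> \<and> \<Union>A = space \<nu> \<and> (\<forall>a\<in>A. emeasure \<nu> a \<noteq> \<infinity>)"
    by (intro exI[of _ A] conjI ballI)
qed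

lemma relabel_nonzero_visible:
  assumes "\<phi> ` {1..m} \<subseteq> {0<..}"
  obtains n where "hitting sig m \<phi> \<subseteq> visible sig n"
proof
  define n where "n = Max (insert 0 (\<phi> ` {1..m}))"
  have sub: "\<phi> ` {1..m} \<subseteq> {1..n}" unfolding n_def using assms by (intro finite_subset_atLeast1) auto
  have "relabel {1..m} \<phi> M = zero_struct sig" if "restr {1..n} M = zero_struct sig" for M
    using relabel_restr[OF sub, of M] that by simp
  then show "hitting sig m \<phi> \<subseteq> visible sig n" by auto
qed

lemma finite_rate_of_hits:
  assumes \<mu>: "finite_off_zero sig \<mu>" and \<phi>: "\<phi> ` {1..m} \<subseteq> {0<..}"
  shows "emeasure \<mu> (hitting sig m \<phi>) < \<infinity>"
proof -
  obtain n where n: "hitting sig m \<phi> \<subseteq> visible sig n" using relabel_nonzero_visible[OF \<phi>] by blast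
  have "sets \<mu> = sets (LN_borel sig)" using \<mu> by (simp add: finite_off_zero_def)
  then have "visible sig n \<in> sets \<mu>"
    using restr_event_sets[of sig "\<lambda>A. A \<noteq> zero_struct sig" n] by simp
  then have "emeasure \<mu> (hitting sig m \<phi>) \<le>
      emeasure \<mu> (visible sig n)"
    using n by (intro emeasure_mono)
  also have "\<dots> < \<infinity>" using \<mu> by (simp add: finite_off_zero_def)
  finally show ?thesis .
qed

text \<open>The event that \<open>\<phi>\<close> reads a nonempty structure is open and closed in a compact space and excludes the empty
structure, so its indicator is an admissible test function.  The rate is thus the limit of \<open>1 / t\<close> times
the probability that \<open>X t\<close> lies in the event, which does not depend on the injection \<open>\<phi>\<close>.\<close>

lemma rate_of_hits_exchangeable:
  assumes rate: "rate_measure P sig X \<mu>" and X: "\<And>t. 0 \<le> t \<Longrightarrow> X t \<in> measurable P (LN_borel sig)"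
    and ex: "exchangeable_process P sig X"
    and \<phi>: "inj_on \<phi> {1..m}" "\<phi> ` {1..m} \<subseteq> {0<..}"
  shows "measure \<mu> (hitting sig m \<phi>) =
    measure \<mu> (visible sig m)"
proof -
  define S where "S = (\<lambda>\<phi>. hitting sig m \<phi>)"
  have \<mu>: "finite_off_zero sig \<mu>" using rate by (simp add: rate_measure_def)
  have S: "S \<phi> \<in> sets (LN_borel sig)" if "\<phi> ` {1..m} \<subseteq> {0<..}" for \<phi>
    unfolding S_def by (rule relabel_event_sets[where Q = "\<lambda>A. A \<noteq> zero_struct sig"]) (use that in auto)
  have lim: "((\<lambda>t. (1 / t) * measure (distr P (LN_borel sig) (X t)) (S \<phi>)) \<longlongrightarrow> measure \<mu> (S \<phi>)) (at_right 0)"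
    if \<phi>: "\<phi> ` {1..m} \<subseteq> {0<..}" for \<phi>
  proof -
    define Y where "Y = subtopology (LN_top sig) (structs sig {0<..} - {zero_struct sig})"
    have top: "topspace Y = structs sig {0<..} - {zero_struct sig}" by (auto simp: Y_def topspace_subtopology)
    have sub: "S \<phi> \<subseteq> structs sig {0<..} - {zero_struct sig}" by (auto simp: S_def)
    have op: "openin (LN_top sig) (S \<phi>)" and cl: "closedin (LN_top sig) (S \<phi>)"
      unfolding S_def using \<phi> open_relabel_event[of "{1..m}" \<phi> sig "\<lambda>A. A \<noteq> zero_struct sig"]
        closed_relabel_event[of "{1..m}" \<phi> sig "\<lambda>A. A \<noteq> zero_struct sig"] by auto
    have "openin Y (S \<phi>)"
      unfolding Y_def openin_subtopology using op sub by (intro exI[of _ "S \<phi>"]) auto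
    moreover have "openin Y (topspace Y - S \<phi>)"
      unfolding top unfolding Y_def openin_subtopology
      using cl by (intro exI[of _ "structs sig {0<..} - S \<phi>"]) (auto simp: closedin_def)
    ultimately have opY: "openin Y (S \<phi>)" "openin Y (topspace Y - S \<phi>)" .
    define f where "f = (indicator (S \<phi>) :: rel_struct \<Rightarrow> real)"
    have "continuous_map Y euclidean f"
      unfolding continuous_map_def
    proof (intro conjI allI impI)
      fix U :: "real set"
      have "{x \<in> topspace Y. f x \<in> U} = (if 1 \<in> U then S \<phi> else {}) \<union> (if 0 \<in> U then topspace Y - S \<phi> else {})"
        using sub by (auto simp: f_def indicator_def top)
      then show "openin Y {x \<in> topspace Y. f x \<in> U}" using opY by auto
    qed simp
    moreover have "compactin Y (S \<phi>)"
      unfolding Y_def compactin_subtopology using sub closedin_compact_space[OF compact_LN_top cl] by simp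
    ultimately have "((\<lambda>t. (1 / t) * (\<integral>\<omega>. f (X t \<omega>) \<partial>P)) \<longlongrightarrow> (\<integral>M. f M \<partial>\<mu>)) (at_right 0)"
      unfolding Y_def
      by (intro rate[unfolded rate_measure_def Let_def, THEN conjunct2, THEN spec[of _ f],
            THEN spec[of _ "S \<phi>"], THEN mp] conjI) (auto simp: f_def)
    moreover have "(\<integral>M. f M \<partial>\<mu>) = measure \<mu> (S \<phi>)"
      using S[OF \<phi>] \<mu> by (auto simp: f_def finite_off_zero_def)
    moreover have "(\<integral>\<omega>. f (X t \<omega>) \<partial>P) = measure (distr P (LN_borel sig) (X t)) (S \<phi>)" if "0 < t" for t
    proof -
      have Xt: "X t \<in> measurable P (LN_borel sig)" using X that by simp
      have "(\<integral>\<omega>. f (X t \<omega>) \<partial>P) = (\<integral>M. f M \<partial>distr P (LN_borel sig) (X t))"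
        by (rule integral_distr[symmetric, OF Xt]) (use S[OF \<phi>] in \<open>simp add: f_def\<close>)
      moreover have "S \<phi> \<inter> structs sig {0<..} = S \<phi>" by (auto simp: S_def)
      ultimately show ?thesis using S[OF \<phi>] by (simp add: f_def)
    qed
    then have "\<forall>\<^sub>F t in at_right 0. (1 / t) * (\<integral>\<omega>. f (X t \<omega>) \<partial>P) = (1 / t) * measure (distr P (LN_borel sig) (X t)) (S \<phi>)"
      by (auto simp: eventually_at_filter)
    ultimately show ?thesis by (auto intro: Lim_transform_eventually)
  qed
  have "((\<lambda>t. (1 / t) * measure (distr P (LN_borel sig) (X t)) (S id)) \<longlongrightarrow> measure \<mu> (S \<phi>)) (at_right 0)"
  proof (rule Lim_transform_eventually[OF lim[OF \<phi>(2)]])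
    have "measure (distr P (LN_borel sig) (X t)) (S \<phi>) = measure (distr P (LN_borel sig) (X t)) (S id)" if "0 < t" for t
    proof -
      have e: "exchangeable_law sig (distr P (LN_borel sig) (X t))"
        by (rule exchangeable_process_marginal[OF ex]) (use X that in auto)
      have "emeasure (distr P (LN_borel sig) (X t)) (S \<phi>) = emeasure (distr P (LN_borel sig) (X t)) (S id)"
        unfolding S_def restr_eq_relabel[symmetric]
        by (rule exchangeable_lawD[OF e, where Q = "\<lambda>A. A \<noteq> zero_struct sig"]) (use \<phi> in auto)
      then show ?thesis by (simp add: measure_def)
    qed
    then show "\<forall>\<^sub>F t in at_right 0. (1 / t) * measure (distr P (LN_borel sig) (X t)) (S \<phi>) = (1 / t) * measure (distr P (LN_borel sig) (X t)) (S id)"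
      by (auto simp: eventually_at_filter)
  qed
  then have "measure \<mu> (S \<phi>) = measure \<mu> (S id)"
    by (rule tendsto_unique[rotated]) (use lim[of id] in auto)
  then show ?thesis by (simp add: S_def restr_eq_relabel)
qed

section \<open>Limits along a path\<close>

lemma convergent_if_approximable:
  fixes a :: "nat \<Rightarrow> real"
  assumes "\<And>e. e > 0 \<Longrightarrow> \<exists>b. convergent b \<and> (\<forall>\<^sub>F N in sequentially. \<bar>a N - b N\<bar> \<le> e)"
  shows "convergent a"
proof -
  have "Cauchy a"
  proof (rule CauchyI')
    fix e :: real assume e: "0 < e"
    then obtain b where b: "convergent b" "\<forall>\<^sub>F N in sequentially. \<bar>a N - b N\<bar> \<le> e / 4"
      using assms[of "e / 4"] by auto
    obtain N\<^sub>1 where N1: "\<And>N. N \<ge> N\<^sub>1 \<Longrightarrow> \<bar>a N - b N\<bar> \<le> e / 4" using b(2) unfolding eventually_sequentially by blast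
    have "Cauchy b" using b(1) by (rule convergent_Cauchy)
    then obtain N\<^sub>2 where N2: "\<And>k n. k \<ge> N\<^sub>2 \<Longrightarrow> n \<ge> N\<^sub>2 \<Longrightarrow> norm (b k - b n) < e / 4"
      using CauchyD[of b "e / 4"] e by auto
    have "dist (a k) (a n) < e" if "k \<ge> max N\<^sub>1 N\<^sub>2" "n > k" for k n
    proof -
      have "\<bar>a k - b k\<bar> \<le> e / 4" "\<bar>a n - b n\<bar> \<le> e / 4" "\<bar>b k - b n\<bar> < e / 4"
        using N1[of k] N1[of n] N2[of k n] that by auto
      then show ?thesis unfolding dist_real_def using e by linarith
    qed
    then show "\<exists>M. \<forall>m\<ge>M. \<forall>n>m. dist (a m) (a n) < e" by blast
  qed
  then show ?thesis by (rule Cauchy_convergent)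
qed

text \<open>One realization of the process for which the exceptional events have been excluded: \<open>A\<^sub>0\<close> and \<open>A l\<close> are the atoms
of the driving processes, \<open>invisible\<close> and \<open>small\<close> bound the proportions of maps that they hit, and \<open>rational\<close>
gives the limits at rational times.  All further arguments are deterministic.\<close>

locale driven_path =
  fixes sig :: signature and x :: "real \<Rightarrow> rel_struct"
    and A\<^sub>0 :: "(real \<times> rel_struct) set" and L :: "nat list set" and A :: "nat list \<Rightarrow> (real \<times> rel_struct) set"
    and C :: "nat \<Rightarrow> real"
  assumes x: "\<And>t. 0 \<le> t \<Longrightarrow> x t \<in> structs sig {0<..}"
    and path: "canonical_path sig (A\<^sub>0 \<union> (\<Union>l\<in>L. A l)) x"
    and L: "finite L"
    and A\<^sub>0: "A\<^sub>0 \<subseteq> {0..} \<times> structs sig {0<..}" and A: "\<And>l. l \<in> L \<Longrightarrow> A l \<subseteq> {0..} \<times> structs sig {0<..}"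
    and fin\<^sub>0: "\<And>T n. finite (A\<^sub>0 \<inter> {0..real T} \<times> visible sig n)"
    and fin: "\<And>l T n. l \<in> L \<Longrightarrow> finite (A l \<inter> {0..real T} \<times> visible sig n)"
    and rational: "\<And>r m B. r \<in> \<rat> \<Longrightarrow> 0 \<le> r \<Longrightarrow> B \<in> structs sig {1..m} \<Longrightarrow> convergent (sampling_density m B (x r))"
    and invisible: "\<And>m T e. 0 < e \<Longrightarrow> \<exists>p. \<forall>\<^sub>F N in sequentially. invisible_hit_share sig p m N A\<^sub>0 (real T) \<le> e"
    and small: "\<And>m l q q' e. l \<in> L \<Longrightarrow> q \<in> \<rat> \<Longrightarrow> q' \<in> \<rat> \<Longrightarrow> 0 \<le> q \<Longrightarrow> q \<le> q' \<Longrightarrow> 0 < e \<Longrightarrow>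
       \<forall>\<^sub>F N in sequentially. hit_share sig m N (A l) {q<..q'} \<le> C m * (q' - q) + e"
    and C: "\<And>m. 0 \<le> C m"
begin

definition visible_times :: "nat \<Rightarrow> nat \<Rightarrow> real set" where
  "visible_times p T = fst ` (A\<^sub>0 \<inter> {0..real T} \<times> visible sig p)"

lemma finite_visible_times: "finite (visible_times p T)"
  unfolding visible_times_def using fin\<^sub>0 by (rule finite_imageI)

definition steady :: "nat \<Rightarrow> nat \<Rightarrow> nat \<Rightarrow> real \<Rightarrow> real \<Rightarrow> bool" where
  "steady m T p d e \<longleftrightarrow> (\<forall>s t B. 0 \<le> s \<longrightarrow> s \<le> t \<longrightarrow> t \<le> real T \<longrightarrow> t - s < d \<longrightarrow>
    visible_times p T \<inter> {s<..t} = {} \<longrightarrow>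
    (\<forall>\<^sub>F N in sequentially. \<bar>sampling_density m B (x t) N - sampling_density m B (x s) N\<bar> \<le> e))"

lemma steadyD:
  assumes "steady m T p d e" "0 \<le> s" "s \<le> t" "t \<le> real T" "t - s < d" "visible_times p T \<inter> {s<..t} = {}"
  shows "\<forall>\<^sub>F N in sequentially. \<bar>sampling_density m B (x t) N - sampling_density m B (x s) N\<bar> \<le> e"
  using assms unfolding steady_def by blast

text \<open>A map whose reading changes over \<open>(s, t]\<close> is hit either by an atom of \<open>A\<^sub>0\<close> that is invisible on \<open>{1..p}\<close> or by
an atom of some \<open>A l\<close>.  A large \<open>p\<close> makes the first proportion at most \<open>e / 2\<close>, and a small \<open>d\<close> does the same for the
second.\<close>

lemma steady_exists:
  assumes e: "0 < e"
  shows "\<exists>p d. 0 < d \<and> steady m T p d e"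
proof -
  obtain p where p: "\<forall>\<^sub>F N in sequentially. invisible_hit_share sig p m N A\<^sub>0 (real T) \<le> e / 2"
    using invisible[of "e / 2"] e by auto
  define k where "k = real (card L) + 1"
  define d where "d = e / (12 * k * (C m + 1))"
  define e' where "e' = e / (4 * k)"
  have k: "k \<ge> 1" by (simp add: k_def)
  have d: "0 < d" and e': "0 < e'" using e k C[of m] by (auto simp: d_def e'_def)
  have "steady m T p d e"
    unfolding steady_def
  proof (intro allI impI)
    fix s t B assume st: "0 \<le> s" "s \<le> t" "t \<le> real T" "t - s < d" and vis: "visible_times p T \<inter> {s<..t} = {}"
    \<comment> \<open>A rational interval of length at most \<open>3 * d\<close> that contains \<open>(s, t]\<close>.\<close>
    obtain q where q: "q \<in> \<rat>" "0 \<le> q" "q \<le> s" "s - d \<le> q"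
    proof (cases "s = 0")
      case True then show ?thesis using d by (intro that[of 0]) auto
    next
      case False
      then have "max 0 (s - d) < s" using st d by auto
      from Rats_dense_in_real[OF this] show ?thesis by (auto intro: that)
    qed
    obtain q' where q': "q' \<in> \<rat>" "t \<le> q'" "q' \<le> t + d"
      using Rats_dense_in_real[of t "t + d"] d by auto
    have qq: "q \<le> q'" "q' - q \<le> 3 * d" using q q' st by auto
    define h\<^sub>0 where "h\<^sub>0 = (\<lambda>\<phi>. of_bool (A\<^sub>0 \<inter> {0..real T} \<times>
       (invisible_hitting sig p m \<phi>) \<noteq> {}) :: real)"
    define h where "h = (\<lambda>l \<phi>. of_bool (A l \<inter> {q<..q'} \<times> hitting sig m \<phi> \<noteq> {}) :: real)"
    have diff: "\<bar>of_bool (relabel {1..m} \<phi> (x t) = B) - of_bool (relabel {1..m} \<phi> (x s) = B)\<bar> \<le> h\<^sub>0 \<phi> + (\<Sum>l\<in>L. h l \<phi>)"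
      if \<phi>: "\<phi> \<in> {1..m} \<rightarrow>\<^sub>E {1..N}" for \<phi> N
    proof (cases "relabel {1..m} \<phi> (x t) = relabel {1..m} \<phi> (x s)")
      case True then show ?thesis by (auto simp: h\<^sub>0_def h_def intro!: add_nonneg_nonneg sum_nonneg)
    next
      case False
      have "\<exists>u M. (u, M) \<in> A\<^sub>0 \<union> (\<Union>l\<in>L. A l) \<and> s < u \<and> u \<le> t \<and> relabel {1..m} \<phi> M \<noteq> zero_struct sig"
      proof (rule ccontr)
        assume neg: "\<not> ?thesis"
        have "relabel {1..m} \<phi> (x t) = relabel {1..m} \<phi> (x s)"
        proof (rule path_changes_only_at_hits[OF path x])
          show "M \<in> structs sig {0<..}" if "(u, M) \<in> A\<^sub>0 \<union> (\<Union>l\<in>L. A l)" for u M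
            using that A\<^sub>0 A by blast
          define V where "V = {0..real T} \<times> visible sig N"
          have "{u \<in> {s<..t}. \<exists>M. (u, M) \<in> A\<^sub>0 \<union> (\<Union>l\<in>L. A l) \<and> restr {1..N} M \<noteq> zero_struct sig} \<subseteq>
              fst ` ((A\<^sub>0 \<inter> V) \<union> (\<Union>l\<in>L. A l \<inter> V))"
          proof
            fix u assume "u \<in> {u \<in> {s<..t}. \<exists>M. (u, M) \<in> A\<^sub>0 \<union> (\<Union>l\<in>L. A l) \<and> restr {1..N} M \<noteq> zero_struct sig}"
            then obtain M where u: "s < u" "u \<le> t" and M: "(u, M) \<in> A\<^sub>0 \<union> (\<Union>l\<in>L. A l)" "restr {1..N} M \<noteq> zero_struct sig" by auto
            have "M \<in> structs sig {0<..}" using M(1) A\<^sub>0 A by blast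
            then have "(u, M) \<in> V" using u M(2) st by (auto simp: V_def)
            then have "(u, M) \<in> (A\<^sub>0 \<inter> V) \<union> (\<Union>l\<in>L. A l \<inter> V)" using M(1) by blast
            then show "u \<in> fst ` ((A\<^sub>0 \<inter> V) \<union> (\<Union>l\<in>L. A l \<inter> V))" by (rule rev_image_eqI) simp
          qed
          moreover have "finite ((A\<^sub>0 \<inter> V) \<union> (\<Union>l\<in>L. A l \<inter> V))" unfolding V_def by (intro finite_UnI finite_UN_I fin\<^sub>0 fin L)
          ultimately show "finite {u \<in> {s<..t}. \<exists>M. (u, M) \<in> A\<^sub>0 \<union> (\<Union>l\<in>L. A l) \<and> restr {1..N} M \<noteq> zero_struct sig}"
            by (rule finite_subset[OF _ finite_imageI])
          show "\<phi> ` {1..m} \<subseteq> {1..N}" using \<phi> by (auto simp: PiE_iff)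
          show "relabel {1..m} \<phi> M = zero_struct sig" if "(u, M) \<in> A\<^sub>0 \<union> (\<Union>l\<in>L. A l)" "s < u" "u \<le> t" for u M
            using neg that by blast
        qed (use st in auto)
        with False show False by contradiction
      qed
      then obtain u M where M: "(u, M) \<in> A\<^sub>0 \<union> (\<Union>l\<in>L. A l)" and u: "s < u" "u \<le> t"
        and nz: "relabel {1..m} \<phi> M \<noteq> zero_struct sig" by blast
      have MS: "M \<in> structs sig {0<..}" using M A\<^sub>0 A by blast
      have nonneg: "0 \<le> h\<^sub>0 \<phi>" "\<And>l. 0 \<le> h l \<phi>" by (auto simp: h\<^sub>0_def h_def)
      have "1 \<le> h\<^sub>0 \<phi> + (\<Sum>l\<in>L. h l \<phi>)"
      proof (cases "(u, M) \<in> A\<^sub>0")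
        case True
        have "restr {1..p} M = zero_struct sig"
        proof (rule ccontr)
          assume "restr {1..p} M \<noteq> zero_struct sig"
          then have "(u, M) \<in> A\<^sub>0 \<inter> {0..real T} \<times> visible sig p"
            using True MS u st by auto
          then have "u \<in> visible_times p T" unfolding visible_times_def by (rule rev_image_eqI) simp
          then show False using vis u by auto
        qed
        then have "(u, M) \<in> A\<^sub>0 \<inter> {0..real T} \<times>
            (invisible_hitting sig p m \<phi>)"
          using True MS u st nz by auto
        then have "h\<^sub>0 \<phi> = 1" unfolding h\<^sub>0_def by auto
        then show ?thesis using nonneg by (simp add: sum_nonneg)
      next
        case False
        then obtain l where l: "l \<in> L" "(u, M) \<in> A l" using M by blast
        then have "(u, M) \<in> A l \<inter> {q<..q'} \<times> hitting sig m \<phi>"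
          using MS u nz q q' by auto
        then have "h l \<phi> = 1" unfolding h_def by auto
        then have "1 \<le> (\<Sum>l\<in>L. h l \<phi>)" using member_le_sum[OF l(1), of "\<lambda>l. h l \<phi>"] L nonneg by auto
        then show ?thesis using nonneg(1) by simp
      qed
      then show ?thesis by (auto simp: of_bool_def)
    qed
    have "\<forall>\<^sub>F N in sequentially. sample_mean {1..m} N (h l) \<le> C m * (q' - q) + e'" if "l \<in> L" for l
      unfolding h_def by (rule small[OF that q(1) q'(1) q(2) qq(1) e'])
    then have "\<forall>\<^sub>F N in sequentially. \<forall>l\<in>L. sample_mean {1..m} N (h l) \<le> C m * (q' - q) + e'"
      using L by (intro eventually_ball_finite) auto
    moreover have "\<forall>\<^sub>F N in sequentially. sample_mean {1..m} N h\<^sub>0 \<le> e / 2" unfolding h\<^sub>0_def by (rule p)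
    ultimately show "\<forall>\<^sub>F N in sequentially. \<bar>sampling_density m B (x t) N - sampling_density m B (x s) N\<bar> \<le> e"
    proof eventually_elim
      case (elim N)
      have "\<bar>sampling_density m B (x t) N - sampling_density m B (x s) N\<bar> \<le>
          sample_mean {1..m} N (\<lambda>\<phi>. \<bar>of_bool (relabel {1..m} \<phi> (x t) = B) - of_bool (relabel {1..m} \<phi> (x s) = B)\<bar>)"
        unfolding sampling_density_def sample_mean_diff[symmetric] by (rule abs_sample_mean_le)
      also have "\<dots> \<le> sample_mean {1..m} N (\<lambda>\<phi>. h\<^sub>0 \<phi> + (\<Sum>l\<in>L. h l \<phi>))"
        by (rule sample_mean_mono) (rule diff)
      also have "\<dots> = sample_mean {1..m} N h\<^sub>0 + (\<Sum>l\<in>L. sample_mean {1..m} N (h l))"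
        by (simp add: sample_mean_add sample_mean_sum)
      also have "\<dots> \<le> e / 2 + (\<Sum>l\<in>L. C m * (q' - q) + e')"
        using elim by (intro add_mono sum_mono) auto
      also have "(\<Sum>l\<in>L. C m * (q' - q) + e') \<le> k * (C m * (3 * d) + e')"
      proof -
        have "C m * (q' - q) + e' \<le> C m * (3 * d) + e'" using qq C[of m] by (intro add_right_mono mult_left_mono)
        moreover have "0 \<le> C m * (q' - q) + e'" "0 \<le> C m * (3 * d) + e'" using C[of m] d e' qq(1) by simp_all
        ultimately show ?thesis unfolding sum_constant by (intro mult_mono) (auto simp: k_def)
      qed
      also have "k * (C m * (3 * d) + e') \<le> e / 2"
      proof -
        have "k * (a * (3 * (e / (12 * k * b)))) = e / 4 * (a / b)" if "b \<noteq> 0" for a b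
          using k that by (simp add: field_simps)
        then have "k * (C m * (3 * d)) = e / 4 * (C m / (C m + 1))" using C[of m] unfolding d_def by simp
        also have "\<dots> \<le> e / 4 * 1" using e C[of m] by (intro mult_left_mono) auto
        finally have "k * (C m * (3 * d)) \<le> e / 4" by simp
        moreover have "k * e' = e / 4" using k by (simp add: e'_def)
        ultimately show ?thesis by (simp add: distrib_left)
      qed
      finally show ?case by simp
    qed
  qed
  with d show ?thesis by blast
qed

text \<open>Comparison with a rational time shortly \<^emph>\<open>after\<close> \<open>t\<close>: whether or not \<open>t\<close> is itself the time of an atom, no visible
atom occurs in a short interval open at \<open>t\<close>.\<close>

lemma limit_exists:
  assumes t: "0 \<le> t" shows "climit_exists sig (x t)"
  unfolding climit_exists_def
proof (intro allI impI ballI)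
  fix m B assume B: "B \<in> structs sig {1..m}"
  have "convergent (sampling_density m B (x t))"
  proof (rule convergent_if_approximable)
    fix e :: real assume "0 < e"
    define T where "T = nat \<lceil>t\<rceil> + 1"
    have T: "t + 1 \<le> real T" using t by (simp add: T_def)
    obtain p d where d: "0 < d" and close: "steady m T p d e"
      using steady_exists[OF \<open>0 < e\<close>] by blast
    obtain c where c: "0 < c" "\<And>u. u \<in> visible_times p T \<Longrightarrow> u \<noteq> t \<Longrightarrow> c \<le> dist t u"
      using finite_set_avoid[OF finite_visible_times, of p T t] by blast
    obtain r where r: "r \<in> \<rat>" "t < r" "r < t + min 1 (min c d)"
      using Rats_dense_in_real[of t "t + min 1 (min c d)"] c d by auto
    have "visible_times p T \<inter> {t<..r} = {}" using c(2) r by (fastforce simp: dist_real_def)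
    then have "\<forall>\<^sub>F N in sequentially. \<bar>sampling_density m B (x r) N - sampling_density m B (x t) N\<bar> \<le> e"
      by (intro steadyD[OF close]) (use r t T in auto)
    then show "\<exists>b. convergent b \<and> (\<forall>\<^sub>F N in sequentially. \<bar>sampling_density m B (x t) N - b N\<bar> \<le> e)"
      using rational[OF r(1) _ B] r t by (intro exI[of _ "sampling_density m B (x r)"]) (auto simp: abs_minus_commute)
  qed
  then show "convergent (inj_density m B (x t))"
    unfolding convergent_def inj_density_tendsto_iff .
qed

text \<open>The atoms of \<open>A\<^sub>0\<close> visible on \<open>{1..p}\<close> occur at finitely many times up to \<open>T\<close>, and \<open>t\<close> is none of them, so an interval
around \<open>t\<close> contains none of these times.\<close>

lemma limit_continuous:
  assumes t: "0 \<le> t" "t \<notin> fst ` A\<^sub>0"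
  shows "limitin (E_top sig) (\<lambda>s. climit sig (x s)) (climit sig (x t)) (at t within {0..})"
proof (rule limitin_E_top)
  show "climit sig (x t) \<in> E_space sig" by (rule climit_in_E_space[OF x limit_exists]) (use t in auto)
  show "\<forall>\<^sub>F s in at t within {0..}. climit sig (x s) \<in> E_space sig"
    using climit_in_E_space[OF x limit_exists] by (auto simp: eventually_at_filter)
  fix m :: nat and B assume m: "1 \<le> m"
  define T where "T = nat \<lceil>t\<rceil> + 1"
  have T: "t + 1 \<le> real T" using t by (simp add: T_def)
  show "((\<lambda>s. measure (climit sig (x s)) (cyl sig m B)) \<longlongrightarrow> measure (climit sig (x t)) (cyl sig m B)) (at t within {0..})"
  proof (rule tendstoI)
    fix e :: real assume "0 < e"
    then have e2: "0 < e / 2" by simp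
    obtain p d where d: "0 < d" and close: "steady m T p d (e / 2)"
      using steady_exists[OF e2] by blast
    obtain c where c: "0 < c" "\<And>u. u \<in> visible_times p T \<Longrightarrow> u \<noteq> t \<Longrightarrow> c \<le> dist t u"
      using finite_set_avoid[OF finite_visible_times, of p T t] by blast
    have tv: "t \<notin> visible_times p T" using t(2) by (auto simp: visible_times_def)
    have "dist (measure (climit sig (x s)) (cyl sig m B)) (measure (climit sig (x t)) (cyl sig m B)) < e"
      if s: "0 \<le> s" "dist s t < min 1 (min c d)" for s
    proof -
      have far: "u \<notin> visible_times p T" if "\<bar>u - t\<bar> < c" for u
        using c(2)[of u] tv that by (auto simp: dist_real_def abs_minus_commute)
      have "\<forall>\<^sub>F N in sequentially. \<bar>sampling_density m B (x s) N - sampling_density m B (x t) N\<bar> \<le> e / 2"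
      proof (cases "s \<le> t")
        case True
        have "visible_times p T \<inter> {s<..t} = {}" using far s(2) by (auto simp: dist_real_def)
        then have "\<forall>\<^sub>F N in sequentially. \<bar>sampling_density m B (x t) N - sampling_density m B (x s) N\<bar> \<le> e / 2"
          using s True T by (intro steadyD[OF close]) (auto simp: dist_real_def)
        then show ?thesis by (simp add: abs_minus_commute)
      next
        case False
        have "visible_times p T \<inter> {t<..s} = {}" using far s(2) by (auto simp: dist_real_def)
        then show ?thesis using s False T t by (intro steadyD[OF close]) (auto simp: dist_real_def)
      qed
      moreover have "(\<lambda>N. \<bar>sampling_density m B (x s) N - sampling_density m B (x t) N\<bar>) \<longlonglongrightarrow>
          \<bar>measure (climit sig (x s)) (cyl sig m B) - measure (climit sig (x t)) (cyl sig m B)\<bar>"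
        by (intro tendsto_rabs tendsto_diff climit_density x limit_exists m s t)
      ultimately have "\<bar>measure (climit sig (x s)) (cyl sig m B) - measure (climit sig (x t)) (cyl sig m B)\<bar> \<le> e / 2"
        by (intro tendsto_upperbound) auto
      then show ?thesis using \<open>0 < e\<close> by (simp add: dist_real_def)
    qed
    then show "\<forall>\<^sub>F s in at t within {0..}. dist (measure (climit sig (x s)) (cyl sig m B)) (measure (climit sig (x t)) (cyl sig m B)) < e"
      unfolding eventually_at using c(1) d by (intro exI[of _ "min 1 (min c d)"]) auto
  qed
qed

end

section \<open>Continuity of the limit process\<close>

lemma space_time_intensity:
  assumes "sets \<nu> = sets (LN_borel sig)"
  shows "space (time_intensity \<nu>) = {0..} \<times> structs sig {0<..}"
  using sets_eq_imp_space_eq[OF assms] by (simp add: time_intensity_def space_pair_measure space_restrict_space)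

lemma (in prob_space) atoms_locally_finite:
  assumes D: "poisson_point_process M (time_intensity \<nu>) D"
    and \<nu>: "sigma_finite_measure \<nu>" "sets \<nu> = sets (LN_borel sig)"
    and fin: "\<And>n. emeasure \<nu> (visible sig n) < \<infinity>"
  shows "AE \<omega> in M. \<forall>T n. finite (D \<omega> \<inter> {0..real T} \<times> visible sig n)"
  unfolding AE_all_countable
proof (intro allI)
  fix T n :: nat
  have B: "visible sig n \<in> sets \<nu>"
    unfolding \<nu>(2) by (rule restr_event_sets)
  have J: "{0..real T} \<in> sets borel" "{0..real T} \<subseteq> {0..}" by auto
  note box = time_intensity_box[OF \<nu>(1) J B]
  show "AE \<omega> in M. finite (D \<omega> \<inter> {0..real T} \<times> visible sig n)"
    by (rule finitely_many_atoms[OF D box(1)]) (use box(2) fin[of n] in \<open>simp add: ennreal_mult_less_top\<close>)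
qed

theorem corollary4p21:
  fixes sig :: signature
    and P :: "'w measure" and X :: "real \<Rightarrow> 'w \<Rightarrow> rel_struct"
    and \<mu> :: "rel_struct measure"
    and \<nu>\<^sub>0 :: "rel_struct measure measure"
    and m :: "nat list \<Rightarrow> rel_struct measure"
    and \<tau> :: "nat multiset \<Rightarrow> nat \<Rightarrow> nat"
    and Q :: "'v measure" and \<pi> :: "'v \<Rightarrow> 'w"
    and D\<^sub>0 :: "'v \<Rightarrow> (real \<times> rel_struct) set"
    and D :: "nat list \<Rightarrow> 'v \<Rightarrow> (real \<times> rel_struct) set"
  assumes "sorted sig" and "sig \<noteq> []" and "last sig \<ge> 1"
    and "comb_Levy_process P sig X" and "exchangeable_process P sig X"
    and "rate_measure P sig X \<mu>"
    and "rate_decomposition sig \<tau> \<mu> \<nu>\<^sub>0 m"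
    \<comment> \<open>\<open>X\<close>, viewed on an extension \<open>Q\<close> of \<open>P\<close> that carries the Poisson point processes of its jumps\<close>
    and "prob_space Q" and "\<pi> \<in> measurable Q P" and "distr Q P \<pi> = P"
    and "driving_processes Q sig \<tau> \<nu>\<^sub>0 m D\<^sub>0 D"
    and "AE \<omega> in Q. canonical_path sig (D\<^sub>0 \<omega> \<union> (\<Union>l\<in>jump_partitions sig. D l \<omega>)) (\<lambda>t. X t (\<pi> \<omega>))"
  shows "AE \<omega> in Q.
     (\<forall>t\<ge>0. climit_exists sig (X t (\<pi> \<omega>))) \<and>
     (\<forall>t\<ge>0. t \<notin> fst ` D\<^sub>0 \<omega> \<longrightarrow>
        limitin (E_top sig) (\<lambda>s. climit sig (X s (\<pi> \<omega>))) (climit sig (X t (\<pi> \<omega>))) (at t within {0..}))"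
proof -
  note Levy = assms(4) and exch = assms(5) and rate = assms(6) and dec = assms(7)
    and \<pi> = assms(9) and distr = assms(10) and driving = assms(11) and path = assms(12)
  interpret Q: prob_space Q by fact
  interpret P: prob_space P using Levy by (simp add: comb_Levy_process_def)
  let ?L = "jump_partitions sig"
  let ?\<nu> = "mixture sig \<nu>\<^sub>0" and ?\<mu> = "\<lambda>l. symmetrized sig \<tau> l (m l)"
  define C where "C = (\<lambda>k. measure \<mu> (visible sig k))"
  have X: "X t \<in> measurable P (LN_borel sig)" if "0 \<le> t" for t
    using Levy that by (simp add: comb_Levy_process_def)
  have \<mu>: "finite_off_zero sig \<mu>" using rate by (simp add: rate_measure_def)
  have \<nu>\<^sub>0: "sets \<nu>\<^sub>0 = sets (E_borel sig)" "emeasure \<nu>\<^sub>0 {zero_limit sig} = 0"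
    using dec by (simp_all add: rate_decomposition_def)
  have L: "finite ?L" by (simp add: jump_partitions_def finite_int_partitions)
  have D\<^sub>0: "poisson_point_process Q (time_intensity ?\<nu>) D\<^sub>0"
    using driving unfolding driving_processes_def Let_def by (auto dest!: bspec[of _ _ None])
  have D: "poisson_point_process Q (time_intensity (?\<mu> l)) (D l)" if "l \<in> ?L" for l
    using driving that unfolding driving_processes_def Let_def by (auto dest!: bspec[of _ _ "Some l"])
  note le\<^sub>0 = mixture_le_rate[OF dec] and le = symmetrized_le_rate[OF dec]
  \<comment> \<open>Each driving measure is bounded by \<open>\<mu>\<close>, which makes it sigma-finite and the rates of all hits finite.\<close>
  have sf\<^sub>0: "sigma_finite_measure ?\<nu>"
    by (rule sigma_finite_below_rate[OF \<mu> sets_mixture le\<^sub>0])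
  have sf: "sigma_finite_measure (?\<mu> l)" if "l \<in> ?L" for l
    by (rule sigma_finite_below_rate[OF \<mu> sets_symmetrized le[OF that]])
  have hit_sets: "hitting sig k \<phi> \<in> sets (LN_borel sig)"
    if "\<phi> ` {1..k} \<subseteq> {0<..}" for k \<phi>
    by (rule relabel_event_sets[where Q = "\<lambda>A. A \<noteq> zero_struct sig"]) (use that in auto)
  have visible_sets: "visible sig n \<in> sets (LN_borel sig)" for n
    by (rule restr_event_sets)
  have visible: "emeasure \<mu> (visible sig n) < \<infinity>" for n
    using \<mu> by (simp add: finite_off_zero_def)
  have fin\<^sub>0: "AE \<omega> in Q. \<forall>T n. finite (D\<^sub>0 \<omega> \<inter> {0..real T} \<times> visible sig n)"
    by (rule Q.atoms_locally_finite[OF D\<^sub>0 sf\<^sub>0 sets_mixture]) (rule le_less_trans[OF le\<^sub>0[OF visible_sets] visible])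
  have "AE \<omega> in Q. \<forall>T n. finite (D l \<omega> \<inter> {0..real T} \<times> visible sig n)"
    if "l \<in> ?L" for l
    by (rule Q.atoms_locally_finite[OF D[OF that] sf[OF that] sets_symmetrized])
      (rule le_less_trans[OF le[OF that visible_sets] visible])
  then have fin: "AE \<omega> in Q. \<forall>l\<in>?L. \<forall>T n. finite (D l \<omega> \<inter> {0..real T} \<times> visible sig n)"
    by (subst AE_ball_countable[OF countable_finite[OF L]]) blast
  have invisible: "AE \<omega> in Q. \<forall>k T. \<forall>e>0. \<exists>p. \<forall>\<^sub>F N in sequentially. invisible_hit_share sig p k N (D\<^sub>0 \<omega>) (real T) \<le> e"
    unfolding AE_all_countable
  proof (intro allI)
    fix k T :: nat
    show "AE \<omega> in Q. \<forall>e>0. \<exists>p. \<forall>\<^sub>F N in sequentially. invisible_hit_share sig p k N (D\<^sub>0 \<omega>) (real T) \<le> e"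
    proof (rule Q.invisible_hits_vanish[OF D\<^sub>0 sf\<^sub>0 sets_mixture mixture_exchangeable[OF \<nu>\<^sub>0(1)]])
      show "emeasure ?\<nu> (hitting sig k \<phi>) < \<infinity>"
        if "\<phi> ` {1..k} \<subseteq> {0<..}" for \<phi>
        by (rule le_less_trans[OF le\<^sub>0[OF hit_sets[OF that]] finite_rate_of_hits[OF \<mu> that]])
      show "(\<lambda>p. measure ?\<nu> (invisible_hitting sig p k (\<lambda>i. p + i))) \<longlonglongrightarrow> 0"
        by (rule mixture_invisible_vanishes[OF \<nu>\<^sub>0]) (rule le_less_trans[OF le\<^sub>0[OF visible_sets] visible])
    qed simp
  qed
  \<comment> \<open>Abbreviated, so that the null sets can be collected over the countable index sets below.\<close>
  define bound where "bound = (\<lambda>\<omega> k l q q'. \<forall>e>0. \<forall>\<^sub>F N in sequentially. hit_share sig k N (D l \<omega>) {q<..q'} \<le> C k * (q' - q) + e)"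
  have "AE \<omega> in Q. bound \<omega> k l q q'" if l: "l \<in> ?L" and q: "0 \<le> q" "q \<le> q'" for k l q q'
  proof -
    have pos: "\<phi> ` {1..k} \<subseteq> {0<..}" if "\<phi> \<in> {1..k} \<rightarrow>\<^sub>E {0<..}" for \<phi> :: "nat \<Rightarrow> nat"
      using that by (auto simp: PiE_iff)
    obtain r where r: "r \<in> {1..last sig}" "l \<in> int_partitions r" using l by (auto simp: jump_partitions_def)
    then have ml: "finite_off_zero sig (m l)" "AE M in m l. substruct (canon_mset l) M = M"
      using dec unfolding rate_decomposition_def by blast+
    have \<tau>: "\<tau> s \<in> LN_perms" if "s \<in> label_multisets" for s
      using dec that unfolding rate_decomposition_def extends_canonical_def by blast
    show ?thesis
      unfolding bound_def
    proof (rule Q.independent_hits_mean[OF D[OF l] sf[OF l] sets_symmetrized _ _ _ q])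
      fix \<phi> assume \<phi>: "\<phi> \<in> {1..k} \<rightarrow>\<^sub>E {0::nat<..}"
      let ?H = "hitting sig k \<phi>"
      note le_H = le[OF l hit_sets[OF pos[OF \<phi>]]] and fin_H = finite_rate_of_hits[OF \<mu> pos[OF \<phi>]]
      show "emeasure (?\<mu> l) ?H < \<infinity>" by (rule le_less_trans[OF le_H fin_H])
      assume inj: "inj_on \<phi> {1..k}"
      have "measure (?\<mu> l) ?H \<le> measure \<mu> ?H"
        unfolding measure_def using le_H fin_H by (intro enn2real_mono) auto
      also have "\<dots> = C k"
        unfolding C_def by (rule rate_of_hits_exchangeable[OF rate X exch inj pos[OF \<phi>]])
      finally show "measure (?\<mu> l) ?H \<le> C k" .
    next
      fix \<phi> \<phi>' assume \<phi>: "\<phi> \<in> {1..k} \<rightarrow>\<^sub>E {0::nat<..}" "\<phi>' \<in> {1..k} \<rightarrow>\<^sub>E {0<..}" and disj: "\<phi> ` {1..k} \<inter> \<phi>' ` {1..k} = {}"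
      show "emeasure (?\<mu> l) {M \<in> structs sig {0<..}. relabel {1..k} \<phi> M \<noteq> zero_struct sig \<and> relabel {1..k} \<phi>' M \<noteq> zero_struct sig} = 0"
        by (rule symmetrized_hits_not_disjoint[OF ml(2) _ r(2) _ _ pos[OF \<phi>(1)] pos[OF \<phi>(2)] disj])
          (use ml(1) r(1) \<tau> in \<open>auto simp: finite_off_zero_def\<close>)
    qed
  qed
  then have "AE \<omega> in Q. 0 \<le> q \<longrightarrow> q \<le> q' \<longrightarrow> bound \<omega> k l q q'" if "l \<in> ?L" for k l q q'
    using that by (cases "0 \<le> q \<and> q \<le> q'") auto
  then have small: "AE \<omega> in Q. \<forall>k. \<forall>l\<in>?L. \<forall>q\<in>\<rat>. \<forall>q'\<in>\<rat>. 0 \<le> q \<longrightarrow> q \<le> q' \<longrightarrow> bound \<omega> k l q q'"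
    by (simp only: AE_all_countable AE_ball_countable[OF countable_finite[OF L]] AE_ball_countable[OF countable_rat]) blast
  have "AE \<omega> in Q. \<forall>k. \<forall>B\<in>structs sig {1..k}. convergent (sampling_density k B (X r (\<pi> \<omega>)))" if "0 \<le> r" for r
  proof -
    have "AE \<omega> in P. \<forall>k. \<forall>B\<in>structs sig {1..k}. convergent (sampling_density k B (X r \<omega>))"
      by (rule P.exchangeable_densities_converge[OF X[OF that] exchangeable_process_marginal[OF exch X[OF that] that]])
    then show ?thesis using AE_distrD[OF \<pi>] unfolding distr by blast
  qed
  then have "AE \<omega> in Q. 0 \<le> r \<longrightarrow> (\<forall>k. \<forall>B\<in>structs sig {1..k}. convergent (sampling_density k B (X r (\<pi> \<omega>))))" for r
    by (cases "0 \<le> r") auto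
  then have rational: "AE \<omega> in Q. \<forall>r\<in>\<rat>. 0 \<le> r \<longrightarrow> (\<forall>k. \<forall>B\<in>structs sig {1..k}. convergent (sampling_density k B (X r (\<pi> \<omega>))))"
    by (simp only: AE_ball_countable[OF countable_rat]) blast
  show ?thesis
  proof (rule AE_mp[OF path], rule AE_mp[OF fin\<^sub>0], rule AE_mp[OF fin], rule AE_mp[OF invisible],
      rule AE_mp[OF small], rule AE_mp[OF rational], rule AE_I2, intro impI)
    fix \<omega>
    assume \<omega>: "\<omega> \<in> space Q"
      and rational: "\<forall>r\<in>\<rat>. 0 \<le> r \<longrightarrow> (\<forall>k. \<forall>B\<in>structs sig {1..k}. convergent (sampling_density k B (X r (\<pi> \<omega>))))"
      and small: "\<forall>k. \<forall>l\<in>?L. \<forall>q\<in>\<rat>. \<forall>q'\<in>\<rat>. 0 \<le> q \<longrightarrow> q \<le> q' \<longrightarrow> bound \<omega> k l q q'"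
      and invisible: "\<forall>k T. \<forall>e>0. \<exists>p. \<forall>\<^sub>F N in sequentially. invisible_hit_share sig p k N (D\<^sub>0 \<omega>) (real T) \<le> e"
      and fin: "\<forall>l\<in>?L. \<forall>T n. finite (D l \<omega> \<inter> {0..real T} \<times> visible sig n)"
      and fin\<^sub>0: "\<forall>T n. finite (D\<^sub>0 \<omega> \<inter> {0..real T} \<times> visible sig n)"
      and path: "canonical_path sig (D\<^sub>0 \<omega> \<union> (\<Union>l\<in>?L. D l \<omega>)) (\<lambda>t. X t (\<pi> \<omega>))"
    have "driven_path sig (\<lambda>t. X t (\<pi> \<omega>)) (D\<^sub>0 \<omega>) ?L (\<lambda>l. D l \<omega>) C"
    proof (rule driven_path.intro)
      show "X t (\<pi> \<omega>) \<in> structs sig {0<..}" if "0 \<le> t" for t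
        using measurable_space[OF X[OF that] measurable_space[OF \<pi> \<omega>]] by simp
      show "D\<^sub>0 \<omega> \<subseteq> {0..} \<times> structs sig {0<..}"
        using D\<^sub>0 \<omega> unfolding poisson_point_process_def space_time_intensity[OF sets_mixture] by blast
      show "D l \<omega> \<subseteq> {0..} \<times> structs sig {0<..}" if "l \<in> ?L" for l
        using D[OF that] \<omega> unfolding poisson_point_process_def space_time_intensity[OF sets_symmetrized] by blast
      show "\<forall>\<^sub>F N in sequentially. hit_share sig k N (D l \<omega>) {q<..q'} \<le> C k * (q' - q) + e"
        if "l \<in> ?L" "q \<in> \<rat>" "q' \<in> \<rat>" "0 \<le> q" "q \<le> q'" "0 < e" for k l q q' e
      proof -
        have "bound \<omega> k l q q'" using small that by blast
        then show ?thesis unfolding bound_def using that(6) by blast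
      qed
      show "\<exists>p. \<forall>\<^sub>F N in sequentially. invisible_hit_share sig p k N (D\<^sub>0 \<omega>) (real T) \<le> e"
        if "0 < e" for k T e using invisible that by simp
      show "0 \<le> C k" for k by (simp add: C_def)
    qed (use path L fin fin\<^sub>0 rational in \<open>simp_all\<close>)
    then interpret driven_path sig "\<lambda>t. X t (\<pi> \<omega>)" "D\<^sub>0 \<omega>" ?L "\<lambda>l. D l \<omega>" C .
    show "(\<forall>t\<ge>0. climit_exists sig (X t (\<pi> \<omega>))) \<and>
     (\<forall>t\<ge>0. t \<notin> fst ` D\<^sub>0 \<omega> \<longrightarrow>
        limitin (E_top sig) (\<lambda>s. climit sig (X s (\<pi> \<omega>))) (climit sig (X t (\<pi> \<omega>))) (at t within {0..}))"
      using limit_exists limit_continuous by blast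
  qed
qed

end
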